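(* Let $m\ge1$, let $k_1,\dots,k_m$ be integers with $k_i\geq 2$ for all $i$, and let $P(z)\in\mathbb{K}[z]$ be a monic polynomial of degree $d\geq 2$ with zero coefficient of $z^{d-1}$. Let $Y=\{y_1^{k_1}\cdots y_m^{k_m}=P(z)\}\subset\mathbb{K}^{m+1}$. Then the group $\mathrm{Aut}(Y)$ is a torus if and only if all $k_i$ are different and one of the following occurs: 1) $P(z)=z^d$ and $\gcd(k_1,\dots,k_m,d)=1$; 2) there is no integer $v>1$ such that $P(z)=z^uQ(z^v)$ for some integer $u\ge0$ and some polynomial $Q\in\mathbb{K}[z]$, and $\gcd(k_1,\dots,k_m)=1$.
   Context: $\mathbb{K}$ is an algebraically closed field of characteristic zero. $\mathrm{Aut}(Y)$ is the group of automorphisms of the affine variety $Y$. A torus is an algebraic group isomorphic to $(\mathbb{K}^\times)^n$. *)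

theory Defs
  imports
    "HOL-Algebra.Bij"
    "HOL-Algebra.Product_Groups"
    "HOL-Computational_Algebra.Polynomial"
begin

text \<open>
  Affine space \<open>K\<^sup>I\<close> is \<open>I \<rightarrow>\<^sub>E UNIV\<close>, and a closed subset of it carries its reduced structure:
  a regular function is the restriction of a polynomial function. The ground field being infinite,
  polynomials and polynomial functions are the same thing.
\<close>

inductive_set subalgebra :: "('x \<Rightarrow> 'a::comm_ring_1) set \<Rightarrow> ('x \<Rightarrow> 'a) set"
  for G :: "('x \<Rightarrow> 'a) set"
where
  const: "(\<lambda>_. c) \<in> subalgebra G"
| gen: "g \<in> G \<Longrightarrow> g \<in> subalgebra G"
| add: "f \<in> subalgebra G \<Longrightarrow> g \<in> subalgebra G \<Longrightarrow> (\<lambda>x. f x + g x) \<in> subalgebra G"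
| mult: "f \<in> subalgebra G \<Longrightarrow> g \<in> subalgebra G \<Longrightarrow> (\<lambda>x. f x * g x) \<in> subalgebra G"

text \<open>Only the values of \<open>f\<close> on \<open>X\<close> matter.\<close>

definition regular_on :: "('x \<Rightarrow> 'a::comm_ring_1) set \<Rightarrow> 'x set \<Rightarrow> ('x \<Rightarrow> 'a) \<Rightarrow> bool" where
  "regular_on G X f \<longleftrightarrow> (\<exists>g\<in>subalgebra G. \<forall>x\<in>X. f x = g x)"

definition coords :: "'i set \<Rightarrow> (('i \<Rightarrow> 'a) \<Rightarrow> 'a) set" where
  "coords I = {\<lambda>x. x i | i. i \<in> I}"

definition regular_maps :: "'i set \<Rightarrow> ('i \<Rightarrow> 'a::comm_ring_1) set \<Rightarrow> 'j set \<Rightarrow> ('j \<Rightarrow> 'a) set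
    \<Rightarrow> (('i \<Rightarrow> 'a) \<Rightarrow> ('j \<Rightarrow> 'a)) set" where
  "regular_maps I X J Z = {f \<in> X \<rightarrow>\<^sub>E Z. \<forall>j\<in>J. regular_on (coords I) X (\<lambda>x. f x j)}"

definition Aut :: "'i set \<Rightarrow> ('i \<Rightarrow> 'a::comm_ring_1) set \<Rightarrow> (('i \<Rightarrow> 'a) \<Rightarrow> ('i \<Rightarrow> 'a)) monoid" where
  "Aut I Y = (BijGroup Y)
     \<lparr>carrier := {f \<in> Bij Y. f \<in> regular_maps I Y I Y \<and> restrict (inv_into Y f) Y \<in> regular_maps I Y I Y}\<rparr>"

definition Gm :: "'a::field monoid" where
  "Gm = \<lparr>carrier = UNIV - {0}, monoid.mult = (*), one = 1\<rparr>"

definition torus :: "nat \<Rightarrow> (nat \<Rightarrow> 'a::field) monoid" where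
  "torus n = product_group {..<n} (\<lambda>_. Gm)"

text \<open>
  Generators of the coordinate ring of \<open>torus n \<times> Y\<close> for \<open>Y \<subseteq> K\<^sup>I\<close>: Laurent polynomials in the torus
  variables, polynomials in the variables of \<open>Y\<close>.
\<close>

definition torus_prod_coords :: "nat \<Rightarrow> 'i set \<Rightarrow> ((nat \<Rightarrow> 'a::field) \<times> ('i \<Rightarrow> 'a) \<Rightarrow> 'a) set" where
  "torus_prod_coords n I =
     {\<lambda>(t, y). t j | j. j < n} \<union> {\<lambda>(t, y). inverse (t j) | j. j < n} \<union> {\<lambda>(t, y). y i | i. i \<in> I}"

text \<open>
  An algebraic group structure on \<open>Aut(Y)\<close> is understood to make the evaluation map
  \<open>Aut(Y) \<times> Y \<rightarrow> Y\<close> a morphism; a mere isomorphism of abstract groups would be a weaker condition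
  (for instance \<open>K\<^sup>\<times>\<close> and \<open>K\<^sup>\<times> \<times> K\<close> are isomorphic as abstract groups).
  Transporting the structure along an isomorphism from \<open>torus n\<close>, this says that \<open>\<phi>\<close> below is a
  group isomorphism for which the action of \<open>torus n\<close> on \<open>Y\<close> is algebraic.
\<close>

definition Aut_is_torus :: "'i set \<Rightarrow> ('i \<Rightarrow> 'a::field) set \<Rightarrow> bool" where
  "Aut_is_torus I Y \<longleftrightarrow>
     (\<exists>n. \<exists>\<phi>\<in>iso (torus n) (Aut I Y).
        \<forall>i\<in>I. regular_on (torus_prod_coords n I) (carrier (torus n) \<times> Y) (\<lambda>(t, y). \<phi> t y i))"

text \<open>Coordinate \<open>0\<close> is \<open>z\<close>, and coordinates \<open>1, \<dots>, m\<close> are \<open>y\<^sub>1, \<dots>, y\<^sub>m\<close>.\<close>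

definition suspension :: "nat \<Rightarrow> (nat \<Rightarrow> nat) \<Rightarrow> 'a::comm_ring_1 poly \<Rightarrow> (nat \<Rightarrow> 'a) set" where
  "suspension m k P = {x \<in> {0..m} \<rightarrow>\<^sub>E UNIV. (\<Prod>i=1..m. x i ^ k i) = poly P (x 0)}"

end

theory Submission
  imports Defs "Jordan_Normal_Form.Determinant"
begin

text \<open>
  Write \<open>y\<^sup>a\<close> for \<open>y\<^sub>1\<^bsup>a 1\<^esup> \<cdots> y\<^sub>m\<^bsup>a m\<^esup>\<close>, so that \<open>Y\<close> is \<open>y\<^sup>k = P(z)\<close>. The points \<open>t\<close> of
  the big torus that satisfy \<open>t\<^sup>k P(z) = P(t\<^sub>0 z)\<close> identically in \<open>z\<close> act on \<open>Y\<close> coordinatewise and form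
  a diagonal group \<open>D\<close> inside \<open>Aut(Y)\<close>. The proof shows that in the relevant situations \<open>Aut(Y)\<close>
  equals \<open>D\<close>, and reads off from the equations of \<open>D\<close> whether it is a torus.

  Necessity. A torus is commutative and divisible. If \<open>k\<^sub>i = k\<^sub>j\<close>, then exchanging \<open>y\<^sub>i\<close> and \<open>y\<^sub>j\<close> does not
  commute with \<open>D\<close>. An automorphism that commutes with the subgroup \<open>t\<^sup>k = 1\<close>, \<open>t\<^sub>0 = 1\<close> of \<open>D\<close> multiplies each
  \<open>y\<^sub>i\<close> by a polynomial in \<open>z\<close> and sends \<open>z\<close> to a polynomial in \<open>z\<close>; being invertible, it lies in \<open>D\<close>
  (\<open>centralizer_diagonal\<close>). Thus \<open>Aut(Y) = D\<close> is divisible. But \<open>D\<close> has a nontrivial finite quotient if \<open>P = z\<^sup>d\<close>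
  and \<open>k\<^sub>1, \<dots>, k\<^sub>m, d\<close> have a common divisor greater than \<open>1\<close>, and also if \<open>P \<noteq> z\<^sup>d\<close> and \<open>k\<^sub>1, \<dots>, k\<^sub>m\<close> have one or
  \<open>P = z\<^sup>u Q(z\<^sup>v)\<close> has a symmetry (\<open>conditions_if_torus\<close>).

  Sufficiency. Let \<open>\<psi>\<close> be an automorphism with coordinates \<open>f\<^sub>0\<close> (for \<open>z\<close>) and \<open>f\<^sub>1, \<dots>, f\<^sub>m\<close>, and look at
  them along an orbit \<open>t \<mapsto> (t\<^bsup>w i\<^esup> x\<^sub>i)\<^sub>i\<close> of a one-parameter subgroup of \<open>D\<close>, where they become Laurent
  polynomials in \<open>t\<close> with \<open>f\<^sub>1\<^bsup>k 1\<^esup> \<cdots> f\<^sub>m\<^bsup>k m\<^esup> = P(f\<^sub>0)\<close>. The singular locus of \<open>Y\<close> consists of the points where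
  \<open>z\<close> is a multiple root of \<open>P\<close>, and \<open>\<psi>\<close> preserves it (\<open>Sing_iff\<close>). Hence \<open>f\<^sub>0\<close> omits the multiple roots of
  \<open>P\<close> along such an orbit outside the singular locus; and because all \<open>k\<^sub>i \<ge> 2\<close>, it takes every simple root with
  multiplicity at least two.

  If \<open>P = z\<^sup>d\<close>, the omitted value is \<open>0\<close>, so no \<open>f\<^sub>i\<close> has a zero along the orbit and each \<open>f\<^sub>i\<close> is a single
  power of \<open>t\<close>. If \<open>P\<close> has no symmetry, then \<open>P\<close> either has a multiple root and another root, or at
  least three simple roots, and a degree count in the style of Riemann and Hurwitz forces \<open>f\<^sub>0\<close> to be constant
  along the orbits (\<open>z_constant_on_curve\<close>). So \<open>\<psi>\<close> acts on \<open>z\<close> by an affine map, \<open>P(f\<^sub>0)\<close> is constant along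
  orbits, and again each \<open>f\<^sub>i\<close> is a single power of \<open>t\<close> there. For a sufficiently general weight \<open>w\<close> this means
  that \<open>f\<^sub>i\<close> is a single monomial on \<open>Y\<close>. Comparing with the inverse automorphism, \<open>\<psi>\<close> permutes the coordinates
  up to factors, and since the \<open>k\<^sub>i\<close> are distinct, it is diagonal. Finally \<open>D\<close> is the kernel
  of a primitive character of a torus, hence a torus (\<open>torus_if_diagonal\<close>).

  Reading off monomials is possible because every regular function on \<open>Y\<close> is uniquely a sum of terms
  \<open>q\<^sub>a(z) y\<^sup>a\<close> in which \<open>y\<^sup>a\<close> is not divisible by \<open>y\<^sup>k\<close> (\<open>normal_form_exists\<close>, \<open>normal_form_unique\<close>); the
  uniqueness is the linear independence of characters on the torus \<open>t\<^sup>k = 1\<close>.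
\<close>

section \<open>Independence of characters, generic weights and complements of a primitive vector\<close>

text \<open>
  Artin's argument: evaluate the relation at \<open>f s t\<close> and subtract \<open>\<chi> b s\<close> times the relation at \<open>t\<close>. This removes
  the term of \<open>b\<close>, and \<open>s\<close> can be chosen so that a given other term survives if its coefficient is nonzero.
\<close>

lemma characters_independent:
  fixes \<chi> :: "'i \<Rightarrow> 'g \<Rightarrow> 'a::field"
  assumes "finite \<Phi>"
    and closed: "\<And>s t. s \<in> T \<Longrightarrow> t \<in> T \<Longrightarrow> f s t \<in> T"
    and hom: "\<And>a s t. a \<in> \<Phi> \<Longrightarrow> s \<in> T \<Longrightarrow> t \<in> T \<Longrightarrow> \<chi> a (f s t) = \<chi> a s * \<chi> a t"
    and nonzero: "\<And>a. a \<in> \<Phi> \<Longrightarrow> \<exists>t\<in>T. \<chi> a t \<noteq> 0"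
    and distinct: "\<And>a b. a \<in> \<Phi> \<Longrightarrow> b \<in> \<Phi> \<Longrightarrow> a \<noteq> b \<Longrightarrow> \<exists>t\<in>T. \<chi> a t \<noteq> \<chi> b t"
    and "\<And>t. t \<in> T \<Longrightarrow> (\<Sum>a\<in>\<Phi>. C a * \<chi> a t) = 0"
    and "a \<in> \<Phi>"
  shows "C a = 0"
  using assms
proof (induction \<Phi> arbitrary: C a rule: finite_induct)
  case (insert b \<Phi>)
  have zero: "C c = 0" if c: "c \<in> \<Phi>" for c
  proof -
    have "c \<noteq> b" using c insert.hyps by auto
    then obtain s where s: "s \<in> T" "\<chi> c s \<noteq> \<chi> b s" using insert.prems(4)[of c b] c by auto
    have "(\<Sum>a\<in>\<Phi>. C a * (\<chi> a s - \<chi> b s) * \<chi> a t) = 0" if t: "t \<in> T" for t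
    proof -
      have "(\<Sum>a\<in>insert b \<Phi>. C a * \<chi> a (f s t)) = 0"
        using insert.prems(1)[OF s(1) t] insert.prems(5) by blast
      moreover have "(\<Sum>a\<in>insert b \<Phi>. C a * \<chi> a (f s t)) = (\<Sum>a\<in>insert b \<Phi>. C a * \<chi> a s * \<chi> a t)"
        using insert.prems(2) s(1) t by (intro sum.cong) auto
      moreover have "\<chi> b s * (\<Sum>a\<in>insert b \<Phi>. C a * \<chi> a t) = 0" using insert.prems(5)[OF t] by simp
      ultimately have "(\<Sum>a\<in>insert b \<Phi>. C a * \<chi> a s * \<chi> a t) - \<chi> b s * (\<Sum>a\<in>insert b \<Phi>. C a * \<chi> a t) = 0"
        by simp
      then show ?thesis
        using insert.hyps by (simp add: sum_distrib_left sum_subtractf algebra_simps)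
    qed
    then have "C c * (\<chi> c s - \<chi> b s) = 0"
      using insert.IH[of "\<lambda>a. C a * (\<chi> a s - \<chi> b s)" c] insert.prems(1-4) c by blast
    then show ?thesis using s by simp
  qed
  obtain t where t: "t \<in> T" "\<chi> b t \<noteq> 0" using insert.prems(3) by blast
  have "C b * \<chi> b t = 0" using insert.prems(5)[OF t(1)] insert.hyps zero by simp
  then show ?case using zero t insert.prems(6) by auto
qed simp

text \<open>
  The vectors \<open>\<kappa>\<^sub>j e\<^sub>i\<^sub>0 - \<kappa>\<^sub>i\<^sub>0 e\<^sub>j\<close> are orthogonal to \<open>\<kappa>\<close>, and the condition on \<open>b\<close> (not proportional to \<open>\<kappa>\<close>)
  says that one of them pairs nontrivially with \<open>b\<close>. Combine them with coefficients \<open>N\<^sup>j\<close>: the pairing with \<open>b\<close>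
  is then the value at \<open>N\<close> of a nonzero polynomial, and some \<open>N\<close> is a root of none of the finitely many
  polynomials.
\<close>

lemma generic_weight:
  fixes \<kappa> :: "nat \<Rightarrow> int"
  assumes "finite I" "i0 \<in> I" "\<kappa> i0 \<noteq> 0" "finite B"
    and B: "\<And>b. b \<in> B \<Longrightarrow> \<exists>j\<in>I. \<kappa> j * b i0 \<noteq> \<kappa> i0 * b j"
  obtains w :: "nat \<Rightarrow> int" where "(\<Sum>i\<in>I. w i * \<kappa> i) = 0" "\<And>b. b \<in> B \<Longrightarrow> (\<Sum>i\<in>I. w i * b i) \<noteq> 0"
proof -
  define q :: "(nat \<Rightarrow> int) \<Rightarrow> int poly" where "q b = (\<Sum>j\<in>I. monom (\<kappa> j * b i0 - \<kappa> i0 * b j) j)" for b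
  have "q b \<noteq> 0" if b: "b \<in> B" for b
  proof -
    obtain j where j: "j \<in> I" "\<kappa> j * b i0 \<noteq> \<kappa> i0 * b j" using B[OF b] by blast
    have "coeff (q b) j = (\<Sum>l\<in>I. if j = l then \<kappa> j * b i0 - \<kappa> i0 * b j else 0)"
      by (auto simp: q_def coeff_sum intro!: sum.cong)
    also have "\<dots> = \<kappa> j * b i0 - \<kappa> i0 * b j" using j \<open>finite I\<close> by simp
    finally show ?thesis using j by auto
  qed
  then have "(\<Prod>b\<in>B. q b) \<noteq> 0" using \<open>finite B\<close> by simp
  then have "finite {x. poly (\<Prod>b\<in>B. q b) x = 0}" by (rule poly_roots_finite)
  then obtain N where N: "poly (\<Prod>b\<in>B. q b) N \<noteq> 0"
    using ex_new_if_finite[OF infinite_UNIV_int] by blast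
  \<comment> \<open>This is the sum over \<open>j\<close> of \<open>N\<^sup>j (\<kappa>\<^sub>j e\<^sub>i\<^sub>0 - \<kappa>\<^sub>i\<^sub>0 e\<^sub>j)\<close>.\<close>
  define w where "w i = (if i = i0 then (\<Sum>j\<in>I. N ^ j * \<kappa> j) else 0) - \<kappa> i0 * N ^ i" for i
  have w: "(\<Sum>i\<in>I. w i * b i) = poly (q b) N" for b
  proof -
    have "(\<Sum>i\<in>I. w i * b i) = (\<Sum>i\<in>I. (if i = i0 then (\<Sum>j\<in>I. N ^ j * \<kappa> j) * b i0 else 0) - \<kappa> i0 * N ^ i * b i)"
      by (intro sum.cong) (auto simp: w_def algebra_simps)
    also have "\<dots> = (\<Sum>j\<in>I. N ^ j * \<kappa> j) * b i0 - (\<Sum>i\<in>I. \<kappa> i0 * N ^ i * b i)"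
      using assms(1,2) by (simp add: sum_subtractf)
    also have "\<dots> = poly (q b) N"
      by (simp add: q_def poly_sum poly_monom sum_subtractf sum_distrib_left sum_distrib_right algebra_simps)
    finally show ?thesis .
  qed
  show ?thesis
  proof
    have "q \<kappa> = 0" by (simp add: q_def mult.commute)
    then show "(\<Sum>i\<in>I. w i * \<kappa> i) = 0" by (simp add: w)
    show "(\<Sum>i\<in>I. w i * b i) \<noteq> 0" if "b \<in> B" for b
      using N that \<open>finite B\<close> by (auto simp: w poly_prod)
  qed
qed

text \<open>
  A primitive vector \<open>\<kappa>\<close> is a row of a unimodular matrix: \<open>B\<close> holds the other rows, and \<open>u\<close> and the columns of
  \<open>A\<close> form the inverse matrix. The proof is Euclid's algorithm: as long as two entries are nonzero, one of
  them can be added to or subtracted from the other so that the sum of absolute values drops. With \<open>\<kappa>\<close> as exponent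
  vector, \<open>A\<close> and \<open>B\<close> parametrise the kernel of the character \<open>t\<^sup>\<kappa>\<close> of a torus by a smaller torus.
\<close>

lemma primitive_vector_complement:
  fixes \<kappa> :: "nat \<Rightarrow> int"
  assumes "finite I" "card I = Suc n" "Gcd (\<kappa> ` I) = 1"
  shows "\<exists>A B u. (\<forall>c<n. (\<Sum>l\<in>I. \<kappa> l * A l c) = 0) \<and> (\<Sum>l\<in>I. \<kappa> l * u l) = 1 \<and>
    (\<forall>c<n. \<forall>c'<n. (\<Sum>l\<in>I. B c l * A l c') = (if c = c' then 1 else 0)) \<and>
    (\<forall>i\<in>I. \<forall>l\<in>I. (\<Sum>c<n. A i c * B c l) = (if i = l then 1 else 0) - u i * \<kappa> l)"
  using assms(3)
proof (induction "nat (\<Sum>i\<in>I. \<bar>\<kappa> i\<bar>)" arbitrary: \<kappa> rule: less_induct)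
  case less
  have "\<exists>i\<in>I. \<kappa> i \<noteq> 0"
  proof (rule ccontr)
    assume "\<not> (\<exists>i\<in>I. \<kappa> i \<noteq> 0)"
    then have "\<kappa> ` I \<subseteq> {0}" by auto
    then have "Gcd (\<kappa> ` I) = 0" by simp
    then show False using less.prems by simp
  qed
  then obtain i0 where i0: "i0 \<in> I" "\<kappa> i0 \<noteq> 0" by blast
  show ?case
  proof (cases "\<exists>i\<in>I. i \<noteq> i0 \<and> \<kappa> i \<noteq> 0")
    case False
    then have z: "\<kappa> l = 0" if "l \<in> I" "l \<noteq> i0" for l using that by auto
    have "\<kappa> i0 dvd Gcd (\<kappa> ` I)" using z by (intro Gcd_greatest) force
    then have unit: "\<kappa> i0 * \<kappa> i0 = 1" using less.prems by (auto simp: zdvd1_eq abs_if split: if_splits)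
    have "card (I - {i0}) = n" using assms i0 by simp
    then obtain h where h: "bij_betw h {..<n} (I - {i0})"
      using ex_bij_betw_nat_finite[of "I - {i0}"] assms(1) by (auto simp: atLeast0LessThan)
    define A :: "nat \<Rightarrow> nat \<Rightarrow> int" where "A l c = (if l = h c then 1 else 0)" for l c
    define u where "u l = (if l = i0 then \<kappa> i0 else 0)" for l
    have hI: "h c \<in> I" "h c \<noteq> i0" if "c < n" for c using h that by (auto dest: bij_betwE)
    have 1: "(\<Sum>l\<in>I. \<kappa> l * A l c) = 0" if "c < n" for c
      using hI[OF that] z assms(1) by (auto simp: A_def intro!: sum.neutral)
    have 2: "(\<Sum>l\<in>I. \<kappa> l * u l) = 1"
    proof -
      have "(\<Sum>l\<in>I. \<kappa> l * u l) = (\<Sum>l\<in>I. if l = i0 then \<kappa> i0 * \<kappa> i0 else 0)"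
        by (intro sum.cong) (auto simp: u_def)
      then show ?thesis using i0 assms(1) unit by simp
    qed
    have 3: "(\<Sum>l\<in>I. A l c * A l c') = (if c = c' then 1 else 0)" if "c < n" "c' < n" for c c'
    proof -
      have "(\<Sum>l\<in>I. A l c * A l c') = (\<Sum>l\<in>I. if l = h c then (if c = c' then 1 else 0) else 0)"
        using h that by (intro sum.cong) (auto simp: A_def bij_betw_def inj_on_def)
      then show ?thesis using hI[OF that(1)] assms(1) by simp
    qed
    have 4: "(\<Sum>c<n. A i c * A l c) = (if i = l then 1 else 0) - u i * \<kappa> l" if il: "i \<in> I" "l \<in> I" for i l
    proof (cases "i = i0")
      case True
      have "(\<Sum>c<n. A i c * A l c) = 0" using True hI by (intro sum.neutral) (force simp: A_def)
      then show ?thesis using True il z unit by (auto simp: u_def)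
    next
      case False
      then have "i \<in> h ` {..<n}" using h il by (simp add: bij_betw_def)
      then obtain e where e: "e < n" "h e = i" by blast
      have "(\<Sum>c<n. A i c * A l c) = (\<Sum>c<n. if c = e then (if i = l then 1 else 0) else 0)"
        using h e by (intro sum.cong) (auto simp: A_def bij_betw_def inj_on_def)
      then show ?thesis using e False by (simp add: u_def)
    qed
    show ?thesis by (rule exI[of _ A], rule exI[of _ "\<lambda>c l. A l c"], rule exI[of _ u]) (use 1 2 3 4 in auto)
  next
    case True
    obtain i j where ij: "i \<in> I" "j \<in> I" "i \<noteq> j" "\<kappa> j \<noteq> 0" "\<bar>\<kappa> j\<bar> \<le> \<bar>\<kappa> i\<bar>"
    proof -
      obtain i1 where "i1 \<in> I" "i1 \<noteq> i0" "\<kappa> i1 \<noteq> 0" using True by blast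
      then show ?thesis using that[of i0 i1] that[of i1 i0] i0 by linarith
    qed
    \<comment> \<open>The sign that makes \<open>\<kappa> i - \<sigma> * \<kappa> j\<close> smaller than \<open>\<kappa> i\<close> in absolute value.\<close>
    define \<sigma> where "\<sigma> = sgn (\<kappa> i) * sgn (\<kappa> j)"
    define \<kappa>' where "\<kappa>' l = \<kappa> l - (if l = i then \<sigma> * \<kappa> j else 0)" for l
    have "\<kappa> i \<noteq> 0" using ij by auto
    then have dec: "\<bar>\<kappa>' i\<bar> < \<bar>\<kappa> i\<bar>" using ij by (auto simp: \<kappa>'_def \<sigma>_def sgn_if)
    have "(\<Sum>l\<in>I. \<bar>\<kappa>' l\<bar>) < (\<Sum>l\<in>I. \<bar>\<kappa> l\<bar>)"
      by (rule sum_strict_mono_ex1[OF assms(1)]) (use dec ij in \<open>auto simp: \<kappa>'_def\<close>)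
    then have less1: "nat (\<Sum>l\<in>I. \<bar>\<kappa>' l\<bar>) < nat (\<Sum>l\<in>I. \<bar>\<kappa> l\<bar>)"
      by (subst nat_less_eq_zless) (auto intro: sum_nonneg)
    have "Gcd (\<kappa>' ` I) dvd 1"
    proof -
      have d: "Gcd (\<kappa>' ` I) dvd \<kappa>' l" if "l \<in> I" for l using that by auto
      have dj: "Gcd (\<kappa>' ` I) dvd \<kappa> j" using d[OF ij(2)] ij(3) by (simp add: \<kappa>'_def)
      have "Gcd (\<kappa>' ` I) dvd \<kappa> l" if "l \<in> I" for l
      proof -
        have "\<kappa> l = \<kappa>' l + (if l = i then \<sigma> else 0) * \<kappa> j" by (simp add: \<kappa>'_def)
        then show ?thesis using d[OF that] dj by (metis dvd_add dvd_mult)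
      qed
      then have "Gcd (\<kappa>' ` I) dvd Gcd (\<kappa> ` I)" by (intro Gcd_greatest) auto
      then show ?thesis using less.prems by simp
    qed
    then have "Gcd (\<kappa>' ` I) = 1" by (metis Gcd_int_greater_eq_0 abs_of_nonneg zdvd1_eq)
    from less.hyps[OF less1 this] obtain A B u where
      a: "\<And>c. c < n \<Longrightarrow> (\<Sum>l\<in>I. \<kappa>' l * A l c) = 0" "(\<Sum>l\<in>I. \<kappa>' l * u l) = 1"
      and b: "\<And>c c'. c < n \<Longrightarrow> c' < n \<Longrightarrow> (\<Sum>l\<in>I. B c l * A l c') = (if c = c' then 1 else 0)"
      and ab: "\<And>i l. i \<in> I \<Longrightarrow> l \<in> I \<Longrightarrow> (\<Sum>c<n. A i c * B c l) = (if i = l then 1 else 0) - u i * \<kappa>' l"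
      by blast
    define A' where "A' l c = A l c - (if l = j then \<sigma> * A i c else 0)" for l c
    define u' where "u' l = u l - (if l = j then \<sigma> * u i else 0)" for l
    define B' where "B' c l = B c l + (if l = i then \<sigma> * B c j else 0)" for c l
    have sh: "(\<Sum>l\<in>I. \<kappa> l * (v l - (if l = j then \<sigma> * v i else 0))) = (\<Sum>l\<in>I. \<kappa>' l * v l)" for v :: "nat \<Rightarrow> int"
    proof -
      have "(\<Sum>l\<in>I. \<kappa> l * (v l - (if l = j then \<sigma> * v i else 0)))
          = (\<Sum>l\<in>I. \<kappa> l * v l - (if l = j then \<kappa> j * \<sigma> * v i else 0))"
        by (intro sum.cong) (auto simp: algebra_simps)
      also have "\<dots> = (\<Sum>l\<in>I. \<kappa> l * v l) - \<kappa> j * \<sigma> * v i"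
        using ij assms(1) by (simp add: sum_subtractf)
      also have "\<dots> = (\<Sum>l\<in>I. \<kappa> l * v l - (if l = i then \<kappa> j * \<sigma> * v i else 0))"
        using ij assms(1) by (simp add: sum_subtractf)
      also have "\<dots> = (\<Sum>l\<in>I. \<kappa>' l * v l)"
        by (intro sum.cong) (auto simp: \<kappa>'_def algebra_simps)
      finally show ?thesis .
    qed
    have 3: "(\<Sum>l\<in>I. B' c l * A' l c') = (\<Sum>l\<in>I. B c l * A l c')" for c c'
    proof -
      have "(\<Sum>l\<in>I. B' c l * A' l c') = (\<Sum>l\<in>I. B c l * A l c'
         + ((if l = i then \<sigma> * B c j * A i c' else 0) - (if l = j then \<sigma> * B c j * A i c' else 0)))"
        using ij by (intro sum.cong) (auto simp: A'_def B'_def algebra_simps)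
      then show ?thesis using ij assms(1) by (simp add: sum.distrib sum_subtractf)
    qed
    have 4: "(\<Sum>c<n. A' r c * B' c l) = (if r = l then 1 else 0) - u' r * \<kappa> l" if rl: "r \<in> I" "l \<in> I" for r l
    proof -
      let ?S = "\<lambda>r l. \<Sum>c<n. A r c * B c l"
      have "(\<Sum>c<n. A' r c * B' c l) = ?S r l + (if l = i then \<sigma> * ?S r j else 0)
         - (if r = j then \<sigma> * ?S i l else 0) - (if r = j \<and> l = i then \<sigma> * \<sigma> * ?S i j else 0)"
        by (auto simp: A'_def B'_def algebra_simps sum.distrib sum_subtractf sum_distrib_left)
      then show ?thesis using ij rl
        by (cases "r = j"; cases "l = i") (simp_all add: ab \<kappa>'_def u'_def algebra_simps)
    qed
    have "(\<Sum>l\<in>I. \<kappa> l * A' l c) = 0" if "c < n" for c using sh[of "\<lambda>l. A l c"] a(1)[OF that] by (simp add: A'_def)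
    moreover have "(\<Sum>l\<in>I. \<kappa> l * u' l) = 1" using sh[of u] a(2) by (simp add: u'_def)
    ultimately show ?thesis
      by (intro exI[of _ A'] exI[of _ B'] exI[of _ u']) (use 3 4 b in auto)
  qed
qed

section \<open>Laurent polynomials in one variable\<close>

text \<open>
  Laurent polynomials, as functions on the nonzero elements; the value at \<open>0\<close> is arbitrary.
\<close>

definition laurent :: "('a::field \<Rightarrow> 'a) \<Rightarrow> bool" where
  "laurent h \<longleftrightarrow> (\<exists>G p. \<forall>t. t \<noteq> 0 \<longrightarrow> h t = poly G t / t ^ p)"

lemma laurent_const: "laurent (\<lambda>t. c)"
  unfolding laurent_def by (rule exI[of _ "[:c:]"], rule exI[of _ 0]) simp

lemma laurent_powi: "laurent (\<lambda>t::'a::field. t powi n)"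
proof (cases "n \<ge> 0")
  case True
  then show ?thesis unfolding laurent_def
    by (intro exI[of _ "monom 1 (nat n)"] exI[of _ 0]) (simp add: poly_monom power_int_def)
next
  case False
  then show ?thesis unfolding laurent_def
    by (intro exI[of _ "1"] exI[of _ "nat (-n)"]) (simp add: power_int_def field_simps)
qed

lemma laurent_add:
  assumes "laurent f" "laurent g" shows "laurent (\<lambda>t. f t + g t)"
proof -
  obtain F p G q where "\<And>t. t \<noteq> 0 \<Longrightarrow> f t = poly F t / t ^ p" "\<And>t. t \<noteq> 0 \<Longrightarrow> g t = poly G t / t ^ q"
    using assms unfolding laurent_def by blast
  then show ?thesis unfolding laurent_def
    by (intro exI[of _ "F * monom 1 q + G * monom 1 p"] exI[of _ "p + q"])
       (simp add: poly_monom power_add field_simps)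
qed

lemma laurent_mult:
  assumes "laurent f" "laurent g" shows "laurent (\<lambda>t. f t * g t)"
proof -
  obtain F p G q where "\<And>t. t \<noteq> 0 \<Longrightarrow> f t = poly F t / t ^ p" "\<And>t. t \<noteq> 0 \<Longrightarrow> g t = poly G t / t ^ q"
    using assms unfolding laurent_def by blast
  then show ?thesis unfolding laurent_def
    by (intro exI[of _ "F * G"] exI[of _ "p + q"]) (simp add: power_add)
qed

lemma laurent_power: "laurent f \<Longrightarrow> laurent (\<lambda>t. f t ^ n)"
  by (induction n) (auto intro: laurent_const laurent_mult)

lemma laurent_prod: "(\<And>i. i \<in> I \<Longrightarrow> laurent (f i)) \<Longrightarrow> laurent (\<lambda>t. \<Prod>i\<in>I. f i t)"
  by (induction I rule: infinite_finite_induct) (auto intro: laurent_const laurent_mult)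

lemma laurent_poly: "laurent f \<Longrightarrow> laurent (\<lambda>t. poly P (f t))"
  by (induction P) (auto intro!: laurent_const laurent_add laurent_mult)

lemma poly_eqI_nonzero:
  fixes G H :: "'a::field_char_0 poly"
  assumes "\<And>t. t \<noteq> 0 \<Longrightarrow> poly G t = poly H t" shows "G = H"
proof (rule ccontr)
  assume "G \<noteq> H"
  then have "finite {t. poly (G - H) t = 0}" by (intro poly_roots_finite) simp
  moreover have "UNIV - {0} \<subseteq> {t. poly (G - H) t = 0}" using assms by auto
  ultimately have "finite (UNIV - {0 :: 'a})" by (rule rev_finite_subset)
  then show False using infinite_UNIV_char_0[where 'a='a] by simp
qed

lemma square_linear_dvd_imp_pderiv_root:
  fixes H :: "'a::idom poly"
  assumes "[:-x, 1:]\<^sup>2 dvd H" shows "poly H x = 0" "poly (pderiv H) x = 0"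
proof -
  define L where "L = [:-x, 1:]"
  have L: "poly L x = 0" "pderiv L = 1" by (auto simp: L_def pderiv_pCons)
  obtain R where "H = L ^ 2 * R" using assms unfolding L_def by blast
  then show "poly H x = 0" "poly (pderiv H) x = 0"
    using L by (simp_all add: power2_eq_square pderiv_mult)
qed

lemma linear_power_dvd_pderiv:
  fixes H :: "'a::idom poly"
  assumes "[:-x, 1:] ^ Suc e dvd H" shows "[:-x, 1:] ^ e dvd pderiv H"
proof -
  define L where "L = [:-x, 1:]"
  have L: "pderiv L = 1" by (auto simp: L_def pderiv_pCons)
  obtain R where "H = L ^ Suc e * R" using assms unfolding L_def by blast
  then have "pderiv H = L ^ e * (Polynomial.smult (of_nat (Suc e)) R + L * pderiv R)"
    using L by (simp add: pderiv_mult pderiv_power_Suc algebra_simps del: of_nat_Suc power_Suc) simp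
  then show ?thesis by (simp add: L_def)
qed

text \<open>
  Over an algebraically closed field divisibility is decided by root multiplicities; linear factors are split off
  one root at a time.
\<close>

lemma poly_dvd_if_order_le:
  fixes p q :: "'a::alg_closed_field poly"
  assumes "p \<noteq> 0" "q \<noteq> 0" "\<And>x. order x p \<le> order x q"
  shows "p dvd q"
  using assms
proof (induction p arbitrary: q rule: poly_root_order_induct)
  case (no_roots p)
  then have "degree p = 0" using alg_closed_imp_poly_has_root[of p] by fastforce
  then have "is_unit p" using no_roots.prems by (simp add: is_unit_iff_degree)
  then show ?case by (rule unit_imp_dvd)
next
  case (root p x n)
  have p0: "p \<noteq> 0" "[:-x, 1:] ^ n \<noteq> 0" using root.hyps by auto
  have "n \<le> order x ([:-x, 1:] ^ n * p)"
    using p0 by (simp add: order_mult order_power_n_n)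
  then have "n \<le> order x q" using root.prems(3)[of x] by linarith
  then obtain r where q: "q = [:-x, 1:] ^ n * r" using order_divides[of x n q] by auto
  then have r0: "r \<noteq> 0" using root.prems by auto
  have "order y p \<le> order y r" for y
    using root.prems(3)[of y] p0 r0 by (simp add: q order_mult)
  then have "p dvd r" using root.IH p0 r0 by blast
  then show ?case by (simp add: q)
qed auto

lemma monom_if_no_nonzero_root:
  fixes H :: "'a::{alg_closed_field, field_char_0} poly"
  assumes "\<And>x. x \<noteq> 0 \<Longrightarrow> poly H x \<noteq> 0"
  obtains c n where "c \<noteq> 0" "H = monom c n"
proof -
  have "H \<noteq> 0" using assms[of 1] by auto
  then obtain R where R: "H = [:-0, 1:] ^ order 0 H * R" "\<not> [:-0, 1:] dvd R"
    using order_decomp by blast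
  have "poly R x \<noteq> 0" for x
  proof (cases "x = 0")
    case True then show ?thesis using R(2) by (simp add: poly_eq_0_iff_dvd)
  next
    case False
    have "poly H x = x ^ order 0 H * poly R x" by (subst R(1)) simp
    then show ?thesis using assms[OF False] by auto
  qed
  then have "degree R = 0" using alg_closed_imp_poly_has_root[of R] by fastforce
  then obtain c where c: "R = [:c:]" using degree_eq_zeroE by blast
  have "H = monom c (order 0 H)"
    by (subst R(1)) (simp add: c monom_altdef mult.commute)
  moreover have "c \<noteq> 0" using \<open>H \<noteq> 0\<close> c R(1) by auto
  ultimately show ?thesis using that by blast
qed

text \<open>
  Where \<open>g = G / t\<^sup>p\<close> takes the value \<open>r\<close>, some \<open>F\<^sub>i\<close> vanishes, and \<open>k\<^sub>i \<ge> 2\<close> makes the product vanish doubly. Since \<open>r\<close>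
  is a simple root of \<open>P\<close>, the cofactor of \<open>g - r\<close> in \<open>P(g)\<close> does not vanish there, so \<open>g - r\<close> itself has
  the double zero.
\<close>

lemma laurent_double_root:
  fixes P G :: "'a::field_char_0 poly"
  assumes "finite I" and lF: "\<And>i. i \<in> I \<Longrightarrow> laurent (F i)" and k: "\<And>i. i \<in> I \<Longrightarrow> k i \<ge> 2"
    and eq: "\<And>t. t \<noteq> 0 \<Longrightarrow> (\<Prod>i\<in>I. F i t ^ k i) = poly P (poly G t / t ^ p)"
    and r: "poly P r = 0" "poly (pderiv P) r \<noteq> 0"
    and x: "x \<noteq> 0" "poly G x = r * x ^ p"
  shows "[:-x, 1:]\<^sup>2 dvd G - monom r p"
proof (cases "G - monom r p = 0")
  case False
  obtain S where S: "P = [:-r, 1:] * S" using r(1) by (auto simp: poly_eq_0_iff_dvd)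
  then have Sr: "poly S r \<noteq> 0" using r(2) by (auto simp: pderiv_mult pderiv_pCons simp del: mult_pCons_left)
  have "laurent (\<lambda>t. poly S (poly G t / t ^ p))"
    by (rule laurent_poly) (auto simp: laurent_def)
  then obtain K q where K: "\<And>t. t \<noteq> 0 \<Longrightarrow> poly S (poly G t / t ^ p) = poly K t / t ^ q"
    by (auto simp: laurent_def)
  have "(\<Prod>i\<in>I. F i x ^ k i) = 0" using eq[OF x(1)] r x by simp
  then obtain i where i: "i \<in> I" "F i x = 0" using \<open>finite I\<close> by auto
  obtain Gi pi where Gi: "\<And>t. t \<noteq> 0 \<Longrightarrow> F i t = poly Gi t / t ^ pi"
    using lF[OF i(1)] by (auto simp: laurent_def)
  have "laurent (\<lambda>t. F i t ^ (k i - 2) * (\<Prod>j\<in>I - {i}. F j t ^ k j))"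
    using lF i by (intro laurent_mult laurent_power laurent_prod) auto
  then obtain R \<rho> where R: "\<And>t. t \<noteq> 0 \<Longrightarrow> F i t ^ (k i - 2) * (\<Prod>j\<in>I - {i}. F j t ^ k j) = poly R t / t ^ \<rho>"
    by (auto simp: laurent_def)
  have split: "(\<Prod>i\<in>I. F i t ^ k i) = F i t ^ 2 * (F i t ^ (k i - 2) * (\<Prod>j\<in>I - {i}. F j t ^ k j))" for t
  proof -
    have "F i t ^ k i = F i t ^ 2 * F i t ^ (k i - 2)"
      using k[OF i(1)] by (metis le_add_diff_inverse power_add)
    then show ?thesis using \<open>finite I\<close> i by (simp add: prod.remove)
  qed
  have "Gi\<^sup>2 * R * monom 1 (p + q) = (G - monom r p) * (K * monom 1 (2 * pi + \<rho>))" (is "?L = _ * ?K")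
  proof (rule poly_eqI_nonzero)
    fix t :: 'a assume t: "t \<noteq> 0"
    have "(poly Gi t / t ^ pi) ^ 2 * (poly R t / t ^ \<rho>) = (poly G t / t ^ p - r) * (poly K t / t ^ q)"
      using eq[OF t] split[of t] Gi[OF t] R[OF t] K[OF t] by (simp add: S algebra_simps)
    then show "poly ?L t = poly ((G - monom r p) * ?K) t"
      using t by (simp add: poly_monom power_add power_mult power2_eq_square field_simps)
  qed
  moreover have "poly Gi x = 0" using Gi[OF x(1)] i(2) x(1) by simp
  then have "[:-x, 1:]\<^sup>2 dvd Gi\<^sup>2" by (intro dvd_power_same) (simp add: poly_eq_0_iff_dvd)
  ultimately have dvd: "[:-x, 1:]\<^sup>2 dvd (G - monom r p) * ?K" by (metis dvd_mult2)
  have "poly K x \<noteq> 0" using K[OF x(1)] Sr x by auto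
  then have Kx: "poly ?K x \<noteq> 0" using x by (simp add: poly_monom)
  then have "?K \<noteq> 0" by force
  then have "order x ((G - monom r p) * ?K) = order x (G - monom r p)"
    using False Kx by (subst order_mult) (auto simp: order_0I)
  then show ?thesis using dvd False \<open>?K \<noteq> 0\<close> by (simp add: order_divides del: mult_eq_0_iff) auto
qed auto

text \<open>
  If \<open>g = G / t\<^sup>p\<close> omits \<open>\<alpha>\<close>, then \<open>g - \<alpha> = c t\<^sup>e\<close>. For \<open>e \<noteq> 0\<close> such a function takes every value other
  than \<open>\<alpha>\<close>, and only with simple multiplicity, contrary to the hypothesis on \<open>\<beta>\<close>.
\<close>

lemma laurent_const_if_omits_value:
  fixes G :: "'a::{alg_closed_field, field_char_0} poly"
  assumes omit: "\<And>x. x \<noteq> 0 \<Longrightarrow> poly G x \<noteq> \<alpha> * x ^ p" and "\<beta> \<noteq> \<alpha>"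
    and double: "\<And>x. x \<noteq> 0 \<Longrightarrow> poly G x = \<beta> * x ^ p \<Longrightarrow> [:-x, 1:]\<^sup>2 dvd G - monom \<beta> p"
  shows "\<exists>c. \<forall>x. x \<noteq> 0 \<longrightarrow> poly G x / x ^ p = c"
proof -
  have "poly (G - monom \<alpha> p) x \<noteq> 0" if "x \<noteq> 0" for x using omit[OF that] by (simp add: poly_monom)
  then obtain c n where c: "c \<noteq> 0" "G - monom \<alpha> p = monom c n" by (rule monom_if_no_nonzero_root)
  then have G: "G = monom c n + monom \<alpha> p" by (simp add: algebra_simps)
  show ?thesis
  proof (cases "n = p")
    case True
    then show ?thesis by (intro exI[of _ "c + \<alpha>"]) (simp add: G poly_monom field_simps)
  next
    case False
    define \<gamma> where "\<gamma> = \<beta> - \<alpha>"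
    have \<gamma>: "\<gamma> \<noteq> 0" using \<open>\<beta> \<noteq> \<alpha>\<close> by (simp add: \<gamma>_def)
    have "\<exists>x. x \<noteq> 0 \<and> c * x ^ n = \<gamma> * x ^ p"
    proof (cases "n < p")
      case True
      obtain x where x: "x ^ (p - n) = c / \<gamma>" using nth_root_exists[of "p - n" "c / \<gamma>"] True by auto
      have "x ^ p = x ^ (p - n) * x ^ n" using True by (simp add: power_add[symmetric])
      moreover have "x \<noteq> 0" using x c \<gamma> True by (auto simp: power_0_left)
      ultimately show ?thesis using x \<gamma> by (intro exI[of _ x]) simp
    next
      case False
      then have np: "p < n" using \<open>n \<noteq> p\<close> by simp
      obtain x where x: "x ^ (n - p) = \<gamma> / c" using nth_root_exists[of "n - p" "\<gamma> / c"] np by auto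
      have "x ^ n = x ^ (n - p) * x ^ p" using np by (simp add: power_add[symmetric])
      moreover have "x \<noteq> 0" using x c \<gamma> np by (auto simp: power_0_left)
      ultimately show ?thesis using x c by (intro exI[of _ x]) simp
    qed
    then obtain x where x: "x \<noteq> 0" "c * x ^ n = \<gamma> * x ^ p" by blast
    have H: "G - monom \<beta> p = monom c n - monom \<gamma> p"
      by (simp add: G \<gamma>_def poly_eq_iff)
    have "poly G x = \<beta> * x ^ p" using x by (simp add: G poly_monom \<gamma>_def algebra_simps)
    then have "[:-x, 1:]\<^sup>2 dvd monom c n - monom \<gamma> p" using double[OF x(1)] H by simp
    then have "poly (pderiv (monom c n - monom \<gamma> p)) x = 0" by (rule square_linear_dvd_imp_pderiv_root)
    then have "x * (of_nat n * c * x ^ (n - 1)) = x * (of_nat p * \<gamma> * x ^ (p - 1))"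
      by (simp add: pderiv_diff pderiv_monom poly_monom)
    moreover have "x * (of_nat l * b * x ^ (l - 1)) = of_nat l * b * x ^ l" for l and b :: 'a
      by (cases l) auto
    ultimately have "of_nat n * (c * x ^ n) = of_nat p * (\<gamma> * x ^ p)" by (metis mult.assoc)
    then have "of_nat n = (of_nat p :: 'a)" using x c by (metis mult_eq_0_iff mult_right_cancel power_not_zero)
    then show ?thesis using False by simp
  qed
qed

text \<open>
  Up to a power of \<open>t\<close>, \<open>V\<close> is the numerator of \<open>t g'\<close> for \<open>g = G / t\<^sup>p\<close>. It does not change when a constant \<open>r\<close> is
  subtracted from \<open>g\<close>, so a root of \<open>G - r t\<^sup>p\<close> of multiplicity \<open>e \<ge> 2\<close> is a root of \<open>V\<^sup>2\<close> of multiplicity at least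
  \<open>2 (e - 1) \<ge> e\<close>. For different \<open>r\<close> these roots are different, so the product of all \<open>G - r t\<^sup>p\<close>
  divides \<open>V\<^sup>2\<close>. This is the part of the Riemann-Hurwitz formula that is needed.
\<close>

lemma sum_degree_le_of_double_roots:
  fixes G V :: "'a::{alg_closed_field, field_char_0} poly"
  assumes "finite J" "V \<noteq> 0"
    and V: "V * monom 1 N = pCons 0 (pderiv G) - Polynomial.smult (of_nat p) G"
    and at0: "\<And>r. r \<in> J \<Longrightarrow> poly (G - monom r p) 0 \<noteq> 0"
    and double: "\<And>r x. r \<in> J \<Longrightarrow> x \<noteq> 0 \<Longrightarrow> poly G x = r * x ^ p \<Longrightarrow> [:-x, 1:]\<^sup>2 dvd G - monom r p"
  shows "(\<Sum>r\<in>J. degree (G - monom r p)) \<le> 2 * degree V"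
proof -
  define H where "H r = G - monom r p" for r
  have H0: "H r \<noteq> 0" if "r \<in> J" for r using at0[OF that] by (auto simp: H_def)
  have W: "V * monom 1 N = pCons 0 (pderiv (H r)) - Polynomial.smult (of_nat p) (H r)" for r
    unfolding V H_def
    by (rule poly_eqI) (auto simp: coeff_pCons coeff_pderiv split: nat.splits)
  have ord: "order x (H r) \<le> order x (V\<^sup>2)" if r: "r \<in> J" for r x
  proof (cases "poly (H r) x = 0")
    case True
    have x: "x \<noteq> 0" using True at0[OF r] by (auto simp: H_def)
    have "[:-x, 1:]\<^sup>2 dvd H r" using double[OF r x] True by (simp add: H_def poly_monom)
    then have e2: "2 \<le> order x (H r)" using H0[OF r] by (simp add: order_divides)
    then obtain e where e: "order x (H r) = Suc e" by (cases "order x (H r)") auto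
    have Hd: "[:-x, 1:] ^ Suc e dvd H r" using order_1[of x "H r"] e by simp
    then have "[:-x, 1:] ^ e dvd pderiv (H r)" by (rule linear_power_dvd_pderiv)
    then have "[:-x, 1:] ^ e dvd pCons 0 (pderiv (H r))"
      using dvd_mult[of _ _ "[:0, 1:]"] by fastforce
    moreover have "[:-x, 1:] ^ e dvd H r" using Hd by (metis dvd_mult_right power_Suc)
    ultimately have "[:-x, 1:] ^ e dvd V * monom 1 N" unfolding W[of r] by (intro dvd_diff dvd_smult)
    moreover have "V * monom 1 N \<noteq> 0" using \<open>V \<noteq> 0\<close> by simp
    ultimately have "e \<le> order x (V * monom 1 N)" using order_divides by blast
    also have "\<dots> = order x V"
      using \<open>V \<noteq> 0\<close> x by (subst order_mult) (auto simp: order_0I poly_monom)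
    finally have "2 * e \<le> order x (V\<^sup>2)" using \<open>V \<noteq> 0\<close> by (simp add: power2_eq_square order_mult)
    then show ?thesis using e e2 by linarith
  qed (simp add: order_0I)
  have "(\<Prod>r\<in>J. H r) dvd V\<^sup>2"
  proof (rule poly_dvd_if_order_le)
    show "(\<Prod>r\<in>J. H r) \<noteq> 0" using H0 \<open>finite J\<close> by simp
    fix x
    show "order x (\<Prod>r\<in>J. H r) \<le> order x (V\<^sup>2)"
    proof (cases "\<exists>r\<in>J. poly (H r) x = 0")
      case True
      then obtain r where r: "r \<in> J" "poly (H r) x = 0" by blast
      have x: "x \<noteq> 0" using r at0[OF r(1)] by (auto simp: H_def)
      have "poly (H s) x \<noteq> 0" if "s \<in> J - {r}" for s
        using r that x by (auto simp: H_def poly_monom)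
      then have "poly (\<Prod>s\<in>J - {r}. H s) x \<noteq> 0" using \<open>finite J\<close> by (simp add: poly_prod)
      then have "order x (\<Prod>s\<in>J - {r}. H s) = 0" by (rule order_0I)
      moreover have "(\<Prod>s\<in>J. H s) = H r * (\<Prod>s\<in>J - {r}. H s)" using r \<open>finite J\<close> by (simp add: prod.remove)
      moreover have "(\<Prod>s\<in>J. H s) \<noteq> 0" using H0 \<open>finite J\<close> by simp
      ultimately have "order x (\<Prod>s\<in>J. H s) = order x (H r)"
        by (simp add: order_mult)
      then show ?thesis using ord[OF r(1)] by simp
    next
      case False
      then have "poly (\<Prod>r\<in>J. H r) x \<noteq> 0" using \<open>finite J\<close> by (simp add: poly_prod)
      then show ?thesis by (simp add: order_0I)
    qed
  qed (use \<open>V \<noteq> 0\<close> in simp)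
  then have "degree (\<Prod>r\<in>J. H r) \<le> degree (V\<^sup>2)" using \<open>V \<noteq> 0\<close> by (intro dvd_imp_degree_le) auto
  moreover have "degree (\<Prod>r\<in>J. H r) = (\<Sum>r\<in>J. degree (H r))"
    using H0 by (intro degree_prod_eq_sum_degree) auto
  ultimately show ?thesis using \<open>V \<noteq> 0\<close> by (simp add: H_def degree_power_eq)
qed

text \<open>
  If \<open>g\<close> has poles at both \<open>0\<close> and \<open>\<infinity>\<close>, three values give \<open>3 degree G \<le> 2 degree G\<close>. Otherwise two values suffice,
  because the bound on the degree of \<open>V\<close> improves by one, but one of the three must be discarded: the value of
  \<open>g\<close> at the end where it is finite, which may be taken there without producing a double root. The function \<open>t + 1/t\<close>
  with the values \<open>2\<close> and \<open>-2\<close> shows that two values do not suffice in general.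
\<close>

lemma laurent_const_if_three_double_values:
  fixes g :: "'a::{alg_closed_field, field_char_0} \<Rightarrow> 'a"
  assumes "laurent g" "finite S" "card S \<ge> 3"
    and double: "\<And>G p r x. (\<And>t. t \<noteq> 0 \<Longrightarrow> g t = poly G t / t ^ p) \<Longrightarrow> r \<in> S \<Longrightarrow> x \<noteq> 0 \<Longrightarrow> poly G x = r * x ^ p
      \<Longrightarrow> [:-x, 1:]\<^sup>2 dvd G - monom r p"
  shows "\<exists>c. \<forall>t. t \<noteq> 0 \<longrightarrow> g t = c"
proof -
  \<comment> \<open>A minimal \<open>p\<close> ensures that \<open>p > 0\<close> means a pole at \<open>0\<close>.\<close>
  define p where "p = (LEAST p. \<exists>G. \<forall>t. t \<noteq> 0 \<longrightarrow> g t = poly G t / t ^ p)"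
  have "\<exists>p G. \<forall>t. t \<noteq> 0 \<longrightarrow> g t = poly G t / t ^ p" using assms(1) unfolding laurent_def by blast
  then have "\<exists>G. \<forall>t. t \<noteq> 0 \<longrightarrow> g t = poly G t / t ^ p" unfolding p_def by (rule LeastI_ex)
  then obtain G where G: "\<And>t. t \<noteq> 0 \<Longrightarrow> g t = poly G t / t ^ p" by blast
  have min: "poly G 0 \<noteq> 0" if "p > 0"
  proof
    assume "poly G 0 = 0"
    then obtain G' where "G = [:-0, 1:] * G'" by (auto simp: poly_eq_0_iff_dvd)
    then have "\<forall>t. t \<noteq> 0 \<longrightarrow> g t = poly G' t / t ^ (p - 1)"
      using G that by (auto simp: power_eq_if[of _ p])
    then have "p \<le> p - 1" unfolding p_def by (intro Least_le) blast
    then show False using that by simp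
  qed
  note dbl = double[OF G]
  have two: "\<exists>J. J \<subseteq> S \<and> card J = 2 \<and> c \<notin> J" for c
  proof -
    have "card (S - {c}) \<ge> 2" using assms(2,3) by (cases "c \<in> S") auto
    then obtain J where "J \<subseteq> S - {c}" "card J = 2" by (rule obtain_subset_with_card_n)
    then show ?thesis by blast
  qed
  let ?W = "pCons 0 (pderiv G) - Polynomial.smult (of_nat p) G"
  have W: "coeff ?W n = (of_nat n - of_nat p) * coeff G n" for n
    by (cases n) (auto simp: coeff_pCons coeff_pderiv algebra_simps)
  show ?thesis
  proof (cases "?W = 0")
    case True
    then have "(of_nat n - of_nat p) * coeff G n = 0" for n using W[of n] by (metis coeff_0)
    then have "coeff G n = 0" if "n \<noteq> p" for n using that by auto
    then have "G = monom (coeff G p) p" by (intro poly_eqI) auto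
    then have "g t = coeff G p" if "t \<noteq> 0" for t using G[OF that] that by (metis nonzero_mult_div_cancel_right poly_monom power_not_zero)
    then show ?thesis by blast
  next
    case nz: False
    show ?thesis
    proof (cases "p = 0")
      case p0: True
      \<comment> \<open>Without a pole at \<open>0\<close>, \<open>V\<close> is the derivative itself, one degree below \<open>G\<close>; roots at \<open>0\<close> are avoided by the choice of \<open>J\<close>.\<close>
      obtain J where J: "J \<subseteq> S" "card J = 2" "poly G 0 \<notin> J" using two by blast
      have "pderiv G \<noteq> 0" using nz p0 by auto
      have "(\<Sum>r\<in>J. degree (G - monom r p)) \<le> 2 * degree (pderiv G)"
        using J p0 \<open>pderiv G \<noteq> 0\<close> dbl assms(2)
        by (intro sum_degree_le_of_double_roots[where N = 1])
           (auto simp: monom_altdef poly_monom finite_subset subset_iff)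
      moreover have "degree (G - monom r p) = degree G" for r
      proof -
        have "degree G > 0" using \<open>pderiv G \<noteq> 0\<close> by (metis bot_nat_0.not_eq_extremum pderiv_eq_0_iff)
        then have "degree (G - monom r p) = degree (- monom r p + G)" by simp
        also have "\<dots> = degree G" using \<open>degree G > 0\<close> p0 by (intro degree_add_eq_right) (simp add: monom_0)
        finally show ?thesis .
      qed
      ultimately have "2 * degree G \<le> 2 * (degree G - 1)" using J by (simp add: degree_pderiv)
      moreover have "degree G > 0" using \<open>pderiv G \<noteq> 0\<close> by (metis bot_nat_0.not_eq_extremum pderiv_eq_0_iff)
      ultimately show ?thesis by linarith
    next
      case p0: False
      have at0: "poly (G - monom r p) 0 \<noteq> 0" for r using min p0 by (simp add: poly_monom power_0_left)
      have bound: "(\<Sum>r\<in>J. degree (G - monom r p)) \<le> 2 * degree ?W" if "J \<subseteq> S" for J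
        using that dbl assms(2) nz at0
        by (intro sum_degree_le_of_double_roots[where N = 0]) (auto simp: finite_subset subset_iff)
      show ?thesis
      proof (cases "degree G > p")
        case True
        have "degree (G - monom r p) = degree G" for r
        proof -
          have "degree (monom r p) < degree G" using True degree_monom_le[of r p] by linarith
          then have "degree (- monom r p + G) = degree G" by (intro degree_add_eq_right) simp
          then show ?thesis by simp
        qed
        then have "card S * degree G \<le> 2 * degree ?W" using bound[of S] by simp
        moreover have "degree ?W \<le> degree G"
        proof (rule degree_le, safe)
          fix i assume "degree G < i" then show "coeff ?W i = 0" unfolding W by (simp add: coeff_eq_0)
        qed
        moreover have "3 * degree G \<le> card S * degree G" using assms(3) by (rule mult_le_mono1)
        ultimately show ?thesis using True by linarith
      next
        case False
        \<comment> \<open>Without a pole at infinity, the coefficient of \<open>V\<close> at \<open>t\<^sup>p\<close> cancels; the value at infinity is \<open>coeff G p\<close>.\<close>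
        obtain J where J: "J \<subseteq> S" "card J = 2" "coeff G p \<notin> J" using two by blast
        have "p \<le> degree (G - monom r p)" if "r \<in> J" for r
          using J that by (intro le_degree) auto
        then have "2 * p \<le> (\<Sum>r\<in>J. degree (G - monom r p))"
          using sum_bounded_below[of J p "\<lambda>r. degree (G - monom r p)"] J(2) by simp
        then have "p \<le> degree ?W" using bound[OF J(1)] by linarith
        moreover have "coeff ?W i = 0" if "i \<ge> p" for i
          unfolding W using that False by (cases "i = p") (auto simp: coeff_eq_0)
        then have "degree ?W < p" using p0 nz by (metis leading_coeff_0_iff leI)
        ultimately show ?thesis by simp
      qed
    qed
  qed
qed

section \<open>Polynomial functions on the suspension\<close>

abbreviation polyfuns :: "nat \<Rightarrow> ((nat \<Rightarrow> 'a) \<Rightarrow> 'a::comm_ring_1) set" where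
  "polyfuns m \<equiv> subalgebra (coords {0..m})"

lemma polyfuns_coord: "i \<le> m \<Longrightarrow> (\<lambda>x. x i) \<in> polyfuns m"
  by (rule subalgebra.gen) (auto simp: coords_def)

lemma subalgebra_sum: "(\<And>i. i \<in> I \<Longrightarrow> f i \<in> subalgebra G) \<Longrightarrow> (\<lambda>x. \<Sum>i\<in>I. f i x) \<in> subalgebra G"
  by (induction I rule: infinite_finite_induct) (auto intro: subalgebra.intros)

lemma subalgebra_prod: "(\<And>i. i \<in> I \<Longrightarrow> f i \<in> subalgebra G) \<Longrightarrow> (\<lambda>x. \<Prod>i\<in>I. f i x) \<in> subalgebra G"
  by (induction I rule: infinite_finite_induct) (auto intro: subalgebra.intros)

lemma subalgebra_power: "f \<in> subalgebra G \<Longrightarrow> (\<lambda>x. f x ^ n) \<in> subalgebra G"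
  by (induction n) (auto intro: subalgebra.intros)

lemma subalgebra_poly: "f \<in> subalgebra G \<Longrightarrow> (\<lambda>x. poly Q (f x)) \<in> subalgebra G"
proof (induction Q)
  case (pCons a Q)
  then show ?case using subalgebra.add[OF subalgebra.const[of a] subalgebra.mult[of f G]] by simp
qed (auto intro: subalgebra.const)

lemma subalgebra_diff: "f \<in> subalgebra G \<Longrightarrow> g \<in> subalgebra G \<Longrightarrow> (\<lambda>x. f x - g x) \<in> subalgebra G"
  using subalgebra.add[OF _ subalgebra.mult[OF subalgebra.const[of "-1"]], of f G g] by simp

lemma polyfuns_cong:
  assumes "h \<in> polyfuns m" "\<And>i. i \<le> m \<Longrightarrow> x i = y i"
  shows "h x = h y"
  using assms by induction (auto simp: coords_def)

lemma polyfuns_compose: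
  assumes "h \<in> polyfuns m" "\<And>i. i \<le> m \<Longrightarrow> (\<lambda>x. g x i) \<in> subalgebra G"
  shows "(\<lambda>x. h (g x)) \<in> subalgebra G"
  using assms by induction (auto simp: coords_def intro: subalgebra.intros)

text \<open>
  Otherwise \<open>x\<^bsup>a mod n\<^esup> - x\<^bsup>b mod n\<^esup>\<close> is a nonzero polynomial of degree less than \<open>n\<close> that vanishes at all roots of
  the squarefree polynomial \<open>x\<^sup>n - 1\<close>.
\<close>

lemma roots_of_unity_determine_exponent:
  fixes a b n :: nat
  assumes "n > 0" and eq: "\<And>\<zeta>::'a::{alg_closed_field, field_char_0}. \<zeta> ^ n = 1 \<Longrightarrow> \<zeta> ^ a = \<zeta> ^ b"
  shows "a mod n = b mod n"
proof (rule ccontr)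
  assume neq: "a mod n \<noteq> b mod n"
  define p :: "'a poly" where "p = monom 1 n - 1"
  define q :: "'a poly" where "q = monom 1 (a mod n) - monom 1 (b mod n)"
  have "coeff q (a mod n) = 1" using neq by (simp add: q_def)
  then have q0: "q \<noteq> 0" by auto
  have "coeff p n = 1" using \<open>n > 0\<close> by (simp add: p_def)
  then have p0: "p \<noteq> 0" and "degree p \<ge> n" by (auto intro: le_degree)
  have mod: "\<zeta> ^ (e mod n) = \<zeta> ^ e" if "\<zeta> ^ n = 1" for \<zeta> :: 'a and e
  proof -
    have "\<zeta> ^ e = \<zeta> ^ (n * (e div n) + e mod n)" by simp
    also have "\<dots> = \<zeta> ^ (e mod n)" unfolding power_add power_mult that by simp
    finally show ?thesis by simp
  qed
  have "p dvd q"
  proof (rule poly_dvd_if_order_le[OF p0 q0])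
    fix x
    show "order x p \<le> order x q"
    proof (cases "poly p x = 0")
      case True
      then have x: "x ^ n = 1" by (simp add: p_def poly_monom)
      then have "x \<noteq> 0" using \<open>n > 0\<close> by (auto simp: power_0_left)
      then have "poly (pderiv p) x \<noteq> 0" using \<open>n > 0\<close> by (simp add: p_def pderiv_diff pderiv_monom poly_monom)
      then have "\<not> [:-x, 1:]\<^sup>2 dvd p" using square_linear_dvd_imp_pderiv_root by blast
      then have "order x p < 2" using p0 by (simp add: order_divides)
      moreover have "poly q x = 0" using eq[OF x] mod[OF x] by (simp add: q_def poly_monom)
      then have "order x q > 0" using q0 by (simp add: order_gt_0_iff)
      ultimately show ?thesis by linarith
    qed (simp add: order_0I)
  qed
  then have "n \<le> degree q" using \<open>degree p \<ge> n\<close> q0 dvd_imp_degree_le[of p q] by linarith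
  moreover have "degree (monom (1::'a) (c mod n)) \<le> n - 1" for c
    using \<open>n > 0\<close> mod_less_divisor[of n c] degree_monom_le[of "1::'a" "c mod n"] by linarith
  then have "degree q \<le> n - 1" unfolding q_def by (intro degree_diff_le)
  ultimately show False using \<open>n > 0\<close> by linarith
qed

locale suspension_data =
  fixes m d :: nat and k :: "nat \<Rightarrow> nat" and P :: "'a::{alg_closed_field, field_char_0} poly"
  assumes m: "m \<ge> 1"
    and k: "\<And>i. i \<in> {1..m} \<Longrightarrow> k i \<ge> 2"
    and d: "d \<ge> 2" and degree: "degree P = d" and monic: "lead_coeff P = 1"
    and coeff: "coeff P (d - 1) = 0"
begin

abbreviation "Y \<equiv> suspension m k P"

definition ymon :: "(nat \<Rightarrow> nat) \<Rightarrow> (nat \<Rightarrow> 'a) \<Rightarrow> 'a" where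
  "ymon a x = (\<Prod>i=1..m. x i ^ a i)"

text \<open>
  The equation of \<open>Y\<close>. It is a function on the whole affine space, so that divisibility by it makes sense.
\<close>

definition F :: "(nat \<Rightarrow> 'a) \<Rightarrow> 'a" where
  "F x = ymon k x - poly P (x 0)"

text \<open>
  The exponents of monomials in \<open>y\<close> that are not divisible by \<open>y\<^sup>k\<close> and hence cannot be rewritten by the equation of
  \<open>Y\<close>.
\<close>

definition reduced :: "(nat \<Rightarrow> nat) set" where
  "reduced = {a. (\<forall>i. i \<notin> {1..m} \<longrightarrow> a i = 0) \<and> (\<exists>i\<in>{1..m}. a i < k i)}"

definition unit_exp :: "nat \<Rightarrow> nat \<Rightarrow> nat" where
  "unit_exp i j = (if j = i then 1 else 0)"

lemma P0: "P \<noteq> 0"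
  using degree d by auto

lemma nonroot_exists: "Q \<noteq> 0 \<Longrightarrow> \<exists>z::'a. poly Q z \<noteq> 0"
  using poly_all_0_iff_0 by blast

lemma ymon_add: "ymon (\<lambda>i. a i + b i) x = ymon a x * ymon b x"
  by (simp add: ymon_def power_add prod.distrib)

lemma ymon_mult: "ymon a (\<lambda>i. x i * y i) = ymon a x * ymon a y"
  by (simp add: ymon_def power_mult_distrib prod.distrib)

lemma ymon_scale: "ymon (\<lambda>i. l * a i) x = ymon a x ^ l"
  by (simp add: ymon_def power_mult[symmetric] mult.commute prod_power_distrib)

lemma ymon_zero [simp]: "ymon (\<lambda>i. 0) x = 1"
  by (simp add: ymon_def)

lemma ymon_cong: "(\<And>i. i \<in> {1..m} \<Longrightarrow> a i = b i) \<Longrightarrow> (\<And>i. i \<in> {1..m} \<Longrightarrow> x i = y i) \<Longrightarrow> ymon a x = ymon b y"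
  by (simp add: ymon_def)

lemma ymon_unit_exp: "i \<in> {1..m} \<Longrightarrow> ymon (unit_exp i) x = x i"
proof -
  assume i: "i \<in> {1..m}"
  have "ymon (unit_exp i) x = (\<Prod>j=1..m. if j = i then x i else 1)"
    unfolding ymon_def by (intro prod.cong) (auto simp: unit_exp_def)
  then show ?thesis using i by simp
qed

lemma ymon_polyfun: "ymon a \<in> polyfuns m"
  unfolding ymon_def[abs_def] by (intro subalgebra_prod subalgebra_power polyfuns_coord) auto

lemma F_polyfun: "F \<in> polyfuns m"
  unfolding F_def[abs_def] by (intro subalgebra_diff ymon_polyfun subalgebra_poly polyfuns_coord) auto

lemma suspension_iff: "x \<in> Y \<longleftrightarrow> x \<in> {0..m} \<rightarrow>\<^sub>E UNIV \<and> ymon k x = poly P (x 0)"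
  by (simp add: suspension_def ymon_def)

lemma ymon_k: "x \<in> Y \<Longrightarrow> ymon k x = poly P (x 0)"
  by (simp add: suspension_iff)

lemma F_zero: "x \<in> Y \<Longrightarrow> F x = 0"
  by (simp add: F_def ymon_k)

lemma reduced_zero: "(\<lambda>_. 0) \<in> reduced"
  using m k by (force simp: reduced_def intro!: bexI[of _ 1])

lemma reduced_unit_exp: "i \<in> {1..m} \<Longrightarrow> unit_exp i \<in> reduced"
  using k by (force simp: reduced_def unit_exp_def intro!: bexI[of _ i])

lemma reduced_eqI: "a \<in> reduced \<Longrightarrow> b \<in> reduced \<Longrightarrow> (\<And>i. i \<in> {1..m} \<Longrightarrow> a i = b i) \<Longrightarrow> a = b"
  by (rule ext) (metis (mono_tags, lifting) reduced_def mem_Collect_eq)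

lemma exponent_decomposition:
  obtains l a where "a \<in> reduced" "\<And>i. i \<in> {1..m} \<Longrightarrow> c i = a i + l * k i"
proof (induction "\<Sum>i=1..m. c i" arbitrary: c thesis rule: less_induct)
  case less
  show ?case
  proof (cases "\<exists>i\<in>{1..m}. c i < k i")
    case True
    then show ?thesis
      by (intro less.prems[of "\<lambda>i. if i \<in> {1..m} then c i else 0" 0]) (auto simp: reduced_def)
  next
    case False
    have lt: "(\<Sum>i=1..m. c i - k i) < (\<Sum>i=1..m. c i)"
    proof (rule sum_strict_mono_ex1)
      have 1: "1 \<in> {1..m}" using m by auto
      then have "k 1 \<le> c 1" using False by (auto simp: not_less)
      then have "c 1 - k 1 < c 1" using k[OF 1] by linarith
      then show "\<exists>i\<in>{1..m}. c i - k i < c i" using 1 by blast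
    qed auto
    show ?thesis
    proof (rule less.hyps[OF lt])
      fix a l assume a: "a \<in> reduced" "\<And>i. i \<in> {1..m} \<Longrightarrow> c i - k i = a i + l * k i"
      show thesis
      proof (rule less.prems[OF a(1), of "Suc l"])
        fix i assume i: "i \<in> {1..m}"
        have "k i \<le> c i" using False i by (auto simp: not_less)
        then show "c i = a i + Suc l * k i" using a(2)[OF i] by simp
      qed
    qed
  qed
qed

lemma ymon_decomposition:
  assumes "\<And>i. i \<in> {1..m} \<Longrightarrow> c i = a i + l * k i"
  shows "ymon c x = ymon a x * ymon k x ^ l"
proof -
  have "ymon c x = ymon (\<lambda>i. a i + l * k i) x" using assms by (intro ymon_cong) auto
  then show ?thesis by (simp add: ymon_add ymon_scale)
qed

definition normal_sum :: "(nat \<Rightarrow> nat) set \<Rightarrow> ((nat \<Rightarrow> nat) \<Rightarrow> 'a poly) \<Rightarrow> (nat \<Rightarrow> 'a) \<Rightarrow> 'a" where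
  "normal_sum \<Phi> q x = (\<Sum>a\<in>\<Phi>. poly (q a) (x 0) * ymon a x)"

text \<open>
  The remainder \<open>F x * E x\<close> is recorded, instead of working on \<open>Y\<close> only, because together with uniqueness it yields that
  the functions vanishing on \<open>Y\<close> are the multiples of \<open>F\<close>.
\<close>

definition has_normal_form :: "((nat \<Rightarrow> 'a) \<Rightarrow> 'a) \<Rightarrow> bool" where
  "has_normal_form f \<longleftrightarrow> (\<exists>\<Phi> q E. finite \<Phi> \<and> \<Phi> \<subseteq> reduced \<and> E \<in> polyfuns m \<and>
     (\<forall>x. f x = normal_sum \<Phi> q x + F x * E x))"

lemma normal_sum_polyfun: "normal_sum \<Phi> q \<in> polyfuns m"
  unfolding normal_sum_def[abs_def]
  by (intro subalgebra_sum subalgebra.mult subalgebra_poly ymon_polyfun polyfuns_coord) auto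

lemma has_normal_form_add:
  assumes "has_normal_form f" "has_normal_form g" shows "has_normal_form (\<lambda>x. f x + g x)"
proof -
  obtain \<Phi> q E where f: "finite \<Phi>" "\<Phi> \<subseteq> reduced" "E \<in> polyfuns m" "\<And>x. f x = normal_sum \<Phi> q x + F x * E x"
    using assms(1) unfolding has_normal_form_def by blast
  obtain \<Psi> r D where g: "finite \<Psi>" "\<Psi> \<subseteq> reduced" "D \<in> polyfuns m" "\<And>x. g x = normal_sum \<Psi> r x + F x * D x"
    using assms(2) unfolding has_normal_form_def by blast
  define s where "s a = (if a \<in> \<Phi> then q a else 0) + (if a \<in> \<Psi> then r a else 0)" for a
  have "normal_sum (\<Phi> \<union> \<Psi>) s x = normal_sum \<Phi> q x + normal_sum \<Psi> r x" for x
  proof -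
    have "normal_sum (\<Phi> \<union> \<Psi>) s x = (\<Sum>a\<in>\<Phi> \<union> \<Psi>. (if a \<in> \<Phi> then poly (q a) (x 0) * ymon a x else 0))
        + (\<Sum>a\<in>\<Phi> \<union> \<Psi>. (if a \<in> \<Psi> then poly (r a) (x 0) * ymon a x else 0))"
      by (simp add: normal_sum_def s_def sum.distrib[symmetric])
         (intro sum.cong, auto simp: algebra_simps)
    also have "(\<Sum>a\<in>\<Phi> \<union> \<Psi>. (if a \<in> \<Phi> then poly (q a) (x 0) * ymon a x else 0)) = normal_sum \<Phi> q x"
      unfolding normal_sum_def using f(1) g(1) by (intro sum.mono_neutral_cong_right) auto
    also have "(\<Sum>a\<in>\<Phi> \<union> \<Psi>. (if a \<in> \<Psi> then poly (r a) (x 0) * ymon a x else 0)) = normal_sum \<Psi> r x"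
      unfolding normal_sum_def using f(1) g(1) by (intro sum.mono_neutral_cong_right) auto
    finally show ?thesis .
  qed
  then have "f x + g x = normal_sum (\<Phi> \<union> \<Psi>) s x + F x * (E x + D x)" for x
    using f(4) g(4) by (simp add: algebra_simps)
  moreover have "(\<lambda>x. E x + D x) \<in> polyfuns m" using f g by (intro subalgebra.add)
  ultimately show ?thesis unfolding has_normal_form_def using f g
    by (intro exI[of _ "\<Phi> \<union> \<Psi>"] exI[of _ s] exI[of _ "\<lambda>x. E x + D x"]) auto
qed

lemma has_normal_form_multiple_of_F: "E \<in> polyfuns m \<Longrightarrow> has_normal_form (\<lambda>x. F x * E x)"
  unfolding has_normal_form_def by (rule exI[of _ "{}"]) (auto simp: normal_sum_def)

lemma has_normal_form_sum:
  "(\<And>i. i \<in> I \<Longrightarrow> has_normal_form (f i)) \<Longrightarrow> has_normal_form (\<lambda>x. \<Sum>i\<in>I. f i x)"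
proof (induction I rule: infinite_finite_induct)
  case empty
  then show ?case using has_normal_form_multiple_of_F[OF subalgebra.const[of 0]] by simp
next
  case (infinite I)
  then show ?case using has_normal_form_multiple_of_F[OF subalgebra.const[of 0]] by simp
qed (auto intro: has_normal_form_add)

text \<open>
  Split off \<open>l\<close> factors \<open>y\<^sup>k\<close> until the exponent is reduced and replace them by \<open>P\<^sup>l\<close>; the error
  \<open>(y\<^sup>k)\<^sup>l - P\<^sup>l\<close> is a multiple of \<open>y\<^sup>k - P = F\<close>.
\<close>

lemma has_normal_form_monomial: "has_normal_form (\<lambda>x. poly Q (x 0) * ymon c x)"
proof -
  obtain a l where a: "a \<in> reduced" "\<And>i. i \<in> {1..m} \<Longrightarrow> c i = a i + l * k i"
    using exponent_decomposition[of c] by metis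
  define S where "S x = (\<Sum>i<l. poly P (x 0) ^ (l - Suc i) * ymon k x ^ i)" for x
  have dec: "ymon c x = ymon a x * ymon k x ^ l" for x using a(2) by (rule ymon_decomposition)
  have "(\<lambda>x. poly Q (x 0) * ymon a x * S x) \<in> polyfuns m" unfolding S_def
    by (intro subalgebra.mult subalgebra_sum subalgebra_power subalgebra_poly ymon_polyfun polyfuns_coord) auto
  moreover have "poly Q (x 0) * ymon c x
      = normal_sum {a} (\<lambda>_. Q * P ^ l) x + F x * (poly Q (x 0) * ymon a x * S x)" for x
  proof -
    have "ymon k x ^ l - poly P (x 0) ^ l = F x * S x"
      unfolding F_def S_def by (rule power_diff_sumr2)
    then have "ymon k x ^ l = poly P (x 0) ^ l + F x * S x" by (simp add: algebra_simps)
    then show ?thesis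
      by (simp add: normal_sum_def dec distrib_left mult_ac)
  qed
  ultimately show ?thesis unfolding has_normal_form_def using a(1) by blast
qed

lemma has_normal_form_mult:
  assumes "has_normal_form f" "has_normal_form g" "f \<in> polyfuns m" "g \<in> polyfuns m"
  shows "has_normal_form (\<lambda>x. f x * g x)"
proof -
  obtain \<Phi> q E where f: "finite \<Phi>" "\<Phi> \<subseteq> reduced" "E \<in> polyfuns m" "\<And>x. f x = normal_sum \<Phi> q x + F x * E x"
    using assms(1) unfolding has_normal_form_def by blast
  obtain \<Psi> r D where g: "finite \<Psi>" "\<Psi> \<subseteq> reduced" "D \<in> polyfuns m" "\<And>x. g x = normal_sum \<Psi> r x + F x * D x"
    using assms(2) unfolding has_normal_form_def by blast
  have "has_normal_form (\<lambda>x. \<Sum>a\<in>\<Phi>. \<Sum>b\<in>\<Psi>. poly (q a * r b) (x 0) * ymon (\<lambda>i. a i + b i) x)"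
    by (intro has_normal_form_sum has_normal_form_monomial)
  moreover have "has_normal_form (\<lambda>x. F x * (E x * g x + normal_sum \<Phi> q x * D x))"
    by (intro has_normal_form_multiple_of_F subalgebra.add subalgebra.mult normal_sum_polyfun f g assms)
  ultimately have "has_normal_form (\<lambda>x. (\<Sum>a\<in>\<Phi>. \<Sum>b\<in>\<Psi>. poly (q a * r b) (x 0) * ymon (\<lambda>i. a i + b i) x)
      + F x * (E x * g x + normal_sum \<Phi> q x * D x))"
    by (rule has_normal_form_add)
  moreover have "(\<Sum>a\<in>\<Phi>. \<Sum>b\<in>\<Psi>. poly (q a * r b) (x 0) * ymon (\<lambda>i. a i + b i) x)
      = normal_sum \<Phi> q x * normal_sum \<Psi> r x" for x
    by (simp add: normal_sum_def sum_product ymon_add algebra_simps)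
  ultimately show ?thesis using f(4) g(4) by (simp add: algebra_simps)
qed

lemma normal_form_exists: "f \<in> polyfuns m \<Longrightarrow> has_normal_form f"
proof (induction rule: subalgebra.induct)
  case (const c)
  then show ?case using has_normal_form_monomial[of "[:c:]" "\<lambda>_. 0"] by simp
next
  case (gen g)
  then obtain i where i: "i \<le> m" "g = (\<lambda>x. x i)" by (auto simp: coords_def)
  show ?case
  proof (cases "i = 0")
    case True
    then show ?thesis using has_normal_form_monomial[of "[:0, 1:]" "\<lambda>_. 0"] i by simp
  next
    case False
    then have "i \<in> {1..m}" using i by auto
    then show ?thesis using has_normal_form_monomial[of 1 "unit_exp i"] i by (simp add: ymon_unit_exp)
  qed
qed (auto intro: has_normal_form_add has_normal_form_mult)

text \<open>
  The group that acts simply transitively on the fibre of \<open>z\<close> over each \<open>z\<close> with \<open>P(z) \<noteq> 0\<close>. The coordinate \<open>t 0\<close> is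
  left free here and set to \<open>1\<close> where the group acts.
\<close>

definition fibre_torus :: "(nat \<Rightarrow> 'a) set" where
  "fibre_torus = {t. (\<forall>i\<in>{1..m}. t i \<noteq> 0) \<and> ymon k t = 1}"

definition act :: "(nat \<Rightarrow> 'a) \<Rightarrow> (nat \<Rightarrow> 'a) \<Rightarrow> nat \<Rightarrow> 'a" where
  "act t x = (\<lambda>i. if i \<le> m then t i * x i else undefined)"

lemma act_apply [simp]: "i \<le> m \<Longrightarrow> act t x i = t i * x i"
  by (simp add: act_def)

lemma ymon_act: "ymon a (act t x) = ymon a t * ymon a x"
  by (simp add: ymon_mult[symmetric]) (rule ymon_cong, auto)

lemma act_in_Y:
  assumes "x \<in> Y" "ymon k t * poly P (x 0) = poly P (t 0 * x 0)"
  shows "act t x \<in> Y"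
proof -
  have "act t x \<in> {0..m} \<rightarrow>\<^sub>E UNIV" by (auto simp: act_def)
  then show ?thesis using assms by (simp add: suspension_iff[of "act t x"] ymon_act ymon_k)
qed

lemma fibre_torus_act: "t \<in> fibre_torus \<Longrightarrow> t 0 = 1 \<Longrightarrow> x \<in> Y \<Longrightarrow> act t x \<in> Y"
  by (rule act_in_Y) (auto simp: fibre_torus_def)

text \<open>
  A nonzero multiple of \<open>k\<close> would make one of the two exponents at least \<open>k\<close> in every entry.
\<close>

lemma reduced_eq_if_proportional_diff:
  assumes a: "a \<in> reduced" and b: "b \<in> reduced" and l: "\<And>i. i \<in> {1..m} \<Longrightarrow> int (a i) - int (b i) = int (k i) * l"
  shows "a = b"
proof -
  have "l = 0"
  proof (rule ccontr)
    assume "l \<noteq> 0"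
    then consider "l \<ge> 1" | "l \<le> -1" by linarith
    then show False
    proof cases
      case 1
      have "k i \<le> a i" if i: "i \<in> {1..m}" for i
      proof -
        have "int (k i) * 1 \<le> int (k i) * l" using 1 by (intro mult_left_mono) auto
        then show ?thesis using l[OF i] by linarith
      qed
      then show False using a by (fastforce simp: reduced_def)
    next
      case 2
      have "k i \<le> b i" if i: "i \<in> {1..m}" for i
      proof -
        have "int (k i) * l \<le> int (k i) * (-1)" using 2 by (intro mult_left_mono) auto
        then show ?thesis using l[OF i] by linarith
      qed
      then show False using b by (fastforce simp: reduced_def)
    qed
  qed
  then show "a = b" using l by (intro reduced_eqI[OF a b]) fastforce
qed

text \<open>
  Elements of the group whose only nontrivial entry is a \<open>k\<^sub>i\<close>-th root of unity show that \<open>a\<^sub>i - b\<^sub>i = k\<^sub>i l\<^sub>i\<close>.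
  Elements with the entries \<open>2\<^bsup>k j\<^esup>\<close> and \<open>2\<^bsup>- k i\<^esup>\<close> at \<open>i\<close> and \<open>j\<close> show that all \<open>l\<^sub>i\<close> are equal.
\<close>

lemma characters_distinct:
  assumes a: "a \<in> reduced" and b: "b \<in> reduced" and eq: "\<And>t. t \<in> fibre_torus \<Longrightarrow> ymon a t = ymon b t"
  shows "a = b"
proof -
  have one: "ymon c (\<lambda>l. if l = i then x else 1) = x ^ c i" if "i \<in> {1..m}" for c i and x :: 'a
  proof -
    have "ymon c (\<lambda>l. if l = i then x else 1) = (\<Prod>l=1..m. if l = i then x ^ c i else 1)"
      unfolding ymon_def by (intro prod.cong) auto
    then show ?thesis using that by simp
  qed
  have "int (k i) dvd int (a i) - int (b i)" if i: "i \<in> {1..m}" for i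
  proof -
    have "a i mod k i = b i mod k i"
    proof (rule roots_of_unity_determine_exponent)
      fix \<zeta> :: 'a assume z: "\<zeta> ^ k i = 1"
      then have "\<zeta> \<noteq> 0" using k[OF i] by (auto simp: power_0_left)
      then have "(\<lambda>l. if l = i then \<zeta> else 1) \<in> fibre_torus" using z one[OF i] by (auto simp: fibre_torus_def)
      then show "\<zeta> ^ a i = \<zeta> ^ b i" using eq one[OF i] by metis
    qed (use k[OF i] in auto)
    then have "int (a i) mod int (k i) = int (b i) mod int (k i)" by (metis zmod_int)
    then show ?thesis by (simp add: mod_eq_dvd_iff)
  qed
  then obtain l where l: "\<And>i. i \<in> {1..m} \<Longrightarrow> int (a i) - int (b i) = int (k i) * l i"
    unfolding dvd_def by metis
  have cross: "k j * a i + k i * b j = k j * b i + k i * a j" if ij: "i \<in> {1..m}" "j \<in> {1..m}" "i \<noteq> j" for i j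
  proof -
    define t :: "nat \<Rightarrow> 'a" where
      "t = (\<lambda>r. (if r = i then 2 ^ k j else 1) * (if r = j then inverse (2 ^ k i) else 1))"
    have t: "ymon c t = 2 ^ (k j * c i) * inverse (2 ^ (k i * c j))" for c
      unfolding t_def ymon_mult one[OF ij(1)] one[OF ij(2)] by (simp add: power_mult power_inverse)
    have "t \<in> fibre_torus" using ij by (simp add: fibre_torus_def t) (simp add: t_def mult.commute)
    then have "2 ^ (k j * a i) * inverse (2 ^ (k i * a j)) = (2::'a) ^ (k j * b i) * inverse (2 ^ (k i * b j))"
      using eq t by metis
    then have "(2::'a) ^ (k j * a i + k i * b j) = 2 ^ (k j * b i + k i * a j)"
      by (simp add: power_add field_simps)
    then have "of_nat (2 ^ (k j * a i + k i * b j)) = (of_nat (2 ^ (k j * b i + k i * a j)) :: 'a)"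
      by simp
    then have "(2::nat) ^ (k j * a i + k i * b j) = 2 ^ (k j * b i + k i * a j)"
      by (simp only: of_nat_eq_iff)
    then show ?thesis by simp
  qed
  have same: "l i = l 1" if i: "i \<in> {1..m}" for i
  proof (cases "i = 1")
    case False
    have 1: "1 \<in> {1..m}" using m by auto
    have "int (k 1 * a i + k i * b 1) = int (k 1 * b i + k i * a 1)" using cross[OF i 1 False] by simp
    then have "int (k 1) * (int (a i) - int (b i)) = int (k i) * (int (a 1) - int (b 1))"
      by (simp add: algebra_simps)
    then have "int (k 1) * (int (k i) * l i) = int (k i) * (int (k 1) * l 1)"
      by (simp only: l[OF i] l[OF 1])
    then have "(int (k 1) * int (k i)) * l i = (int (k 1) * int (k i)) * l 1"
      by (simp only: mult_ac)
    moreover have "int (k 1) * int (k i) \<noteq> 0" using k[OF i] k[OF 1] by auto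
    ultimately show ?thesis by (metis mult_cancel_left)
  qed simp
  have "int (a i) - int (b i) = int (k i) * l 1" if "i \<in> {1..m}" for i
    using l[OF that] same[OF that] by simp
  then show "a = b" by (rule reduced_eq_if_proportional_diff[OF a b])
qed

lemma characters_independent_on_orbit:
  assumes "finite \<Phi>" "\<Phi> \<subseteq> reduced" "\<And>t. t \<in> fibre_torus \<Longrightarrow> t 0 = 1 \<Longrightarrow> (\<Sum>a\<in>\<Phi>. C a * ymon a t) = 0" "a \<in> \<Phi>"
  shows "C a = 0"
proof (rule characters_independent[where C = C and a = a and \<Phi> = \<Phi> and T = fibre_torus and \<chi> = ymon and f = "\<lambda>s t i. s i * t i"])
  show "(\<lambda>i. s i * t i) \<in> fibre_torus" if "s \<in> fibre_torus" "t \<in> fibre_torus" for s t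
    using that by (auto simp: fibre_torus_def ymon_mult)
  show "\<exists>t\<in>fibre_torus. ymon a t \<noteq> 0" for a
    by (rule bexI[of _ "\<lambda>_. 1"]) (auto simp: fibre_torus_def ymon_def)
  show "\<exists>t\<in>fibre_torus. ymon a t \<noteq> ymon b t" if "a \<in> \<Phi>" "b \<in> \<Phi>" "a \<noteq> b" for a b
    using that characters_distinct assms(2) by blast
  show "(\<Sum>a\<in>\<Phi>. C a * ymon a t) = 0" if "t \<in> fibre_torus" for t
  proof -
    have t: "ymon a (t(0 := 1)) = ymon a t" for a by (rule ymon_cong) auto
    have "t(0 := 1) \<in> fibre_torus" using that by (auto simp: fibre_torus_def t)
    then show ?thesis using assms(3)[of "t(0 := 1)"] by (simp add: t)
  qed
qed (use assms in \<open>auto simp: ymon_mult\<close>)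

lemma point_over:
  obtains x where "x \<in> Y" "x 0 = z" "\<And>i. i \<in> {2..m} \<Longrightarrow> x i = 1"
    "poly P z \<noteq> 0 \<Longrightarrow> \<forall>i\<in>{1..m}. x i \<noteq> 0"
proof -
  obtain y where y: "y ^ k 1 = poly P z" using nth_root_exists[of "k 1" "poly P z"] k[of 1] m by auto
  define x where "x = (\<lambda>i. if i = 0 then z else if i = 1 then y else if i \<le> m then 1 else undefined)"
  have "ymon k x = (\<Prod>i=1..m. if i = 1 then y ^ k 1 else 1)"
    unfolding ymon_def by (intro prod.cong) (auto simp: x_def)
  then have "ymon k x = poly P z" using y m by simp
  then have "x \<in> Y" using m by (auto simp: suspension_iff x_def)
  moreover have "poly P z \<noteq> 0 \<Longrightarrow> \<forall>i\<in>{1..m}. x i \<noteq> 0" using y k[of 1] m by (auto simp: x_def power_0_left)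
  ultimately show ?thesis by (intro that[of x]) (auto simp: x_def)
qed

lemma nonzero_coords:
  assumes "x \<in> Y" shows "poly P (x 0) \<noteq> 0 \<longleftrightarrow> (\<forall>i\<in>{1..m}. x i \<noteq> 0)"
  using k by (fastforce simp: ymon_def power_0_left simp flip: ymon_k[OF assms])

lemma ymon_nonzero: "(\<And>i. i \<in> {1..m} \<Longrightarrow> x i \<noteq> 0) \<Longrightarrow> ymon a x \<noteq> 0"
  by (auto simp: ymon_def)

lemma normal_sum_act:
  assumes "t 0 = 1" shows "normal_sum \<Phi> q (act t x) = (\<Sum>a\<in>\<Phi>. (poly (q a) (x 0) * ymon a x) * ymon a t)"
  using assms by (simp add: normal_sum_def ymon_act algebra_simps)

text \<open>
  On the fibre over \<open>z\<close> with \<open>P(z) \<noteq> 0\<close> the normal form is a combination of distinct characters of the torus acting on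
  this fibre, with coefficients that are \<open>q\<^sub>a(z)\<close> up to nonzero factors. So each \<open>q\<^sub>a\<close> vanishes outside the roots of \<open>P\<close>.
\<close>

lemma normal_form_unique:
  assumes "finite \<Phi>" "\<Phi> \<subseteq> reduced" "\<And>x. x \<in> Y \<Longrightarrow> normal_sum \<Phi> q x = 0" "a \<in> \<Phi>"
  shows "q a = 0"
proof -
  have "poly (q a * P) z = 0" for z
  proof (cases "poly P z = 0")
    case False
    obtain x where x: "x \<in> Y" "x 0 = z" "\<forall>i\<in>{1..m}. x i \<noteq> 0" using point_over[of z] False by metis
    have "poly (q a) (x 0) * ymon a x = 0"
      using assms(1,2) _ assms(4)
    proof (rule characters_independent_on_orbit[where C = "\<lambda>a. poly (q a) (x 0) * ymon a x"])
      fix t assume t: "t \<in> fibre_torus" "t 0 = 1"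
      show "(\<Sum>a\<in>\<Phi>. poly (q a) (x 0) * ymon a x * ymon a t) = 0"
        using assms(3)[OF fibre_torus_act[OF t x(1)]] normal_sum_act[of t \<Phi> q x] t(2) by simp
    qed
    then show ?thesis using ymon_nonzero x by auto
  qed simp
  then have "q a * P = 0" using poly_all_0_iff_0 by blast
  then show ?thesis using P0 by simp
qed

lemma vanishing_ideal_principal:
  assumes "h \<in> polyfuns m" "\<And>x. x \<in> Y \<Longrightarrow> h x = 0"
  obtains E where "E \<in> polyfuns m" "\<And>x. h x = F x * E x"
proof -
  obtain \<Phi> q E where f: "finite \<Phi>" "\<Phi> \<subseteq> reduced" "E \<in> polyfuns m" "\<And>x. h x = normal_sum \<Phi> q x + F x * E x"
    using normal_form_exists[OF assms(1)] unfolding has_normal_form_def by blast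
  have "normal_sum \<Phi> q x = 0" if "x \<in> Y" for x using f(4)[of x] assms(2)[OF that] F_zero[OF that] by simp
  then have "q a = 0" if "a \<in> \<Phi>" for a using normal_form_unique[OF f(1,2)] that by blast
  then have "normal_sum \<Phi> q x = 0" for x by (simp add: normal_sum_def)
  then show ?thesis using f that by simp
qed

lemma normal_form_on_Y:
  assumes "h \<in> polyfuns m"
  obtains \<Phi> q where "finite \<Phi>" "\<Phi> \<subseteq> reduced" "\<And>x. x \<in> Y \<Longrightarrow> h x = normal_sum \<Phi> q x"
  using normal_form_exists[OF assms] F_zero unfolding has_normal_form_def by (metis add.right_neutral mult_zero_left)

text \<open>
  Comparison of coefficients for a single term: rewriting \<open>y\<^sup>c\<close> in reduced form replaces a factor \<open>(y\<^sup>k)\<^sup>l\<close> by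
  \<open>P\<^sup>l\<close>, and normal forms are unique.
\<close>

lemma monomial_eqD:
  assumes eq: "\<And>x. x \<in> Y \<Longrightarrow> poly Q (x 0) * ymon c x = poly R (x 0) * ymon e x"
    and e: "e \<in> reduced" and "R \<noteq> 0"
  obtains l where "\<And>i. i \<in> {1..m} \<Longrightarrow> c i = e i + l * k i" "Q * P ^ l = R"
proof -
  obtain a l where a: "a \<in> reduced" "\<And>i. i \<in> {1..m} \<Longrightarrow> c i = a i + l * k i"
    using exponent_decomposition[of c] by metis
  have dec: "ymon c x = ymon a x * ymon k x ^ l" for x using a(2) by (rule ymon_decomposition)
  have c: "poly Q (x 0) * ymon c x = poly (Q * P ^ l) (x 0) * ymon a x" if "x \<in> Y" for x
    by (simp add: dec ymon_k[OF that])
  have "a = e"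
  proof (rule ccontr)
    assume ne: "a \<noteq> e"
    define q where "q b = (if b = a then Q * P ^ l else - R)" for b
    have "normal_sum {a, e} q x = 0" if "x \<in> Y" for x
      using ne eq[OF that] c[OF that] by (auto simp: normal_sum_def q_def)
    then have "q e = 0" using normal_form_unique[of "{a, e}" q e] a e by auto
    then show False using ne \<open>R \<noteq> 0\<close> by (auto simp: q_def split: if_splits)
  qed
  have "normal_sum {e} (\<lambda>_. Q * P ^ l - R) x = 0" if "x \<in> Y" for x
    using eq[OF that] c[OF that] \<open>a = e\<close> by (simp add: normal_sum_def left_diff_distrib)
  then have "Q * P ^ l - R = 0" using normal_form_unique[of "{e}" "\<lambda>_. Q * P ^ l - R" e] e by auto
  then show ?thesis using a \<open>a = e\<close> by (intro that) auto
qed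

end

section \<open>Automorphisms preserve the singular locus\<close>

context suspension_data
begin

text \<open>
  Point derivations at \<open>p\<close> stand in for tangent vectors: they can be transported along a polynomial map by composition,
  without a chain rule for partial derivatives.
\<close>

definition derivation_at :: "(nat \<Rightarrow> 'a) \<Rightarrow> (((nat \<Rightarrow> 'a) \<Rightarrow> 'a) \<Rightarrow> 'a) \<Rightarrow> bool" where
  "derivation_at p \<Delta> \<longleftrightarrow> (\<forall>c. \<Delta> (\<lambda>x. c) = 0) \<and>
     (\<forall>f\<in>polyfuns m. \<forall>g\<in>polyfuns m. \<Delta> (\<lambda>x. f x + g x) = \<Delta> f + \<Delta> g \<and>
        \<Delta> (\<lambda>x. f x * g x) = f p * \<Delta> g + g p * \<Delta> f)"

lemma derivation_at_const: "derivation_at p \<Delta> \<Longrightarrow> \<Delta> (\<lambda>x. c) = 0"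
  and derivation_at_add: "derivation_at p \<Delta> \<Longrightarrow> f \<in> polyfuns m \<Longrightarrow> g \<in> polyfuns m \<Longrightarrow>
    \<Delta> (\<lambda>x. f x + g x) = \<Delta> f + \<Delta> g"
  and derivation_at_mult: "derivation_at p \<Delta> \<Longrightarrow> f \<in> polyfuns m \<Longrightarrow> g \<in> polyfuns m \<Longrightarrow>
    \<Delta> (\<lambda>x. f x * g x) = f p * \<Delta> g + g p * \<Delta> f"
  by (auto simp: derivation_at_def)

lemma derivation_at_diff:
  assumes D: "derivation_at p \<Delta>" and f: "f \<in> polyfuns m" and g: "g \<in> polyfuns m"
  shows "\<Delta> (\<lambda>x. f x - g x) = \<Delta> f - \<Delta> g"
proof -
  have "\<Delta> (\<lambda>x. (f x - g x) + g x) = \<Delta> (\<lambda>x. f x - g x) + \<Delta> g"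
    by (rule derivation_at_add[OF D subalgebra_diff[OF f g] g])
  then show ?thesis by simp
qed

lemma derivation_at_poly:
  assumes D: "derivation_at p \<Delta>" and f: "f \<in> polyfuns m"
  shows "\<Delta> (\<lambda>x. poly Q (f x)) = poly (pderiv Q) (f p) * \<Delta> f"
proof (induction Q)
  case 0
  then show ?case using derivation_at_const[OF D, of 0] by simp
next
  case (pCons a Q)
  have Q: "(\<lambda>x. poly Q (f x)) \<in> polyfuns m" by (rule subalgebra_poly[OF f])
  have "\<Delta> (\<lambda>x. a + f x * poly Q (f x)) = \<Delta> (\<lambda>x. f x * poly Q (f x))"
    using derivation_at_add[OF D subalgebra.const[of a] subalgebra.mult[OF f Q]] derivation_at_const[OF D]
    by simp
  then show ?case using derivation_at_mult[OF D f Q] pCons.IH by (simp add: pderiv_pCons algebra_simps)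
qed

lemma derivation_at_power:
  assumes "derivation_at p \<Delta>" "f \<in> polyfuns m"
  shows "\<Delta> (\<lambda>x. f x ^ n) = of_nat n * f p ^ (n - 1) * \<Delta> f"
  using derivation_at_poly[OF assms, of "monom 1 n"] by (simp add: poly_monom pderiv_monom)

lemma derivation_at_prod:
  assumes D: "derivation_at p \<Delta>" and "finite I" and "\<And>i. i \<in> I \<Longrightarrow> f i \<in> polyfuns m"
  shows "\<Delta> (\<lambda>x. \<Prod>i\<in>I. f i x) = (\<Sum>i\<in>I. (\<Prod>j\<in>I - {i}. f j p) * \<Delta> (f i))"
  using assms(2,3)
proof (induction I rule: finite_induct)
  case empty
  then show ?case using derivation_at_const[OF D] by simp
next
  case (insert i I)
  have "\<Delta> (\<lambda>x. \<Prod>j\<in>insert i I. f j x) = \<Delta> (\<lambda>x. f i x * (\<Prod>j\<in>I. f j x))"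
    using insert.hyps by simp
  also have "\<dots> = f i p * \<Delta> (\<lambda>x. \<Prod>j\<in>I. f j x) + (\<Prod>j\<in>I. f j p) * \<Delta> (f i)"
    using insert.prems by (intro derivation_at_mult[OF D] subalgebra_prod) auto
  also have "f i p * \<Delta> (\<lambda>x. \<Prod>j\<in>I. f j x) = (\<Sum>l\<in>I. (\<Prod>j\<in>insert i I - {l}. f j p) * \<Delta> (f l))"
  proof -
    have "(\<Prod>j\<in>insert i I - {l}. f j p) = f i p * (\<Prod>j\<in>I - {l}. f j p)" if "l \<in> I" for l
    proof -
      have "insert i I - {l} = insert i (I - {l})" using that insert.hyps by auto
      then show ?thesis using insert.hyps by simp
    qed
    then show ?thesis using insert by (simp add: sum_distrib_left mult.assoc)
  qed
  finally show ?case using insert.hyps by simp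
qed

lemma derivation_at_zero:
  assumes D: "derivation_at p \<Delta>" and "\<And>i. i \<le> m \<Longrightarrow> \<Delta> (\<lambda>x. x i) = 0" and "h \<in> polyfuns m"
  shows "\<Delta> h = 0"
  using assms(3)
proof induction
  case (const c) then show ?case by (rule derivation_at_const[OF D])
next
  case (gen g) then show ?case using assms(2) by (auto simp: coords_def)
next
  case (add f g) then show ?case using derivation_at_add[OF D] by simp
next
  case (mult f g) then show ?case using derivation_at_mult[OF D] by simp
qed

text \<open>
  The partial derivatives of \<open>F\<close>.
\<close>

definition grad :: "(nat \<Rightarrow> 'a) \<Rightarrow> nat \<Rightarrow> 'a" where
  "grad p i = (if i = 0 then - poly (pderiv P) (p 0)
     else (\<Prod>j\<in>{1..m} - {i}. p j ^ k j) * (of_nat (k i) * p i ^ (k i - 1)))"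

lemma derivation_at_F:
  assumes D: "derivation_at p \<Delta>"
  shows "\<Delta> F = (\<Sum>i\<le>m. grad p i * \<Delta> (\<lambda>x. x i))"
proof -
  have c: "(\<lambda>x. x i) \<in> polyfuns m" if "i \<le> m" for i using that by (rule polyfuns_coord)
  have "\<Delta> F = \<Delta> (ymon k) - \<Delta> (\<lambda>x. poly P (x 0))"
    unfolding F_def[abs_def] by (intro derivation_at_diff[OF D] ymon_polyfun subalgebra_poly c) auto
  also have "\<Delta> (\<lambda>x. poly P (x 0)) = poly (pderiv P) (p 0) * \<Delta> (\<lambda>x. x 0)"
    by (rule derivation_at_poly[OF D c]) simp
  also have "\<Delta> (ymon k) = (\<Sum>i=1..m. (\<Prod>j\<in>{1..m} - {i}. p j ^ k j) * \<Delta> (\<lambda>x. x i ^ k i))"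
    unfolding ymon_def[abs_def] by (intro derivation_at_prod[OF D] subalgebra_power c) auto
  also have "\<dots> = (\<Sum>i=1..m. grad p i * \<Delta> (\<lambda>x. x i))"
    by (intro sum.cong refl) (simp add: grad_def derivation_at_power[OF D c])
  also have "\<dots> - poly (pderiv P) (p 0) * \<Delta> (\<lambda>x. x 0) = (\<Sum>i\<in>insert 0 {1..m}. grad p i * \<Delta> (\<lambda>x. x i))"
    by (simp add: grad_def)
  also have "insert 0 {1..m} = {..m}" by auto
  finally show ?thesis .
qed

definition Sing :: "(nat \<Rightarrow> 'a) set" where
  "Sing = {x \<in> Y. poly P (x 0) = 0 \<and> poly (pderiv P) (x 0) = 0}"

text \<open>
  Since all \<open>k\<^sub>i \<ge> 2\<close>, the derivatives of \<open>y\<^sup>k\<close> vanish wherever some \<open>y\<^sub>i\<close> does, that is, wherever \<open>P(z) = 0\<close>.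
\<close>

lemma Sing_iff_grad:
  assumes "x \<in> Y" shows "x \<in> Sing \<longleftrightarrow> (\<forall>i\<le>m. grad x i = 0)"
proof
  assume x: "x \<in> Sing"
  show "\<forall>i\<le>m. grad x i = 0"
  proof safe
    fix i assume i: "i \<le> m"
    show "grad x i = 0"
    proof (cases "i = 0")
      case True
      then show ?thesis using x by (simp add: grad_def Sing_def)
    next
      case False
      obtain l where l: "l \<in> {1..m}" "x l = 0"
        using nonzero_coords[OF assms] x by (auto simp: Sing_def)
      have "x i ^ (k i - 1) = 0 \<or> (\<Prod>j\<in>{1..m} - {i}. x j ^ k j) = 0"
      proof (cases "l = i")
        case True
        then show ?thesis using k[OF l(1)] l by (simp add: power_0_left)
      next
        case False
        then show ?thesis using k[OF l(1)] l by (auto simp: power_0_left intro!: bexI[of _ l])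
      qed
      then show ?thesis using False by (auto simp: grad_def)
    qed
  qed
next
  assume g: "\<forall>i\<le>m. grad x i = 0"
  have "poly P (x 0) = 0"
  proof (rule ccontr)
    assume "poly P (x 0) \<noteq> 0"
    then have nz: "\<forall>i\<in>{1..m}. x i \<noteq> 0" using nonzero_coords[OF assms] by simp
    have "grad x 1 \<noteq> 0" using nz m k[of 1] by (auto simp: grad_def)
    then show False using g m by auto
  qed
  moreover have "poly (pderiv P) (x 0) = 0" using g[rule_format, of 0] by (simp add: grad_def)
  ultimately show "x \<in> Sing" using assms by (simp add: Sing_def)
qed

text \<open>
  The derivative in the direction \<open>v\<close>, as the linear coefficient of \<open>h\<close> along the line through \<open>x\<close>. The polynomial is
  unique because the field is infinite.
\<close>

definition dder :: "(nat \<Rightarrow> 'a) \<Rightarrow> (nat \<Rightarrow> 'a) \<Rightarrow> ((nat \<Rightarrow> 'a) \<Rightarrow> 'a) \<Rightarrow> 'a" where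
  "dder x v h = coeff (SOME H. \<forall>s. h (\<lambda>i. x i + s * v i) = poly H s) 1"

lemma dder_eqI:
  assumes "\<And>s. h (\<lambda>i. x i + s * v i) = poly H s"
  shows "dder x v h = coeff H 1"
proof -
  have "(SOME H. \<forall>s. h (\<lambda>i. x i + s * v i) = poly H s) = H"
    using assms by (intro some_equality) (auto simp: poly_eq_poly_eq_iff[symmetric])
  then show ?thesis by (simp add: dder_def)
qed

lemma polyfun_on_line:
  assumes "h \<in> polyfuns m"
  obtains H where "\<And>s. h (\<lambda>i. x i + s * v i) = poly H s"
  using assms
proof (induction arbitrary: thesis)
  case (const c)
  show ?case by (rule const[of "[:c:]"]) simp
next
  case (gen g)
  then obtain i where "g = (\<lambda>x. x i)" by (auto simp: coords_def)
  then show ?case by (intro gen(2)[of "[:x i, v i:]"]) simp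
next
  case (add f g)
  show ?case
    by (rule add.IH(1), rule add.IH(2)) (metis add.prems poly_add)
next
  case (mult f g)
  show ?case
    by (rule mult.IH(1), rule mult.IH(2)) (metis mult.prems poly_mult)
qed

lemma derivation_at_dder: "derivation_at x (dder x v)"
  unfolding derivation_at_def
proof (intro conjI allI ballI)
  show "dder x v (\<lambda>x. c) = 0" for c by (subst dder_eqI[of _ _ _ "[:c:]"]) auto
  fix f g :: "(nat \<Rightarrow> 'a) \<Rightarrow> 'a" assume fg: "f \<in> polyfuns m" "g \<in> polyfuns m"
  obtain A where A: "\<And>s. f (\<lambda>i. x i + s * v i) = poly A s" using polyfun_on_line[OF fg(1)] by blast
  obtain B where B: "\<And>s. g (\<lambda>i. x i + s * v i) = poly B s" using polyfun_on_line[OF fg(2)] by blast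
  show "dder x v (\<lambda>x. f x + g x) = dder x v f + dder x v g"
    by (subst dder_eqI[of _ _ _ "A + B"]) (auto simp: A B dder_eqI[OF A] dder_eqI[OF B])
  have "f x = coeff A 0" "g x = coeff B 0"
    using A[of 0] B[of 0] by (simp_all add: poly_0_coeff_0)
  then show "dder x v (\<lambda>x. f x * g x) = f x * dder x v g + g x * dder x v f"
    by (subst dder_eqI[of _ _ _ "A * B"]) (auto simp: A B dder_eqI[OF A] dder_eqI[OF B] coeff_mult)
qed

lemma dder_coord: "dder x v (\<lambda>x. x i) = v i"
  by (subst dder_eqI[of _ _ _ "[:x i, v i:]"]) auto

lemma dder_linear:
  assumes "h \<in> polyfuns m"
  shows "dder x v h = (\<Sum>j\<le>m. v j * dder x (\<lambda>i. if i = j then 1 else 0) h)"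
  using assms
proof induction
  case (const c)
  then show ?case by (simp add: derivation_at_const[OF derivation_at_dder])
next
  case (gen g)
  then obtain i where i: "i \<le> m" "g = (\<lambda>x. x i)" by (auto simp: coords_def)
  then show ?case by (simp add: dder_coord if_distrib cong: if_cong)
next
  case (add f g)
  then show ?case
    by (simp add: derivation_at_add[OF derivation_at_dder] algebra_simps sum.distrib)
next
  case (mult f g)
  then show ?case
    by (simp add: derivation_at_mult[OF derivation_at_dder] algebra_simps sum.distrib sum_distrib_left)
qed

text \<open>
  At a singular point every direction is tangent to \<open>Y\<close>, because \<open>F\<close> generates the ideal of \<open>Y\<close> and vanishes to
  second order there.
\<close>

lemma dder_vanishing:
  assumes "q \<in> Sing" "h \<in> polyfuns m" "\<And>x. x \<in> Y \<Longrightarrow> h x = 0"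
  shows "dder q v h = 0"
proof -
  have q: "q \<in> Y" using assms(1) by (simp add: Sing_def)
  obtain E where E: "E \<in> polyfuns m" "\<And>x. h x = F x * E x"
    using vanishing_ideal_principal[OF assms(2,3)] by blast
  have "dder q v F = 0"
    using assms(1) Sing_iff_grad[OF q] by (simp add: derivation_at_F[OF derivation_at_dder])
  then have "dder q v (\<lambda>x. F x * E x) = 0"
    using F_zero[OF q] by (simp add: derivation_at_mult[OF derivation_at_dder F_polyfun E(1)])
  moreover have "h = (\<lambda>x. F x * E x)" using E(2) by auto
  ultimately show ?thesis by simp
qed

end

lemma nontrivial_kernel_if_transpose_singular:
  fixes M :: "nat \<Rightarrow> nat \<Rightarrow> 'a::field"
  assumes "\<And>j. j \<le> m \<Longrightarrow> (\<Sum>i\<le>m. r i * M i j) = 0" "i0 \<le> m" "r i0 \<noteq> 0"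
  obtains c j0 where "\<And>i. i \<le> m \<Longrightarrow> (\<Sum>j\<le>m. c j * M i j) = 0" "j0 \<le> m" "c j0 \<noteq> 0"
proof -
  define A where "A = mat (Suc m) (Suc m) (\<lambda>(i, j). M i j)"
  have A: "A \<in> carrier_mat (Suc m) (Suc m)" by (simp add: A_def)
  have set: "{0..<Suc m} = {..m}" by auto
  have "transpose_mat A *\<^sub>v vec (Suc m) r = 0\<^sub>v (Suc m)"
  proof (rule eq_vecI)
    fix j assume "j < dim_vec (0\<^sub>v (Suc m) :: 'a vec)"
    then have j: "j < Suc m" by simp
    then have "(transpose_mat A *\<^sub>v vec (Suc m) r) $ j = (\<Sum>i\<in>{0..<Suc m}. M i j * r i)"
      by (simp add: A_def scalar_prod_def del: sum.op_ivl_Suc)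
    also have "\<dots> = 0" using assms(1)[of j] j unfolding set by (simp add: mult.commute)
    finally show "(transpose_mat A *\<^sub>v vec (Suc m) r) $ j = 0\<^sub>v (Suc m) $ j" using j by simp
  qed (simp add: A_def)
  moreover have "vec (Suc m) r \<noteq> 0\<^sub>v (Suc m)"
  proof
    assume "vec (Suc m) r = 0\<^sub>v (Suc m)"
    then have "vec (Suc m) r $ i0 = 0\<^sub>v (Suc m) $ i0" by simp
    then show False using assms by simp
  qed
  ultimately have "det (transpose_mat A) = 0"
    using det_0_iff_vec_prod_zero[OF transpose_carrier_mat[THEN iffD2, OF A]] vec_carrier by blast
  then have "det A = 0" using det_transpose[OF A] by simp
  then obtain v where v: "v \<in> carrier_vec (Suc m)" "v \<noteq> 0\<^sub>v (Suc m)" "A *\<^sub>v v = 0\<^sub>v (Suc m)"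
    using det_0_iff_vec_prod_zero[OF A] by blast
  then obtain j0 where j0: "j0 < Suc m" "v $ j0 \<noteq> 0" by (metis carrier_vecD eq_vecI index_zero_vec)
  have "(\<Sum>j\<le>m. v $ j * M i j) = 0" if "i \<le> m" for i
  proof -
    have "(A *\<^sub>v v) $ i = (\<Sum>j\<in>{0..<Suc m}. M i j * v $ j)"
      using that v(1) by (simp add: A_def scalar_prod_def del: sum.op_ivl_Suc)
    moreover have "(A *\<^sub>v v) $ i = 0" using v(3) that by simp
    ultimately show ?thesis unfolding set by (simp add: mult.commute)
  qed
  then show ?thesis using that[of "\<lambda>j. v $ j" j0] j0 by auto
qed

locale suspension_automorphism = suspension_data +
  fixes \<psi> \<psi>' :: "(nat \<Rightarrow> 'a) \<Rightarrow> nat \<Rightarrow> 'a" and f g :: "nat \<Rightarrow> (nat \<Rightarrow> 'a) \<Rightarrow> 'a"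
  assumes \<psi>: "\<And>x. x \<in> Y \<Longrightarrow> \<psi> x \<in> Y" and \<psi>': "\<And>x. x \<in> Y \<Longrightarrow> \<psi>' x \<in> Y"
    and left_inverse: "\<And>x. x \<in> Y \<Longrightarrow> \<psi>' (\<psi> x) = x"
    and right_inverse: "\<And>x. x \<in> Y \<Longrightarrow> \<psi> (\<psi>' x) = x"
    and f: "\<And>i. i \<le> m \<Longrightarrow> f i \<in> polyfuns m" and g: "\<And>i. i \<le> m \<Longrightarrow> g i \<in> polyfuns m"
    and f_eq: "\<And>i x. i \<le> m \<Longrightarrow> x \<in> Y \<Longrightarrow> \<psi> x i = f i x"
    and g_eq: "\<And>i x. i \<le> m \<Longrightarrow> x \<in> Y \<Longrightarrow> \<psi>' x i = g i x"
begin

lemma inverse_automorphism: "suspension_automorphism m d k P \<psi>' \<psi> g f"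
  using \<psi> \<psi>' left_inverse right_inverse f g f_eq g_eq by unfold_locales auto

text \<open>
  At a singular point \<open>q\<close> the tangent space of \<open>Y\<close> is the whole space of dimension \<open>m + 1\<close>. Transport along \<open>\<psi>'\<close> is
  injective on tangent vectors, because composing further with \<open>f\<close> gives back the coordinate functions on \<open>Y\<close>; so the
  tangent space at \<open>\<psi>' q\<close> has dimension \<open>m + 1\<close> as well. At a nonsingular point it would be contained in the kernel of
  the gradient. In coordinates, the Jacobian matrix \<open>M\<close> of \<open>\<psi>'\<close> at \<open>q\<close> would be singular, which yields a direction
  \<open>c \<noteq> 0\<close> that is transported to zero.
\<close>

lemma inverse_preserves_Sing:
  assumes q: "q \<in> Sing" shows "\<psi>' q \<in> Sing"
proof (rule ccontr)
  assume "\<psi>' q \<notin> Sing"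
  have qY: "q \<in> Y" using q by (simp add: Sing_def)
  define G where "G x = (\<lambda>i. g i x)" for x
  have Gp: "G x i = \<psi>' x i" if "i \<le> m" "x \<in> Y" for x i using g_eq that by (simp add: G_def)
  have comp: "(\<lambda>x. h (G x)) \<in> polyfuns m" if "h \<in> polyfuns m" for h
    by (rule polyfuns_compose[OF that]) (use g in \<open>simp add: G_def\<close>)
  have comp_eq: "h (G x) = h (\<psi>' x)" if "h \<in> polyfuns m" "x \<in> Y" for h x
    using that(1) by (rule polyfuns_cong) (use Gp that in auto)
  define \<Delta> where "\<Delta> v h = dder q v (\<lambda>x. h (G x))" for v h
  have D: "derivation_at (G q) (\<Delta> v)" for v
    using derivation_at_const[OF derivation_at_dder] derivation_at_add[OF derivation_at_dder comp comp]
      derivation_at_mult[OF derivation_at_dder comp comp]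
    by (auto simp: derivation_at_def \<Delta>_def)
  have grad_G: "grad (G q) i = grad (\<psi>' q) i" if "i \<le> m" for i
    using Gp qY that by (auto simp: grad_def intro!: prod.cong)
  obtain i0 where i0: "i0 \<le> m" "grad (\<psi>' q) i0 \<noteq> 0"
    using \<open>\<psi>' q \<notin> Sing\<close> Sing_iff_grad[OF \<psi>'[OF qY]] by blast
  define M where "M i j = dder q (\<lambda>i. if i = j then 1 else 0) (g i)" for i j
  have rM: "(\<Sum>i\<le>m. grad (\<psi>' q) i * M i j) = 0" for j
  proof -
    have "\<Delta> (\<lambda>i. if i = j then 1 else 0) F = (\<Sum>i\<le>m. grad (\<psi>' q) i * M i j)"
      unfolding derivation_at_F[OF D]
      by (intro sum.cong refl) (simp add: grad_G, simp add: \<Delta>_def M_def G_def)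
    moreover have "\<Delta> (\<lambda>i. if i = j then 1 else 0) F = 0"
      unfolding \<Delta>_def using q comp[OF F_polyfun]
      by (rule dder_vanishing) (simp add: comp_eq[OF F_polyfun] F_zero \<psi>')
    ultimately show ?thesis by simp
  qed
  obtain c j0 where c: "\<And>i. i \<le> m \<Longrightarrow> (\<Sum>j\<le>m. c j * M i j) = 0" "j0 \<le> m" "c j0 \<noteq> 0"
    using nontrivial_kernel_if_transpose_singular[of m "grad (\<psi>' q)" M i0] rM i0 by metis
  have coord_zero: "\<Delta> c (\<lambda>x. x i) = 0" if "i \<le> m" for i
  proof -
    have "\<Delta> c (\<lambda>x. x i) = dder q c (g i)" by (simp add: \<Delta>_def G_def)
    also have "\<dots> = (\<Sum>j\<le>m. c j * M i j)" unfolding M_def by (rule dder_linear[OF g[OF that]])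
    finally show ?thesis using c(1)[OF that] by simp
  qed
  \<comment> \<open>\<open>\<Delta> c\<close> kills all coordinates, hence everything; but \<open>f j0 \<circ> G\<close> is the coordinate \<open>j0\<close> on \<open>Y\<close>, with derivative \<open>c j0\<close>.\<close>
  have "\<Delta> c (f j0) = 0"
  proof (rule derivation_at_zero[where p = "G q" and \<Delta> = "\<Delta> c" and h = "f j0"])
    show "derivation_at (G q) (\<Delta> c)" by (rule D)
    show "\<Delta> c (\<lambda>x. x i) = 0" if "i \<le> m" for i using that by (rule coord_zero)
    show "f j0 \<in> polyfuns m" using c(2) by (rule f)
  qed
  moreover have "dder q c (\<lambda>x. f j0 (G x) - x j0) = 0"
  proof (rule dder_vanishing[OF q])
    show "(\<lambda>x. f j0 (G x) - x j0) \<in> polyfuns m"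
      using comp[OF f[OF c(2)]] polyfuns_coord[OF c(2)] by (rule subalgebra_diff)
    show "f j0 (G x) - x j0 = 0" if "x \<in> Y" for x
      using comp_eq[OF f[OF c(2)] that] f_eq[OF c(2) \<psi>'[OF that]] right_inverse[OF that] by simp
  qed
  then have "\<Delta> c (f j0) = c j0"
    unfolding \<Delta>_def
    by (simp add: derivation_at_diff[OF derivation_at_dder comp[OF f[OF c(2)]] polyfuns_coord[OF c(2)]] dder_coord)
  ultimately show False using c(3) by simp
qed

lemma Sing_iff:
  assumes "x \<in> Y" shows "\<psi> x \<in> Sing \<longleftrightarrow> x \<in> Sing"
proof -
  interpret inv: suspension_automorphism m d k P \<psi>' \<psi> g f by (rule inverse_automorphism)
  show ?thesis
    using inv.inverse_preserves_Sing[of x] inverse_preserves_Sing[of "\<psi> x"] left_inverse[OF assms] by auto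
qed

end

section \<open>Coordinates of an automorphism along a torus orbit\<close>

lemma laurent_nowhere_zero:
  fixes h :: "'a::{alg_closed_field, field_char_0} \<Rightarrow> 'a"
  assumes "laurent h" "\<And>t. t \<noteq> 0 \<Longrightarrow> h t \<noteq> 0"
  obtains c n where "c \<noteq> 0" "\<And>t. t \<noteq> 0 \<Longrightarrow> h t = c * t powi n"
proof -
  obtain G p where G: "\<And>t. t \<noteq> 0 \<Longrightarrow> h t = poly G t / t ^ p" using assms(1) unfolding laurent_def by blast
  have "poly G t \<noteq> 0" if "t \<noteq> 0" for t using G assms(2) that by auto
  then obtain c n where c: "c \<noteq> 0" "G = monom c n" by (rule monom_if_no_nonzero_root)
  have "h t = c * t powi (int n - int p)" if "t \<noteq> 0" for t
    using G[OF that] that c by (simp add: poly_monom power_int_diff)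
  then show ?thesis using that c by blast
qed

lemma powi_independent:
  fixes C :: "int \<Rightarrow> 'a::field_char_0"
  assumes "finite N" "\<And>t. t \<noteq> 0 \<Longrightarrow> (\<Sum>n\<in>N. C n * t powi n) = 0" "n \<in> N"
  shows "C n = 0"
proof (rule characters_independent[where C = C and a = n and \<Phi> = N and T = "UNIV - {0}"
      and \<chi> = "\<lambda>n t. t powi n" and f = "(*)"])
  show "\<exists>t\<in>UNIV - {0}. t powi a \<noteq> (0::'a)" for a by (rule bexI[of _ 1]) auto
  show "\<exists>t\<in>UNIV - {0}. t powi a \<noteq> (t::'a) powi b" if "a \<noteq> b" for a b :: int
  proof (rule bexI[of _ 2])
    have neq: "(2::'a) powi a \<noteq> 2 powi b" if "a < b" for a b :: int
    proof -
      obtain l where l: "b = a + int l" "l > 0" using \<open>a < b\<close> by (metis zless_iff_Suc_zadd zero_less_Suc)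
      have "(of_nat (2 ^ l) :: 'a) \<noteq> of_nat 1" unfolding of_nat_eq_iff using l by simp
      then show ?thesis by (simp add: l power_int_add)
    qed
    show "(2::'a) powi a \<noteq> 2 powi b" by (metis neq linorder_neqE that)
  qed simp
qed (use assms in \<open>auto simp: power_int_mult_distrib intro!: bexI[of _ 1]\<close>)

text \<open>
  The functions \<open>t powi n\<close> are distinct characters of the multiplicative group, so a sum of terms with distinct exponents
  that equals \<open>c * t powi n\<close> has no other term.
\<close>

lemma powi_sum_monomial:
  fixes C :: "'i \<Rightarrow> 'a::field_char_0" and e :: "'i \<Rightarrow> int"
  assumes "finite \<Phi>" and inj: "inj_on e \<Phi>"
    and eq: "\<And>t. t \<noteq> 0 \<Longrightarrow> (\<Sum>a\<in>\<Phi>. C a * t powi e a) = c * t powi n"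
    and "a \<in> \<Phi>" "e a \<noteq> n"
  shows "C a = 0"
proof -
  define D where "D l = (if l \<in> e ` \<Phi> then C (inv_into \<Phi> e l) else 0) - (if l = n then c else 0)" for l
  have "(\<Sum>l\<in>insert n (e ` \<Phi>). D l * t powi l) = 0" if t: "t \<noteq> 0" for t
  proof -
    have "(\<Sum>l\<in>insert n (e ` \<Phi>). D l * t powi l)
        = (\<Sum>l\<in>insert n (e ` \<Phi>). if l \<in> e ` \<Phi> then C (inv_into \<Phi> e l) * t powi l else 0)
          - (\<Sum>l\<in>insert n (e ` \<Phi>). if l = n then c * t powi n else 0)"
      by (simp add: sum_subtractf[symmetric] D_def del: sum.insert)
         (intro sum.cong, auto simp: algebra_simps)
    also have "(\<Sum>l\<in>insert n (e ` \<Phi>). if l \<in> e ` \<Phi> then C (inv_into \<Phi> e l) * t powi l else 0)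
        = (\<Sum>l\<in>e ` \<Phi>. C (inv_into \<Phi> e l) * t powi l)"
      using assms(1) by (intro sum.mono_neutral_cong_right) auto
    also have "\<dots> = (\<Sum>a\<in>\<Phi>. C a * t powi e a)"
      by (subst sum.reindex[OF inj]) (simp add: inj)
    also have "(\<Sum>l\<in>insert n (e ` \<Phi>). if l = n then c * t powi n else 0) = c * t powi n"
      using assms(1) by (subst sum.delta) auto
    finally show ?thesis using eq[OF t] by simp
  qed
  then have "D (e a) = 0" using assms by (intro powi_independent[of "insert n (e ` \<Phi>)" D]) auto
  then show ?thesis using assms by (simp add: D_def)
qed

context suspension_data
begin

text \<open>
  The orbit of \<open>x\<close> under the one-parameter subgroup with weight vector \<open>w\<close>.
\<close>

definition curve :: "(nat \<Rightarrow> int) \<Rightarrow> (nat \<Rightarrow> 'a) \<Rightarrow> 'a \<Rightarrow> nat \<Rightarrow> 'a" where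
  "curve w x t = act (\<lambda>i. t powi w i) x"

lemma laurent_curve: "h \<in> polyfuns m \<Longrightarrow> laurent (\<lambda>t. h (curve w x t))"
proof (induction rule: subalgebra.induct)
  case (gen g)
  then obtain i where "i \<le> m" "g = (\<lambda>x. x i)" by (auto simp: coords_def)
  then show ?case by (auto simp: curve_def intro!: laurent_mult laurent_powi laurent_const)
qed (auto intro: laurent_const laurent_add laurent_mult)

abbreviation wt :: "(nat \<Rightarrow> int) \<Rightarrow> (nat \<Rightarrow> nat) \<Rightarrow> int" where
  "wt w a \<equiv> \<Sum>i=1..m. w i * int (a i)"

lemma ymon_powi:
  assumes "t \<noteq> 0" shows "ymon a (\<lambda>i. t powi w i) = t powi wt w a"
proof -
  have "(\<Prod>i\<in>I. t powi e i) = t powi (\<Sum>i\<in>I. e i)" for I and e :: "nat \<Rightarrow> int"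
    using assms by (induction I rule: infinite_finite_induct) (auto simp: power_int_add)
  moreover have "(t powi w i) ^ a i = t powi (w i * int (a i))" for i by (simp add: power_int_mult)
  ultimately show ?thesis by (simp only: ymon_def)
qed

lemma curve_in_Y:
  assumes "w 0 = 0" "wt w k = 0" "x \<in> Y" "t \<noteq> 0" shows "curve w x t \<in> Y"
  unfolding curve_def using assms ymon_powi[OF assms(4), of k w] by (intro act_in_Y) auto

text \<open>
  A polynomial with a single root is \<open>(z - \<alpha>)\<^sup>d\<close>, whose coefficient of \<open>z\<^bsup>d - 1\<^esup>\<close> is \<open>- d \<alpha>\<close>; here this coefficient
  is zero.
\<close>

lemma root_other_than:
  assumes "P \<noteq> monom 1 d" shows "\<exists>\<beta>. poly P \<beta> = 0 \<and> \<beta> \<noteq> \<alpha>"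
proof (rule ccontr)
  assume "\<not> ?thesis"
  then have only: "\<beta> = \<alpha>" if "poly P \<beta> = 0" for \<beta> using that by blast
  obtain A where A: "size A = d" "P = (\<Prod>x\<in>#A. [:-x, 1:])"
    using alg_closed_imp_factorization[OF P0] degree monic by auto
  have "x = \<alpha>" if "x \<in># A" for x
  proof (rule only)
    have "[:-x, 1:] dvd P" unfolding A(2) using that by (intro dvd_prod_mset) auto
    then show "poly P x = 0" by (simp add: poly_eq_0_iff_dvd)
  qed
  then have "set_mset A \<subseteq> {\<alpha>}" by auto
  then have "A = replicate_mset d \<alpha>" using A(1) set_mset_subset_singletonD by fastforce
  then have P: "P = [:-\<alpha>, 1:] ^ d" using A(2) by simp
  then have "of_nat (d choose (d - 1)) * (- \<alpha>) ^ (d - (d - 1)) = 0"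
    using coeff coeff_linear_poly_power[of "d - 1" d "-\<alpha>" 1] by simp
  then have "\<alpha> = 0" using d by (auto simp: binomial_eq_0_iff)
  then show False using P assms by (simp add: monom_altdef)
qed

lemma nonzero_lower_coeff:
  assumes "P \<noteq> monom 1 d" shows "\<exists>j<d. coeff P j \<noteq> 0"
proof (rule ccontr)
  assume "\<not> ?thesis"
  then have "coeff P j = 0" if "j < d" for j using that by blast
  then have "P = monom 1 d" using monic degree
    by (intro poly_eqI) (metis coeff_eq_0 coeff_monom linorder_neqE_nat)
  then show False using assms by simp
qed

lemma card_roots_ge_3_if_squarefree:
  assumes simple: "\<And>z. poly P z = 0 \<Longrightarrow> poly (pderiv P) z \<noteq> 0" and "d \<ge> 3"
  shows "card {z. poly P z = 0} \<ge> 3"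
proof -
  obtain A where A: "size A = d" "P = (\<Prod>x\<in>#A. [:-x, 1:])"
    using alg_closed_imp_factorization[OF P0] degree monic by auto
  have "count A x \<le> 1" for x
  proof (rule ccontr)
    assume "\<not> count A x \<le> 1"
    then have "replicate_mset 2 x \<subseteq># A" by (simp add: count_le_replicate_mset_subset_eq[symmetric])
    then obtain B where "A = replicate_mset 2 x + B" by (metis mset_subset_eq_exists_conv)
    then have "P = [:-x, 1:]\<^sup>2 * (\<Prod>x\<in>#B. [:-x, 1:])" unfolding A(2) by simp
    then have "[:-x, 1:]\<^sup>2 dvd P" by (metis dvd_triv_left)
    then show False using simple square_linear_dvd_imp_pderiv_root by blast
  qed
  then have "size A \<le> card (set_mset A)"
    unfolding size_multiset_overloaded_eq card_eq_sum by (intro sum_mono)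
  moreover have "set_mset A \<subseteq> {z. poly P z = 0}"
  proof safe
    fix x assume "x \<in># A"
    then have "[:-x, 1:] dvd P" unfolding A(2) by (intro dvd_prod_mset) auto
    then show "poly P x = 0" by (simp add: poly_eq_0_iff_dvd)
  qed
  then have "card (set_mset A) \<le> card {z. poly P z = 0}"
    using P0 by (intro card_mono poly_roots_finite)
  ultimately show ?thesis using A(1) assms(2) by linarith
qed

end

context suspension_automorphism
begin

lemma eq_on_Y: "x \<in> Y \<Longrightarrow> (\<Prod>i=1..m. f i x ^ k i) = poly P (f 0 x)"
  using ymon_k[OF \<psi>[of x]] by (simp add: ymon_def f_eq)

text \<open>
  Along the curve, \<open>f\<^sub>0\<close> omits the multiple roots of \<open>P\<close>, as the curve avoids the singular locus and \<open>\<psi>\<close> preserves it, and takes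
  the simple roots doubly. If there is a multiple root, it and any other root give constancy; if not, there are \<open>d\<close> simple
  roots, and \<open>d \<ge> 3\<close> because for \<open>d = 2\<close> the polynomial would be \<open>z\<^sup>2 + c\<close>. On \<open>y\<^sub>1\<^sup>2 y\<^sub>2\<^sup>2 = z\<^sup>2 - 4\<close>, for
  instance, constancy cannot be obtained in this way, as \<open>t + 1/t\<close> takes both roots doubly.
\<close>

lemma z_constant_on_curve:
  assumes "P \<noteq> monom 1 d" and not_even: "\<And>c. P \<noteq> monom 1 2 + [:c:]"
    and w: "w 0 = 0" "wt w k = 0" and x: "x \<in> Y" "poly P (x 0) \<noteq> 0"
  shows "\<exists>c. \<forall>t. t \<noteq> 0 \<longrightarrow> f 0 (curve w x t) = c"
proof -
  let ?c = "curve w x"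
  have c0: "?c t 0 = x 0" for t using w by (simp add: curve_def)
  have cY: "?c t \<in> Y" if "t \<noteq> 0" for t by (rule curve_in_Y[OF w x(1) that])
  have "?c t \<notin> Sing" for t using x c0 by (simp add: Sing_def)
  then have ns: "\<psi> (?c t) \<notin> Sing" if "t \<noteq> 0" for t using Sing_iff[OF cY[OF that]] by simp
  have F: "(\<Prod>i=1..m. f i (?c t) ^ k i) = poly P (f 0 (?c t))" if "t \<noteq> 0" for t
    using eq_on_Y[OF cY[OF that]] .
  have L: "laurent (\<lambda>t. f i (?c t))" if "i \<le> m" for i using laurent_curve[OF f[OF that]] .
  have double: "[:-y, 1:]\<^sup>2 dvd G - monom r p"
    if G: "\<And>t. t \<noteq> 0 \<Longrightarrow> f 0 (?c t) = poly G t / t ^ p" and r: "poly P r = 0"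
      and y: "y \<noteq> 0" "poly G y = r * y ^ p" for G p r y
  proof (rule laurent_double_root[where I = "{1..m}" and F = "\<lambda>i t. f i (?c t)" and k = k and P = P])
    show "(\<Prod>i=1..m. f i (?c t) ^ k i) = poly P (poly G t / t ^ p)" if "t \<noteq> 0" for t
      using F[OF that] G[OF that] by simp
    have "\<psi> (?c y) 0 = r" using G[OF y(1)] y f_eq[of 0 "?c y"] cY by simp
    then show "poly (pderiv P) r \<noteq> 0" using ns[OF y(1)] r \<psi>[OF cY[OF y(1)]] by (auto simp: Sing_def)
  qed (use L k r y in auto)
  show ?thesis
  proof (cases "\<exists>\<alpha>. poly P \<alpha> = 0 \<and> poly (pderiv P) \<alpha> = 0")
    case True
    then obtain \<alpha> where \<alpha>: "poly P \<alpha> = 0" "poly (pderiv P) \<alpha> = 0" by blast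
    obtain \<beta> where \<beta>: "poly P \<beta> = 0" "\<beta> \<noteq> \<alpha>" using root_other_than[OF assms(1)] by blast
    obtain G p where G: "\<And>t. t \<noteq> 0 \<Longrightarrow> f 0 (?c t) = poly G t / t ^ p"
      using L[of 0] unfolding laurent_def by auto
    have "\<exists>c. \<forall>y. y \<noteq> 0 \<longrightarrow> poly G y / y ^ p = c"
    proof (rule laurent_const_if_omits_value[OF _ \<beta>(2)])
      show "poly G y \<noteq> \<alpha> * y ^ p" if "y \<noteq> 0" for y
      proof
        assume "poly G y = \<alpha> * y ^ p"
        then have "\<psi> (?c y) 0 = \<alpha>" using G[OF that] that f_eq[of 0 "?c y"] cY by simp
        then show False using ns[OF that] \<alpha> \<psi>[OF cY[OF that]] by (auto simp: Sing_def)
      qed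
      show "[:-y, 1:]\<^sup>2 dvd G - monom \<beta> p" if "y \<noteq> 0" "poly G y = \<beta> * y ^ p" for y
        using double[OF G \<beta>(1) that] by simp
    qed
    then show ?thesis using G by auto
  next
    case False
    have "d \<noteq> 2"
    proof
      assume d2: "d = 2"
      have "P = monom 1 2 + [:coeff P 0:]"
      proof (rule poly_eqI)
        fix n :: nat
        consider "n = 0" | "n = 1" | "n = 2" | "n > 2" by linarith
        then show "coeff P n = coeff (monom 1 2 + [:coeff P 0:]) n"
        proof cases
          case 4
          then show ?thesis using degree d2 by (simp add: coeff_eq_0 coeff_pCons split: nat.splits)
        qed (use coeff monic degree d2 in \<open>auto simp: coeff_pCons numeral_2_eq_2 split: nat.splits\<close>)
      qed
      then show False using not_even by blast
    qed
    then have "card {z. poly P z = 0} \<ge> 3" using False d by (intro card_roots_ge_3_if_squarefree) auto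
    then show ?thesis
      using double P0 L[of 0] poly_roots_finite[OF P0]
      by (intro laurent_const_if_three_double_values[where S = "{z. poly P z = 0}"]) auto
  qed
qed

end

section \<open>Semi-invariants and diagonal automorphisms\<close>

text \<open>
  A rational multiple of a primitive vector that is integral is an integral multiple: \<open>\<kappa> i0\<close> divides all products
  \<open>b i0 * \<kappa> j\<close>, hence divides \<open>b i0\<close> times their greatest common divisor.
\<close>

lemma proportional_to_primitive:
  fixes \<kappa> b :: "nat \<Rightarrow> int"
  assumes "Gcd (\<kappa> ` I) = 1" "i0 \<in> I" "\<kappa> i0 \<noteq> 0" and cross: "\<And>j. j \<in> I \<Longrightarrow> \<kappa> j * b i0 = \<kappa> i0 * b j"
  obtains l where "\<And>j. j \<in> I \<Longrightarrow> b j = \<kappa> j * l"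
proof -
  have "\<kappa> i0 dvd Gcd ((*) (b i0) ` \<kappa> ` I)"
  proof (rule Gcd_greatest)
    fix y assume "y \<in> (*) (b i0) ` \<kappa> ` I"
    then obtain j where "j \<in> I" "y = b i0 * \<kappa> j" by blast
    then have "y = \<kappa> i0 * b j" using cross by (simp add: mult.commute)
    then show "\<kappa> i0 dvd y" by simp
  qed
  then have "\<kappa> i0 dvd b i0" by (simp add: Gcd_mult assms(1))
  then obtain l where l: "b i0 = \<kappa> i0 * l" by blast
  have "b j = \<kappa> j * l" if "j \<in> I" for j
  proof -
    have "\<kappa> i0 * b j = \<kappa> i0 * (\<kappa> j * l)" by (metis cross[OF that] l mult.left_commute)
    then show ?thesis using assms(3) by (metis mult_cancel_left)
  qed
  then show ?thesis by (rule that)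
qed

text \<open>
  A unit vector is not a sum of two nonzero vectors of natural numbers. This makes a monomial map with a monomial inverse a
  permutation of the coordinates up to factors.
\<close>

lemma nat_combination_eq_unit:
  fixes a :: "'j \<Rightarrow> 'l \<Rightarrow> nat" and b :: "'j \<Rightarrow> nat"
  assumes "finite J" and eq: "\<And>l. l \<in> L \<Longrightarrow> (\<Sum>j\<in>J. b j * a j l) = (if l = i then 1 else 0)" and "i \<in> L"
  shows "\<exists>j\<in>J. \<forall>l\<in>L. a j l = (if l = i then 1 else 0)"
proof -
  have "(\<Sum>j\<in>J. b j * a j i) \<noteq> 0" using eq[OF assms(3)] by simp
  then obtain j where j: "j \<in> J" "b j * a j i \<noteq> 0" by (meson sum.neutral)
  have "a j l \<le> (if l = i then 1 else 0)" if "l \<in> L" for l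
  proof -
    have "a j l \<le> b j * a j l" using j by simp
    also have "\<dots> \<le> (\<Sum>j\<in>J. b j * a j l)" using assms(1) j(1) by (intro member_le_sum) auto
    finally show ?thesis using eq[OF that] by simp
  qed
  moreover have "a j i \<noteq> 0" using j by simp
  ultimately have "\<forall>l\<in>L. a j l = (if l = i then 1 else 0)"
    using assms(3) by (metis One_nat_def le_0_eq le_Suc_eq)
  then show ?thesis using j(1) by blast
qed

lemma poly_eq_zero_off_roots:
  fixes q R :: "'a::field_char_0 poly"
  assumes "R \<noteq> 0" "\<And>z. poly R z \<noteq> 0 \<Longrightarrow> poly q z = 0" shows "q = 0"
proof -
  have "poly (q * R) z = 0" for z using assms(2)[of z] by auto
  then have "q * R = 0" using poly_all_0_iff_0 by blast
  then show ?thesis using assms(1) by simp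
qed

lemma poly_eqI_all: "(\<And>z. poly p z = poly q z) \<Longrightarrow> p = (q :: 'a::field_char_0 poly)"
  by (simp add: poly_eq_poly_eq_iff[symmetric] ext)

context suspension_data
begin

text \<open>
  \<open>P(\<alpha> z + \<beta>)\<close> has the coefficient \<open>d \<alpha>\<^bsup>d - 1\<^esup> \<beta>\<close> at \<open>z\<^bsup>d - 1\<^esup>\<close>, because \<open>P\<close> has none; so \<open>\<beta> = 0\<close>, and the
  other claims follow by comparing coefficients.
\<close>

lemma proportional_affine_substitution:
  assumes eq: "Polynomial.smult C P = pcompose P [:\<beta>, \<alpha>:]" and "\<alpha> \<noteq> 0"
  shows "\<beta> = 0" "C = \<alpha> ^ d" "coeff P j \<noteq> 0 \<Longrightarrow> \<alpha> ^ j = \<alpha> ^ d"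
proof -
  define R where "R = P - monom 1 d"
  have P: "P = monom 1 d + R" by (simp add: R_def)
  have "coeff R i = 0" if "i > d - 2" for i
  proof -
    consider "i = d - 1" | "i = d" | "i > d" using \<open>i > d - 2\<close> by linarith
    then show ?thesis
      using coeff monic degree d by cases (auto simp: R_def coeff_eq_0)
  qed
  then have R: "degree R \<le> d - 2" by (intro degree_le) auto
  have "degree (pcompose R [:\<beta>, \<alpha>:]) \<le> d - 2"
    using degree_pcompose_le[of R "[:\<beta>, \<alpha>:]"] R by (auto simp: degree_pCons_eq_if split: if_splits)
  then have "coeff (pcompose R [:\<beta>, \<alpha>:]) (d - 1) = 0" using d by (intro coeff_eq_0) linarith
  moreover have "pcompose (monom 1 d) [:\<beta>, \<alpha>:] = [:\<beta>, \<alpha>:] ^ d"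
    by (rule poly_eqI_all) (simp add: poly_pcompose poly_monom)
  ultimately have "coeff (pcompose P [:\<beta>, \<alpha>:]) (d - 1)
      = of_nat (d choose (d - 1)) * \<alpha> ^ (d - 1) * \<beta> ^ (d - (d - 1))"
    by (simp add: P pcompose_add coeff_linear_poly_power)
  moreover have "coeff (pcompose P [:\<beta>, \<alpha>:]) (d - 1) = 0"
    unfolding eq[symmetric] using coeff by simp
  ultimately show \<beta>: "\<beta> = 0" using d assms(2) by (auto simp: binomial_eq_0_iff)
  have c: "C * coeff P i = \<alpha> ^ i * coeff P i" for i
    using arg_cong[OF eq, of "\<lambda>p. coeff p i"] by (simp add: \<beta> coeff_pcompose_linear)
  show C: "C = \<alpha> ^ d" using c[of d] monic degree by simp
  show "\<alpha> ^ j = \<alpha> ^ d" if "coeff P j \<noteq> 0" using c[of j] C that by simp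
qed

text \<open>
  The diagonal automorphisms of \<open>Y\<close>; entries of \<open>t\<close> beyond \<open>m\<close> are irrelevant.
\<close>

definition diag_group :: "(nat \<Rightarrow> 'a) set" where
  "diag_group = {t. (\<forall>i\<le>m. t i \<noteq> 0) \<and> (\<forall>z. ymon k t * poly P z = poly P (t 0 * z))}"

text \<open>
  In the normal form of \<open>h\<close>, independence of characters leaves only the term that transforms like \<open>y\<^sup>e\<close>.
\<close>

lemma semi_invariant:
  assumes "h \<in> polyfuns m" and e: "e \<in> reduced"
    and inv: "\<And>t x. t \<in> fibre_torus \<Longrightarrow> t 0 = 1 \<Longrightarrow> x \<in> Y \<Longrightarrow> h (act t x) = ymon e t * h x"
  shows "\<exists>q. \<forall>x\<in>Y. h x = poly q (x 0) * ymon e x"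
proof -
  obtain \<Phi> q where \<Phi>: "finite \<Phi>" "\<Phi> \<subseteq> reduced" "\<And>x. x \<in> Y \<Longrightarrow> h x = normal_sum \<Phi> q x"
    using normal_form_on_Y[OF assms(1)] by metis
  define q' where "q' a = (if a \<in> \<Phi> then q a else 0)" for a
  have h: "h x = normal_sum (insert e \<Phi>) q' x" if "x \<in> Y" for x
    unfolding \<Phi>(3)[OF that] normal_sum_def using \<Phi>(1)
    by (intro sum.mono_neutral_cong_left) (auto simp: q'_def)
  have "q' a = 0" if a: "a \<in> insert e \<Phi>" "a \<noteq> e" for a
  proof (rule poly_eq_zero_off_roots[OF P0])
    fix z assume "poly P z \<noteq> 0"
    then obtain x where x: "x \<in> Y" "x 0 = z" "\<forall>i\<in>{1..m}. x i \<noteq> 0" using point_over[of z] by metis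
    have "poly (q' a) (x 0) * ymon a x - (if a = e then h x else 0) = 0"
      using _ _ _ a(1)
    proof (rule characters_independent_on_orbit[where C = "\<lambda>a. poly (q' a) (x 0) * ymon a x - (if a = e then h x else 0)"])
      fix t assume t: "t \<in> fibre_torus" "t 0 = 1"
      have "(\<Sum>a\<in>insert e \<Phi>. poly (q' a) (x 0) * ymon a x * ymon a t) = h (act t x)"
        using h[OF fibre_torus_act[OF t x(1)]] normal_sum_act[of t "insert e \<Phi>" q' x] t(2) by simp
      also have "\<dots> = (\<Sum>a\<in>insert e \<Phi>. if a = e then h x * ymon e t else 0)"
        using inv[OF t x(1)] \<Phi>(1) by (subst sum.delta) auto
      finally have "(\<Sum>a\<in>insert e \<Phi>. poly (q' a) (x 0) * ymon a x * ymon a t)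
          - (\<Sum>a\<in>insert e \<Phi>. if a = e then h x * ymon e t else 0) = 0" by simp
      moreover have "(\<Sum>a\<in>insert e \<Phi>. poly (q' a) (x 0) * ymon a x * ymon a t)
          - (\<Sum>a\<in>insert e \<Phi>. if a = e then h x * ymon e t else 0)
        = (\<Sum>a\<in>insert e \<Phi>. (poly (q' a) (x 0) * ymon a x - (if a = e then h x else 0)) * ymon a t)"
        unfolding sum_subtractf[symmetric] by (intro sum.cong) (auto simp: algebra_simps)
      ultimately show "(\<Sum>a\<in>insert e \<Phi>. (poly (q' a) (x 0) * ymon a x - (if a = e then h x else 0)) * ymon a t) = 0"
        by simp
    qed (use \<Phi> e in auto)
    then show "poly (q' a) z = 0" using a(2) ymon_nonzero x by auto
  qed
  then have "normal_sum (insert e \<Phi>) q' x = poly (q' e) (x 0) * ymon e x" for x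
    unfolding normal_sum_def using \<Phi>(1) by (subst sum.remove[of _ e]) (auto intro!: sum.neutral)
  then show ?thesis using h by auto
qed

text \<open>
  Two reduced exponents differ by a vector that is not proportional to \<open>k\<close>: since \<open>k\<close> is primitive, the factor would be an
  integer. So a generic weight orthogonal to \<open>k\<close> tells finitely many reduced exponents apart.
\<close>

lemma separating_weight:
  assumes gcd: "Gcd (k ` {1..m}) = 1" and "finite \<Phi>" "\<Phi> \<subseteq> reduced"
  obtains w :: "nat \<Rightarrow> int" where "w 0 = 0" "wt w k = 0"
    "inj_on (\<lambda>a. wt w a) \<Phi>"
proof -
  define B where "B = (\<lambda>(a, b) i. int (a i) - int (b i)) ` {(a, b). a \<in> \<Phi> \<and> b \<in> \<Phi> \<and> a \<noteq> b}"
  have "{(a, b). a \<in> \<Phi> \<and> b \<in> \<Phi> \<and> a \<noteq> b} \<subseteq> \<Phi> \<times> \<Phi>" by auto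
  then have "finite B" unfolding B_def using assms(2) by (intro finite_imageI) (meson finite_SigmaI finite_subset)
  have 1: "1 \<in> {1..m}" using m by auto
  have gcd_int: "Gcd ((\<lambda>i. int (k i)) ` {1..m}) = 1"
    using gcd Gcd_int_eq[of "k ` {1..m}"] by (simp add: image_image)
  have k1: "int (k 1) \<noteq> 0" using k[OF 1] by simp
  obtain w :: "nat \<Rightarrow> int" where w: "(\<Sum>i\<in>{1..m}. w i * int (k i)) = 0" "\<And>b. b \<in> B \<Longrightarrow> (\<Sum>i\<in>{1..m}. w i * b i) \<noteq> 0"
  proof (rule generic_weight[where \<kappa> = "\<lambda>i. int (k i)" and I = "{1..m}" and ?i0.0 = 1 and B = B])
    fix b assume "b \<in> B"
    then obtain a c where ac: "a \<in> \<Phi>" "c \<in> \<Phi>" "a \<noteq> c" "b = (\<lambda>i. int (a i) - int (c i))" by (auto simp: B_def)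
    show "\<exists>j\<in>{1..m}. int (k j) * b 1 \<noteq> int (k 1) * b j"
    proof (rule ccontr)
      assume "\<not> ?thesis"
      then obtain l where "\<And>j. j \<in> {1..m} \<Longrightarrow> b j = int (k j) * l"
        using proportional_to_primitive[OF gcd_int 1 k1, of b] by blast
      then have "a = c" using ac assms(3) by (intro reduced_eq_if_proportional_diff[of a c l]) auto
      then show False using ac by simp
    qed
  qed (use 1 k1 \<open>finite B\<close> in auto)
  show ?thesis
  proof (rule that[of "w(0 := 0)"])
    have upd: "(\<Sum>i=1..m. (w(0 := 0)) i * c i) = (\<Sum>i=1..m. w i * c i)" for c :: "nat \<Rightarrow> int"
      by (intro sum.cong) auto
    show "(\<Sum>i=1..m. (w(0 := 0)) i * int (k i)) = 0" unfolding upd by (rule w(1))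
    show "inj_on (\<lambda>a. \<Sum>i=1..m. (w(0 := 0)) i * int (a i)) \<Phi>"
    proof (rule inj_onI, unfold upd, rule ccontr)
      fix a b assume ab: "a \<in> \<Phi>" "b \<in> \<Phi>" "wt w a = wt w b" "a \<noteq> b"
      then have "(\<lambda>i. int (a i) - int (b i)) \<in> B" by (auto simp: B_def intro!: image_eqI[of _ _ "(a, b)"])
      then show False using w(2) ab(3) by (fastforce simp: algebra_simps sum_subtractf)
    qed
  qed simp
qed

lemma normal_sum_curve:
  assumes "w 0 = 0" "t \<noteq> 0"
  shows "normal_sum \<Phi> q (curve w x t)
    = (\<Sum>a\<in>\<Phi>. (poly (q a) (x 0) * ymon a x) * t powi wt w a)"
  unfolding curve_def using assms by (subst normal_sum_act) (simp_all add: ymon_powi)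

text \<open>
  Choose a weight that separates the exponents of the normal form of \<open>h\<close>. If two of its coefficients were nonzero, there would be
  an admissible \<open>z\<close> at which both are nonzero, and \<open>h\<close> would contain two different powers of \<open>t\<close> along the orbit of a
  point above \<open>z\<close>.
\<close>

lemma single_exponent:
  assumes gcd: "Gcd (k ` {1..m}) = 1" and "h \<in> polyfuns m" and "R \<noteq> 0"
    and mono: "\<And>w x. w 0 = 0 \<Longrightarrow> wt w k = 0 \<Longrightarrow> x \<in> Y \<Longrightarrow> poly P (x 0) \<noteq> 0 \<Longrightarrow>
      poly R (x 0) \<noteq> 0 \<Longrightarrow> \<exists>c n. \<forall>t. t \<noteq> 0 \<longrightarrow> h (curve w x t) = c * t powi n"
  obtains a q where "a \<in> reduced" "\<And>x. x \<in> Y \<Longrightarrow> h x = poly q (x 0) * ymon a x"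
proof -
  obtain \<Phi> q where \<Phi>: "finite \<Phi>" "\<Phi> \<subseteq> reduced" "\<And>x. x \<in> Y \<Longrightarrow> h x = normal_sum \<Phi> q x"
    using normal_form_on_Y[OF assms(2)] by metis
  obtain w where w: "w 0 = 0" "wt w k = 0"
    "inj_on (\<lambda>a. wt w a) \<Phi>"
    using separating_weight[OF gcd \<Phi>(1,2)] by blast
  have same: "a = b" if ab: "a \<in> \<Phi>" "b \<in> \<Phi>" "q a \<noteq> 0" "q b \<noteq> 0" for a b
  proof (rule ccontr)
    assume "a \<noteq> b"
    have "q a * q b * P * R \<noteq> 0" using ab P0 assms(3) by simp
    then obtain z where z: "poly (q a * q b * P * R) z \<noteq> 0" using nonroot_exists by blast
    obtain x where x: "x \<in> Y" "x 0 = z" "\<forall>i\<in>{1..m}. x i \<noteq> 0" using point_over[of z] z by auto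
    obtain c n where cn: "\<And>t. t \<noteq> 0 \<Longrightarrow> h (curve w x t) = c * t powi n"
      using mono[OF w(1,2) x(1)] x(2) z by auto
    have eq: "(\<Sum>a\<in>\<Phi>. (poly (q a) (x 0) * ymon a x) * t powi wt w a) = c * t powi n"
      if "t \<noteq> 0" for t
    proof -
      have "curve w x t \<in> Y" by (rule curve_in_Y[OF w(1,2) x(1) that])
      then show ?thesis using cn[OF that] \<Phi>(3) normal_sum_curve[of w t \<Phi> q x] w(1) that by simp
    qed
    have "wt w e = n" if "e \<in> \<Phi>" "q e \<noteq> 0" "poly (q e) z \<noteq> 0" for e
    proof (rule ccontr)
      assume "wt w e \<noteq> n"
      then have "poly (q e) (x 0) * ymon e x = 0"
        using powi_sum_monomial[OF \<Phi>(1) w(3) eq that(1)] by blast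
      then show False using that x ymon_nonzero by auto
    qed
    then have "wt w a = wt w b" using ab z by auto
    then show False using w(3) ab \<open>a \<noteq> b\<close> by (auto dest: inj_onD)
  qed
  show ?thesis
  proof (cases "\<exists>a\<in>\<Phi>. q a \<noteq> 0")
    case True
    then obtain a where a: "a \<in> \<Phi>" "q a \<noteq> 0" by blast
    have "q e = 0" if "e \<in> \<Phi> - {a}" for e using same[of e a] a that by auto
    then have "normal_sum \<Phi> q x = poly (q a) (x 0) * ymon a x" for x
      unfolding normal_sum_def using \<Phi>(1) a
      by (subst sum.remove[of _ a]) (auto intro!: sum.neutral)
    then show ?thesis using that[of a "q a"] a \<Phi> by auto
  next
    case False
    then have "normal_sum \<Phi> q x = 0" for x by (simp add: normal_sum_def)
    then show ?thesis using that[OF reduced_zero, of 0] \<Phi>(3) by simp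
  qed
qed

end

context suspension_automorphism
begin

text \<open>
  The action on \<open>z\<close> is an invertible polynomial map of the line, so its degree is one.
\<close>

lemma z_part_affine:
  assumes "\<And>x. x \<in> Y \<Longrightarrow> f 0 x = poly b (x 0)" "\<And>x. x \<in> Y \<Longrightarrow> g 0 x = poly b' (x 0)"
  obtains \<alpha> \<beta> where "\<alpha> \<noteq> 0" "b = [:\<beta>, \<alpha>:]"
proof -
  have "pcompose b' b = [:0, 1:]"
  proof (rule poly_eqI_all)
    fix z
    obtain x where x: "x \<in> Y" "x 0 = z" using point_over[of z] by metis
    have "x 0 = \<psi>' (\<psi> x) 0" using left_inverse x by simp
    also have "\<dots> = poly b' (poly b (x 0))"
      using assms(2)[OF \<psi>[OF x(1)]] assms(1)[OF x(1)] g_eq[of 0 "\<psi> x"] f_eq[of 0 x] \<psi> x by simp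
    finally show "poly (pcompose b' b) z = poly [:0, 1:] z" using x by (simp add: poly_pcompose)
  qed
  then have "degree (pcompose b' b) = degree [:0, 1 :: 'a:]" by simp
  then have "degree b' * degree b = 1" by (simp add: degree_pcompose)
  then have "degree b = 1" by simp
  then obtain \<alpha> \<beta> where "b = [:\<beta>, \<alpha>:]" "\<alpha> \<noteq> 0" by (metis degree1_coeffs)
  then show ?thesis using that by blast
qed

lemma diagonal_conclusion:
  assumes "\<alpha> \<noteq> 0" and f0: "\<And>x. x \<in> Y \<Longrightarrow> f 0 x = \<beta> + \<alpha> * x 0"
    and fi: "\<And>i x. i \<in> {1..m} \<Longrightarrow> x \<in> Y \<Longrightarrow> f i x = c i * x i"
  obtains t where "t \<in> diag_group" "t 0 = \<alpha>" "\<And>x. x \<in> Y \<Longrightarrow> \<psi> x = act t x"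
    "\<And>j. coeff P j \<noteq> 0 \<Longrightarrow> \<alpha> ^ j = \<alpha> ^ d"
proof -
  define t where "t = c(0 := \<alpha>)"
  have "Polynomial.smult (ymon k c) P = pcompose P [:\<beta>, \<alpha>:]"
  proof (rule poly_eqI_all)
    fix z
    obtain x where x: "x \<in> Y" "x 0 = z" using point_over[of z] by metis
    have "(\<Prod>i=1..m. f i x ^ k i) = ymon k (\<lambda>i. c i * x i)"
      unfolding ymon_def using fi x by (intro prod.cong) auto
    then show "poly (Polynomial.smult (ymon k c) P) z = poly (pcompose P [:\<beta>, \<alpha>:]) z"
      using eq_on_Y[OF x(1)] f0[OF x(1)] ymon_k[OF x(1)] x(2)
      by (simp add: ymon_mult poly_pcompose algebra_simps)
  qed
  note eqs = proportional_affine_substitution[OF this assms(1)]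
  have kc: "ymon k t = \<alpha> ^ d" unfolding eqs(2)[symmetric] by (rule ymon_cong) (auto simp: t_def)
  have "ymon k t * poly P z = poly P (t 0 * z)" for z
  proof -
    have "poly (Polynomial.smult (ymon k c) P) z = poly (pcompose P [:\<beta>, \<alpha>:]) z"
      using \<open>Polynomial.smult (ymon k c) P = pcompose P [:\<beta>, \<alpha>:]\<close> by simp
    then show ?thesis using eqs(1,2) kc by (simp add: poly_pcompose t_def mult.commute)
  qed
  moreover have "t i \<noteq> 0" if "i \<le> m" for i
  proof
    assume "t i = 0"
    then have i: "i \<in> {1..m}" using that assms(1) by (cases "i = 0") (auto simp: t_def)
    then have "ymon k t = 0" using \<open>t i = 0\<close> k[OF i] by (auto simp: ymon_def power_0_left intro!: bexI[of _ i])
    then show False using kc assms(1) by simp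
  qed
  ultimately have "t \<in> diag_group" by (simp add: diag_group_def)
  moreover have "\<psi> x = act t x" if x: "x \<in> Y" for x
  proof
    fix i
    show "\<psi> x i = act t x i"
    proof (cases "i \<le> m")
      case True
      then show ?thesis
        using f_eq[OF True x] f0[OF x] fi[of i x] x eqs(1) by (cases "i = 0") (auto simp: t_def)
    next
      case False
      have "\<psi> x \<in> {0..m} \<rightarrow>\<^sub>E UNIV" using \<psi>[OF x] by (simp add: suspension_iff)
      then show ?thesis using False by (auto simp: act_def)
    qed
  qed
  ultimately show ?thesis using eqs(3) by (intro that[of t]) (auto simp: t_def)
qed

text \<open>
  The coordinates of \<open>\<psi>\<close> are semi-invariants of the same weights as the coordinates themselves: \<open>f\<^sub>0 = b(z)\<close> and
  \<open>f\<^sub>i = q\<^sub>i(z) y\<^sub>i\<close>. The same holds for the inverse, so \<open>b\<close> is affine, and comparing degrees in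
  \<open>q\<^sub>1\<^bsup>k 1\<^esup> \<cdots> q\<^sub>m\<^bsup>k m\<^esup> P = P(b)\<close> shows that the \<open>q\<^sub>i\<close> are constant.
\<close>

lemma centralizer_diagonal:
  assumes comm: "\<And>t x. t \<in> fibre_torus \<Longrightarrow> t 0 = 1 \<Longrightarrow> x \<in> Y \<Longrightarrow> \<psi> (act t x) = act t (\<psi> x)"
  shows "\<exists>t\<in>diag_group. \<forall>x\<in>Y. \<psi> x = act t x"
proof -
  interpret inv: suspension_automorphism m d k P \<psi>' \<psi> g f by (rule inverse_automorphism)
  have comm': "\<psi>' (act t x) = act t (\<psi>' x)" if t: "t \<in> fibre_torus" "t 0 = 1" and x: "x \<in> Y" for t x
  proof -
    have "act t x = \<psi> (act t (\<psi>' x))" using comm[OF t \<psi>'[OF x]] right_inverse[OF x] by simp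
    then show ?thesis using left_inverse[OF fibre_torus_act[OF t \<psi>'[OF x]]] by simp
  qed
  have f_act: "f i (act t x) = t i * f i x" if t: "t \<in> fibre_torus" "t 0 = 1" and x: "x \<in> Y" and i: "i \<le> m" for i t x
    using f_eq[OF i fibre_torus_act[OF t x]] f_eq[OF i x] comm[OF t x] i by simp
  have g_act: "g 0 (act t x) = t 0 * g 0 x" if t: "t \<in> fibre_torus" "t 0 = 1" and x: "x \<in> Y" for t x
    using g_eq[of 0, OF _ fibre_torus_act[OF t x]] g_eq[of 0, OF _ x] comm'[OF t x] by simp
  obtain b where b: "\<And>x. x \<in> Y \<Longrightarrow> f 0 x = poly b (x 0)"
    using semi_invariant[OF f[of 0] reduced_zero] f_act[of _ _ 0] by auto
  obtain b' where b': "\<And>x. x \<in> Y \<Longrightarrow> g 0 x = poly b' (x 0)"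
    using semi_invariant[OF g[of 0] reduced_zero] g_act by auto
  obtain \<alpha> \<beta> where \<alpha>: "\<alpha> \<noteq> 0" "b = [:\<beta>, \<alpha>:]" using z_part_affine[OF b b'] by metis
  have "\<exists>q. \<forall>x\<in>Y. f i x = poly q (x 0) * x i" if i: "i \<in> {1..m}" for i
    using semi_invariant[OF f reduced_unit_exp[OF i]] f_act[of _ _ i] i by (simp add: ymon_unit_exp)
  then obtain q where q: "\<And>i x. i \<in> {1..m} \<Longrightarrow> x \<in> Y \<Longrightarrow> f i x = poly (q i) (x 0) * x i" by metis
  have eq: "(\<Prod>i=1..m. q i ^ k i) * P = pcompose P b"
  proof (rule poly_eqI_all)
    fix z
    obtain x where x: "x \<in> Y" "x 0 = z" using point_over[of z] by metis
    have "(\<Prod>i=1..m. f i x ^ k i) = (\<Prod>i=1..m. poly (q i ^ k i) z * x i ^ k i)"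
      using q x by (intro prod.cong) (auto simp: power_mult_distrib)
    also have "\<dots> = poly (\<Prod>i=1..m. q i ^ k i) z * ymon k x"
      by (simp add: prod.distrib poly_prod ymon_def)
    finally show "poly ((\<Prod>i=1..m. q i ^ k i) * P) z = poly (pcompose P b) z"
      using eq_on_Y[OF x(1)] b[OF x(1)] ymon_k[OF x(1)] x(2) by (simp add: poly_pcompose)
  qed
  have deg: "degree (pcompose P b) = d" using \<alpha> degree by (simp add: degree_pcompose)
  then have "pcompose P b \<noteq> 0" using d by auto
  then have nz: "(\<Prod>i=1..m. q i ^ k i) \<noteq> 0" using eq by (metis mult_zero_left)
  then have "degree (\<Prod>i=1..m. q i ^ k i) + d = d"
    using eq deg P0 degree by (metis degree_mult_eq)
  then have "degree (\<Prod>i=1..m. q i ^ k i) = 0" by simp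
  moreover have "q i dvd (\<Prod>i=1..m. q i ^ k i)" if i: "i \<in> {1..m}" for i
    using i k[OF i] dvd_trans[OF dvd_power[of "k i" "q i"] dvd_prodI[of "{1..m}" i "\<lambda>i. q i ^ k i"]] by auto
  ultimately have degq: "degree (q i) = 0" if "i \<in> {1..m}" for i
    using nz that by (metis dvd_imp_degree_le le_zero_eq)
  have fi: "f i x = coeff (q i) 0 * x i" if "i \<in> {1..m}" "x \<in> Y" for i x
    using q[OF that] degq[OF that(1)] by (auto elim!: degree_eq_zeroE)
  show ?thesis
  proof (rule diagonal_conclusion[OF \<alpha>(1)])
    show "f 0 x = \<beta> + \<alpha> * x 0" if "x \<in> Y" for x using b[OF that] \<alpha>(2) by simp
  qed (use fi in blast)+
qed

end

section \<open>Automorphisms when the polynomial has no symmetry\<close>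

lemma (in suspension_data) ymon_sum: "ymon (\<lambda>l. \<Sum>j\<in>J. e j l) x = (\<Prod>j\<in>J. ymon (e j) x)"
  by (induction J rule: infinite_finite_induct) (auto simp: ymon_add)

lemma poly_in_power_of_z:
  fixes P :: "'a::field_char_0 poly"
  assumes "v > 0" and supp: "\<And>j. coeff P j \<noteq> 0 \<Longrightarrow> j mod v = degree P mod v"
  shows "\<exists>u Q. P = monom 1 u * pcompose Q (monom 1 v)"
proof -
  define u where "u = degree P mod v"
  define Q where "Q = (\<Sum>i\<le>degree P. monom (coeff P (u + v * i)) i)"
  have P: "P = (\<Sum>i\<le>degree P. monom (coeff P (u + v * i)) (u + v * i))"
  proof (rule poly_eqI)
    fix n
    have sum: "coeff (\<Sum>i\<le>degree P. monom (coeff P (u + v * i)) (u + v * i)) n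
       = (\<Sum>i\<le>degree P. if u + v * i = n then coeff P n else 0)"
      unfolding coeff_sum by (intro sum.cong) auto
    show "coeff P n = coeff (\<Sum>i\<le>degree P. monom (coeff P (u + v * i)) (u + v * i)) n"
    proof (cases "coeff P n = 0")
      case True
      then have "(\<Sum>i\<le>degree P. if u + v * i = n then coeff P n else 0) = 0"
        by (intro sum.neutral) auto
      then show ?thesis unfolding sum using True by simp
    next
      case False
      then have n: "n \<le> degree P" "n mod v = u" using supp le_degree by (auto simp: u_def)
      have "u + v * i = n \<longleftrightarrow> i = n div v" for i
        using n(2) assms(1) by (metis add_left_cancel mod_mult_div_eq mult_cancel1 not_gr_zero)
      moreover have "n div v \<le> degree P" using n(1) div_le_dividend[of n v] by linarith
      ultimately have "(\<Sum>i\<le>degree P. if u + v * i = n then coeff P n else 0) = coeff P n"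
        by simp
      then show ?thesis unfolding sum by simp
    qed
  qed
  have "P = monom 1 u * pcompose Q (monom 1 v)"
  proof (rule poly_eqI_all)
    fix z
    have "poly P z = (\<Sum>i\<le>degree P. coeff P (u + v * i) * z ^ (u + v * i))"
      by (subst P) (simp add: poly_sum poly_monom)
    then show "poly P z = poly (monom 1 u * pcompose Q (monom 1 v)) z"
      by (simp add: Q_def poly_pcompose poly_sum poly_monom power_add power_mult[symmetric] sum_distrib_left mult_ac)
  qed
  then show ?thesis by blast
qed

context suspension_automorphism
begin

text \<open>
  Inserting the coordinates into the equation of \<open>Y\<close> gives \<open>C y\<^bsup>k \<circ> \<tau>\<^esup> = P(\<alpha> z + \<beta>)\<close>. By uniqueness of normal forms \<open>k \<circ> \<tau>\<close> is
  a multiple of \<open>k\<close>, and comparing degrees in \<open>z\<close> the factor is one.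
\<close>

lemma permutation_trivial:
  assumes "inj_on k {1..m}" "\<alpha> \<noteq> 0" and f0: "\<And>x. x \<in> Y \<Longrightarrow> f 0 x = \<beta> + \<alpha> * x 0"
    and \<tau>: "\<And>i. i \<in> {1..m} \<Longrightarrow> \<tau> i \<in> {1..m}" "inj_on \<tau> {1..m}"
    and f\<tau>: "\<And>i x. i \<in> {1..m} \<Longrightarrow> x \<in> Y \<Longrightarrow> f (\<tau> i) x = c i * x i"
    and i: "i \<in> {1..m}"
  shows "\<tau> i = i"
proof -
  have surj: "\<tau> ` {1..m} = {1..m}" using \<tau> by (intro endo_inj_surj) auto
  have prod: "(\<Prod>j=1..m. f j x ^ k j) = ymon (\<lambda>i. k (\<tau> i)) c * ymon (\<lambda>i. k (\<tau> i)) x" if x: "x \<in> Y" for x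
  proof -
    have "(\<Prod>j=1..m. f j x ^ k j) = (\<Prod>i=1..m. f (\<tau> i) x ^ k (\<tau> i))"
      by (subst surj[symmetric], subst prod.reindex[OF \<tau>(2)]) simp
    also have "\<dots> = ymon (\<lambda>i. k (\<tau> i)) (\<lambda>i. c i * x i)"
      unfolding ymon_def using f\<tau> x by (intro prod.cong) auto
    finally show ?thesis by (simp add: ymon_mult)
  qed
  define b where "b = [:\<beta>, \<alpha>:]"
  define C where "C = ymon (\<lambda>i. k (\<tau> i)) c"
  have deg: "degree (pcompose P b) = d" using assms(2) degree by (simp add: degree_pcompose b_def)
  then have nz: "pcompose P b \<noteq> 0" using d by auto
  have "poly [:C:] (x 0) * ymon (\<lambda>i. k (\<tau> i)) x = poly (pcompose P b) (x 0) * ymon (\<lambda>_. 0) x" if "x \<in> Y" for x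
    using eq_on_Y[OF that] prod[OF that] f0[OF that] by (simp add: poly_pcompose C_def b_def mult.commute)
  then obtain l where l: "\<And>i. i \<in> {1..m} \<Longrightarrow> k (\<tau> i) = 0 + l * k i" "[:C:] * P ^ l = pcompose P b"
    using monomial_eqD[OF _ reduced_zero nz] by blast
  have "C \<noteq> 0" using l(2) nz by auto
  then have "degree ([:C:] * P ^ l) = l * d"
    using P0 degree by (simp add: degree_power_eq)
  then have "l * d = d" using l(2) deg by metis
  then have "l = 1" using d by simp
  then have "k (\<tau> i) = k i" using l(1)[OF i] by simp
  then show ?thesis using assms(1) \<tau>(1)[OF i] i by (auto dest: inj_onD)
qed

text \<open>
  Substituting the formulas for \<open>\<psi>\<close> into those for \<open>\<psi>'\<close> writes \<open>x\<^sub>i\<close> as a single term, which can be compared with the normal form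
  of \<open>x\<^sub>i\<close>.
\<close>

lemma exponents_compose:
  assumes "\<alpha> \<noteq> 0" and f0: "\<And>x. x \<in> Y \<Longrightarrow> f 0 x = \<beta> + \<alpha> * x 0"
    and fa: "\<And>i x. i \<in> {1..m} \<Longrightarrow> x \<in> Y \<Longrightarrow> f i x = poly (q i) (x 0) * ymon (a i) x"
    and gb: "\<And>i x. i \<in> {1..m} \<Longrightarrow> x \<in> Y \<Longrightarrow> g i x = poly (q' i) (x 0) * ymon (b i) x"
    and i: "i \<in> {1..m}"
  shows "degree (q' i) = 0" "\<And>l. l \<in> {1..m} \<Longrightarrow> (\<Sum>j=1..m. b i j * a j l) = (if l = i then 1 else 0)"
proof -
  define r where "r = [:\<beta>, \<alpha>:]"
  define Q where "Q = pcompose (q' i) r * (\<Prod>j=1..m. q j ^ b i j)"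
  have eq: "poly Q (x 0) * ymon (\<lambda>l. \<Sum>j=1..m. b i j * a j l) x = poly 1 (x 0) * ymon (unit_exp i) x"
    if x: "x \<in> Y" for x
  proof -
    have "x i = g i (\<psi> x)" using left_inverse[OF x] g_eq[of i "\<psi> x"] \<psi>[OF x] i by simp
    also have "\<dots> = poly (q' i) (\<psi> x 0) * ymon (b i) (\<psi> x)" using gb[OF i \<psi>[OF x]] .
    also have "\<psi> x 0 = poly r (x 0)" using f_eq[of 0 x] f0 x by (simp add: r_def)
    also have "ymon (b i) (\<psi> x) = (\<Prod>j=1..m. (poly (q j) (x 0) * ymon (a j) x) ^ b i j)"
      unfolding ymon_def[of "b i"] using f_eq fa x by (intro prod.cong) auto
    also have "\<dots> = poly (\<Prod>j=1..m. q j ^ b i j) (x 0) * ymon (\<lambda>l. \<Sum>j=1..m. b i j * a j l) x"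
      by (simp add: power_mult_distrib prod.distrib poly_prod ymon_sum ymon_scale)
    finally show ?thesis using ymon_unit_exp[OF i] by (simp add: Q_def poly_pcompose)
  qed
  obtain l where l: "\<And>j. j \<in> {1..m} \<Longrightarrow> (\<Sum>j'=1..m. b i j' * a j' j) = unit_exp i j + l * k j" "Q * P ^ l = 1"
    using monomial_eqD[OF eq reduced_unit_exp[OF i]] by auto
  have "Q \<noteq> 0" using l(2) by auto
  then have "degree Q + l * d = 0" using l(2) P0 degree by (metis degree_1 degree_mult_eq degree_power_eq power_not_zero)
  then have "l = 0" "degree Q = 0" using d by auto
  then show "\<And>l. l \<in> {1..m} \<Longrightarrow> (\<Sum>j=1..m. b i j * a j l) = (if l = i then 1 else 0)"
    using l(1) by (simp add: unit_exp_def)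
  have "pcompose (q' i) r dvd Q" by (simp add: Q_def)
  then have "degree (pcompose (q' i) r) \<le> degree Q" using \<open>Q \<noteq> 0\<close> by (rule dvd_imp_degree_le)
  then have "degree (pcompose (q' i) r) = 0" using \<open>degree Q = 0\<close> by simp
  then show "degree (q' i) = 0" using assms(1) by (simp add: degree_pcompose r_def)
qed

text \<open>
  Constancy along orbits forces the single exponent of \<open>f\<^sub>0\<close> to be zero, since a weight can be chosen that does not annihilate
  a given nonzero reduced exponent.
\<close>

lemma z_part_poly:
  assumes gcd: "Gcd (k ` {1..m}) = 1" and "P \<noteq> monom 1 d" "\<And>c. P \<noteq> monom 1 2 + [:c:]"
  obtains b where "\<And>x. x \<in> Y \<Longrightarrow> f 0 x = poly b (x 0)"
proof -
  note const = z_constant_on_curve[OF assms(2,3)]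
  have mono: "\<exists>c n. \<forall>t. t \<noteq> 0 \<longrightarrow> f 0 (curve w x t) = c * t powi n"
    if w: "w 0 = 0" "wt w k = 0" "x \<in> Y" "poly P (x 0) \<noteq> 0" for w x
  proof -
    obtain c where "\<forall>t. t \<noteq> 0 \<longrightarrow> f 0 (curve w x t) = c" using const[OF w] by blast
    then show ?thesis by (intro exI[of _ c] exI[of _ 0]) simp
  qed
  have "f 0 \<in> polyfuns m" "(1 :: 'a poly) \<noteq> 0" using f by auto
  then obtain a q where a: "a \<in> reduced" "\<And>x. x \<in> Y \<Longrightarrow> f 0 x = poly q (x 0) * ymon a x"
    by (rule single_exponent[OF gcd]) (use mono in auto)
  show ?thesis
  proof (cases "a = (\<lambda>_. 0) \<or> q = 0")
    case True
    then show ?thesis using a(2) that[of q] by auto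
  next
    case False
    obtain w where w: "w 0 = 0" "wt w k = 0"
      "inj_on (\<lambda>a. wt w a) {a, \<lambda>_. 0}"
      using separating_weight[OF gcd, of "{a, \<lambda>_. 0}"] a(1) reduced_zero by auto
    have wa: "wt w a \<noteq> 0" using w(3) False by (auto simp: inj_on_def)
    have "q * P \<noteq> 0" using False P0 by simp
    then obtain z where z: "poly (q * P) z \<noteq> 0" using nonroot_exists by blast
    then obtain x where x: "x \<in> Y" "x 0 = z" "\<forall>i\<in>{1..m}. x i \<noteq> 0" using point_over[of z] by auto
    obtain c where c: "\<And>t. t \<noteq> 0 \<Longrightarrow> f 0 (curve w x t) = c" using const[OF w(1,2) x(1)] x z by auto
    have eq: "(\<Sum>a\<in>{a}. (poly q (x 0) * ymon a x) * t powi wt w a) = c * t powi 0"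
      if t: "t \<noteq> 0" for t
    proof -
      have "curve w x t \<in> Y" by (rule curve_in_Y[OF w(1,2) x(1) t])
      then have "c = normal_sum {a} (\<lambda>_. q) (curve w x t)"
        using c[OF t] a(2) by (simp add: normal_sum_def)
      then show ?thesis using normal_sum_curve[of w t "{a}" "\<lambda>_. q" x] w(1) t by simp
    qed
    have "poly q (x 0) * ymon a x = 0"
      by (rule powi_sum_monomial[where \<Phi> = "{a}" and C = "\<lambda>a. poly q (x 0) * ymon a x"
            and e = "\<lambda>a. wt w a", OF _ _ eq]) (use wa in auto)
    then have False using z x ymon_nonzero by auto
    then show ?thesis ..
  qed
qed

text \<open>
  Along an orbit the product of powers of the \<open>f\<^sub>i\<close> equals \<open>P(\<alpha> z + \<beta>)\<close>, a constant. For all but finitely many \<open>z\<close> it is nonzero,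
  so \<open>f\<^sub>i\<close> has no zero on the orbit and is a power of \<open>t\<close> up to a factor.
\<close>

lemma y_part_monomial:
  assumes gcd: "Gcd (k ` {1..m}) = 1" and "\<alpha> \<noteq> 0" and f0: "\<And>x. x \<in> Y \<Longrightarrow> f 0 x = \<beta> + \<alpha> * x 0"
    and i: "i \<in> {1..m}"
  shows "\<exists>a q. \<forall>x\<in>Y. f i x = poly q (x 0) * ymon a x"
proof -
  define R where "R = pcompose P [:\<beta>, \<alpha>:]"
  have "degree R = d" using assms(2) degree by (simp add: degree_pcompose R_def)
  then have "R \<noteq> 0" using d by auto
  have mono: "\<exists>c n. \<forall>t. t \<noteq> 0 \<longrightarrow> f i (curve w x t) = c * t powi n"
    if w: "w 0 = 0" "wt w k = 0" and x: "x \<in> Y" "poly R (x 0) \<noteq> 0" for w x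
  proof -
    have "f i (curve w x t) \<noteq> 0" if t: "t \<noteq> 0" for t
    proof -
      have c: "curve w x t \<in> Y" by (rule curve_in_Y[OF w x(1) t])
      have "curve w x t 0 = x 0" using w by (simp add: curve_def)
      then have "poly P (\<psi> (curve w x t) 0) \<noteq> 0"
        using f_eq[of 0, OF _ c] f0[OF c] x(2) by (simp add: R_def poly_pcompose mult.commute)
      then show ?thesis using nonzero_coords[OF \<psi>[OF c]] i f_eq[of i, OF _ c] by auto
    qed
    moreover have "laurent (\<lambda>t. f i (curve w x t))" using i by (intro laurent_curve f) auto
    ultimately show ?thesis using laurent_nowhere_zero by metis
  qed
  have "f i \<in> polyfuns m" using i by (intro f) auto
  then obtain a q where "\<And>x. x \<in> Y \<Longrightarrow> f i x = poly q (x 0) * ymon a x"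
    using \<open>R \<noteq> 0\<close> by (rule single_exponent[OF gcd]) (use mono in auto)
  then show ?thesis by blast
qed

text \<open>
  After the permutation of the coordinates has been excluded, \<open>\<psi>\<close> is given by \<open>z \<mapsto> \<alpha> z\<close> and factors on the \<open>y\<^sub>i\<close>, where
  \<open>\<alpha>\<^sup>j = \<alpha>\<^sup>d\<close> for all \<open>j\<close> in the support of \<open>P\<close>. If \<open>\<alpha> \<noteq> 1\<close>, its order \<open>v > 1\<close> divides all \<open>d - j\<close>, and \<open>P\<close> would be
  \<open>z\<^sup>u Q(z\<^sup>v)\<close>.
\<close>

lemma diagonal_if_no_symmetry:
  assumes inj: "inj_on k {1..m}" and gcd: "Gcd (k ` {1..m}) = 1"
    and no_sym: "\<nexists>v. v > 1 \<and> (\<exists>u Q. P = monom 1 u * pcompose Q (monom 1 v))"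
  shows "\<exists>t\<in>diag_group. t 0 = 1 \<and> (\<forall>x\<in>Y. \<psi> x = act t x)"
proof -
  interpret inv: suspension_automorphism m d k P \<psi>' \<psi> g f by (rule inverse_automorphism)
  have P_monom: "P \<noteq> monom 1 d"
  proof
    assume "P = monom 1 d"
    then have "P = monom 1 d * pcompose 1 (monom 1 2)" by (simp add: pcompose_1)
    then show False using no_sym by (metis one_less_numeral_iff semiring_norm(76))
  qed
  have P_even: "P \<noteq> monom 1 2 + [:c:]" for c
  proof
    assume "P = monom 1 2 + [:c:]"
    then have "P = monom 1 0 * pcompose [:c, 1:] (monom 1 2)"
      by (intro poly_eqI_all) (simp add: poly_pcompose poly_monom)
    then show False using no_sym by (metis one_less_numeral_iff semiring_norm(76))
  qed
  obtain r where r: "\<And>x. x \<in> Y \<Longrightarrow> f 0 x = poly r (x 0)" using z_part_poly[OF gcd P_monom P_even] by blast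
  obtain r' where r': "\<And>x. x \<in> Y \<Longrightarrow> g 0 x = poly r' (x 0)" using inv.z_part_poly[OF gcd P_monom P_even] by blast
  obtain \<alpha> \<beta> where \<alpha>: "\<alpha> \<noteq> 0" "r = [:\<beta>, \<alpha>:]" using z_part_affine[OF r r'] by metis
  obtain \<alpha>' \<beta>' where \<alpha>': "\<alpha>' \<noteq> 0" "r' = [:\<beta>', \<alpha>':]" using inv.z_part_affine[OF r' r] by metis
  have f0: "f 0 x = \<beta> + \<alpha> * x 0" if "x \<in> Y" for x using r[OF that] \<alpha> by simp
  have g0: "g 0 x = \<beta>' + \<alpha>' * x 0" if "x \<in> Y" for x using r'[OF that] \<alpha>' by simp
  have "\<forall>i\<in>{1..m}. \<exists>a q. \<forall>x\<in>Y. f i x = poly q (x 0) * ymon a x"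
    using y_part_monomial[OF gcd \<alpha>(1) f0] by blast
  then obtain a q where fa: "\<And>i x. i \<in> {1..m} \<Longrightarrow> x \<in> Y \<Longrightarrow> f i x = poly (q i) (x 0) * ymon (a i) x" by metis
  have "\<forall>i\<in>{1..m}. \<exists>a q. \<forall>x\<in>Y. g i x = poly q (x 0) * ymon a x"
    using inv.y_part_monomial[OF gcd \<alpha>'(1) g0] by blast
  then obtain b q' where gb: "\<And>i x. i \<in> {1..m} \<Longrightarrow> x \<in> Y \<Longrightarrow> g i x = poly (q' i) (x 0) * ymon (b i) x" by metis
  have degq: "degree (q i) = 0" if "i \<in> {1..m}" for i
    using inv.exponents_compose(1)[OF \<alpha>'(1) g0 gb fa that] .
  have "\<exists>j\<in>{1..m}. \<forall>l\<in>{1..m}. a j l = (if l = i then 1 else 0)" if i: "i \<in> {1..m}" for i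
    using exponents_compose(2)[OF \<alpha>(1) f0 fa gb i] i
    by (intro nat_combination_eq_unit[where b = "b i"]) auto
  then obtain \<tau> where \<tau>: "\<And>i. i \<in> {1..m} \<Longrightarrow> \<tau> i \<in> {1..m}"
    "\<And>i l. i \<in> {1..m} \<Longrightarrow> l \<in> {1..m} \<Longrightarrow> a (\<tau> i) l = (if l = i then 1 else 0)" by metis
  have inj\<tau>: "inj_on \<tau> {1..m}"
    by (rule inj_onI) (metis \<tau>(2) zero_neq_one)
  define c where "c i = coeff (q (\<tau> i)) 0" for i
  have f\<tau>: "f (\<tau> i) x = c i * x i" if i: "i \<in> {1..m}" and x: "x \<in> Y" for i x
  proof -
    have "poly (q (\<tau> i)) (x 0) = c i" using degq[OF \<tau>(1)[OF i]] by (auto simp: c_def elim!: degree_eq_zeroE)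
    moreover have "ymon (a (\<tau> i)) x = ymon (unit_exp i) x"
      using \<tau>(2)[OF i] by (intro ymon_cong) (auto simp: unit_exp_def)
    ultimately show ?thesis using fa[OF \<tau>(1)[OF i] x] ymon_unit_exp[OF i] by simp
  qed
  have fi: "f i x = c i * x i" if "i \<in> {1..m}" "x \<in> Y" for i x
    using f\<tau>[OF that] permutation_trivial[OF inj \<alpha>(1) f0 \<tau>(1) inj\<tau> f\<tau> that(1)] by simp
  obtain t where t: "t \<in> diag_group" "t 0 = \<alpha>" "\<And>x. x \<in> Y \<Longrightarrow> \<psi> x = act t x"
    and supp: "\<And>j. coeff P j \<noteq> 0 \<Longrightarrow> \<alpha> ^ j = \<alpha> ^ d"
    using diagonal_conclusion[OF \<alpha>(1) f0 fi] by blast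
  have "\<alpha> = 1"
  proof (rule ccontr)
    assume "\<alpha> \<noteq> 1"
    have root: "\<alpha> ^ (d - j) = 1" if "coeff P j \<noteq> 0" for j
    proof -
      have "j \<le> d" using le_degree[OF that] degree by simp
      then have "\<alpha> ^ d = \<alpha> ^ (d - j) * \<alpha> ^ j" by (simp add: power_add[symmetric])
      then show ?thesis using supp[OF that] \<alpha>(1) by simp
    qed
    obtain j where j: "coeff P j \<noteq> 0" "j < d" using nonzero_lower_coeff[OF P_monom] by blast
    define v where "v = (LEAST n. n > 0 \<and> \<alpha> ^ n = 1)"
    have ex: "d - j > 0 \<and> \<alpha> ^ (d - j) = 1" using root j by simp
    have v: "v > 0" "\<alpha> ^ v = 1" using LeastI[of "\<lambda>n. n > 0 \<and> \<alpha> ^ n = 1", OF ex] by (auto simp: v_def)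
    have vdvd: "n mod v = 0" if "\<alpha> ^ n = 1" for n
    proof (rule ccontr)
      assume "n mod v \<noteq> 0"
      have "\<alpha> ^ n = \<alpha> ^ (v * (n div v) + n mod v)" by simp
      also have "\<dots> = \<alpha> ^ (n mod v)" unfolding power_add power_mult v(2) by simp
      finally have "v \<le> n mod v" unfolding v_def using \<open>n mod v \<noteq> 0\<close> that
        by (intro Least_le) (auto simp: v_def)
      then show False using mod_less_divisor[OF v(1), of n] by linarith
    qed
    have "j mod v = degree P mod v" if "coeff P j \<noteq> 0" for j
    proof -
      have "j \<le> d" using le_degree[OF that] degree by simp
      then show ?thesis using vdvd[OF root[OF that]] degree by (metis mod_eq_dvd_iff_nat mod_eq_0_iff_dvd)
    qed
    then have "\<exists>u Q. P = monom 1 u * pcompose Q (monom 1 v)" using v(1) by (intro poly_in_power_of_z)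
    moreover have "v \<noteq> 1" using v(2) \<open>\<alpha> \<noteq> 1\<close> by auto
    then have "v > 1" using v(1) by simp
    ultimately show False using no_sym by blast
  qed
  then show ?thesis using t by auto
qed

end

section \<open>Automorphisms when the polynomial is a power\<close>

lemma poly_eq_sum_upto:
  fixes p :: "'a::comm_semiring_1 poly"
  assumes "degree p \<le> N" shows "poly p x = (\<Sum>i\<le>N. coeff p i * x ^ i)"
  unfolding poly_altdef using assms by (intro sum.mono_neutral_left) (auto simp: coeff_eq_0)

context suspension_data
begin

definition fmon :: "(nat \<Rightarrow> nat) \<Rightarrow> (nat \<Rightarrow> 'a) \<Rightarrow> 'a" where
  "fmon E x = (\<Prod>l\<le>m. x l ^ E l)"

lemma fmon_eq: "fmon E x = x 0 ^ E 0 * ymon E x"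
proof -
  have "{..m} = insert 0 {1..m}" by auto
  then show ?thesis by (simp add: fmon_def ymon_def)
qed

lemma fmon_combination: "fmon (\<lambda>l. \<Sum>j\<in>J. b j * E j l) x = (\<Prod>j\<in>J. fmon (E j) x ^ b j)"
proof (induction J rule: infinite_finite_induct)
  case (insert j J)
  have "fmon (\<lambda>l. \<Sum>j\<in>insert j J. b j * E j l) x = fmon (\<lambda>l. b j * E j l) x * fmon (\<lambda>l. \<Sum>j\<in>J. b j * E j l) x"
    using insert.hyps by (simp add: fmon_def power_add prod.distrib)
  also have "fmon (\<lambda>l. b j * E j l) x = fmon (E j) x ^ b j"
    by (simp add: fmon_def prod_power_distrib power_mult[symmetric] mult.commute)
  finally show ?case using insert by simp
qed (auto simp: fmon_def)

definition one_point :: "nat \<Rightarrow> 'a" where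
  "one_point = (\<lambda>i. if i \<le> m then 1 else undefined)"

lemma ymon_one_point: "ymon a one_point = 1"
  by (auto simp: ymon_def one_point_def)

lemma one_point_in_Y: "P = monom 1 d \<Longrightarrow> one_point \<in> Y"
proof -
  assume "P = monom 1 d"
  then have "ymon k one_point = poly P (one_point 0)"
    unfolding ymon_one_point by (simp add: poly_monom one_point_def)
  moreover have "one_point \<in> {0..m} \<rightarrow>\<^sub>E UNIV" by (auto simp: one_point_def)
  ultimately show ?thesis by (simp only: suspension_iff simp_thms)
qed

lemma curve_one_point:
  assumes "P = monom 1 d" "wt w k = int d * w 0" "t \<noteq> 0"
  shows "curve w one_point t \<in> Y" "curve w one_point t 0 = t powi w 0"
    "ymon a (curve w one_point t) = t powi wt w a"
proof -
  show "curve w one_point t \<in> Y"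
    unfolding curve_def
  proof (rule act_in_Y[OF one_point_in_Y[OF assms(1)]])
    have "ymon k (\<lambda>i. t powi w i) = (t powi w 0) ^ d"
      unfolding ymon_powi[OF assms(3)] assms(2) by (simp add: mult.commute[of "int d"] power_int_mult)
    then show "ymon k (\<lambda>i. t powi w i) * poly P (one_point 0) = poly P (t powi w 0 * one_point 0)"
      by (simp add: assms(1) poly_monom one_point_def)
  qed
  show "curve w one_point t 0 = t powi w 0" by (simp add: curve_def one_point_def)
  show "ymon a (curve w one_point t) = t powi wt w a"
    unfolding curve_def ymon_act ymon_one_point using ymon_powi[OF assms(3)] by simp
qed

text \<open>
  The exponents of the character \<open>y\<^sup>k z\<^bsup>- d\<^esup>\<close>, which is trivial on the part of \<open>Y\<close> where no coordinate vanishes if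
  \<open>P = z\<^sup>d\<close>.
\<close>

definition full_exp :: "nat \<Rightarrow> int" where
  "full_exp i = (if i = 0 then - int d else int (k i))"

lemma Gcd_full_exp: "Gcd (full_exp ` {0..m}) = int (Gcd (insert d (k ` {1..m})))"
proof -
  have "{0..m} = insert 0 {1..m}" by auto
  then have "full_exp ` {0..m} = insert (- int d) (int ` k ` {1..m})" by (force simp: full_exp_def)
  then have "Gcd (full_exp ` {0..m}) = gcd (int d) (Gcd (int ` k ` {1..m}))" by simp
  then show ?thesis by (simp only: Gcd_int_eq gcd_int_int_eq Gcd_insert)
qed

text \<open>
  As in \<open>separating_weight\<close>, now for exponents \<open>(a, b)\<close> of monomials \<open>z\<^sup>b y\<^sup>a\<close> with reduced \<open>a\<close>: two of them do not
  differ by a multiple of \<open>(k, - d)\<close>.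
\<close>

lemma separating_weight_full:
  assumes gcd: "Gcd (insert d (k ` {1..m})) = 1" and "finite \<Psi>" "\<Psi> \<subseteq> reduced \<times> UNIV"
  obtains w :: "nat \<Rightarrow> int" where "wt w k = int d * w 0"
    "inj_on (\<lambda>(a, b). w 0 * int b + wt w a) \<Psi>"
proof -
  define \<delta> where "\<delta> = (\<lambda>((a :: nat \<Rightarrow> nat, b), (a' :: nat \<Rightarrow> nat, b')) i. if i = 0 then int b - int b' else int (a i) - int (a' i))"
  define B where "B = \<delta> ` {(p, q). p \<in> \<Psi> \<and> q \<in> \<Psi> \<and> p \<noteq> q}"
  have "{(p, q). p \<in> \<Psi> \<and> q \<in> \<Psi> \<and> p \<noteq> q} \<subseteq> \<Psi> \<times> \<Psi>" by auto
  then have "finite B" unfolding B_def using assms(2) by (intro finite_imageI) (meson finite_SigmaI finite_subset)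
  have I: "{..m} = insert 0 {1..m}" by auto
  have gcd_int: "Gcd (full_exp ` {..m}) = 1"
    using Gcd_full_exp gcd by (simp add: atLeast0AtMost)
  obtain w :: "nat \<Rightarrow> int" where w: "(\<Sum>i\<in>{..m}. w i * full_exp i) = 0" "\<And>b. b \<in> B \<Longrightarrow> (\<Sum>i\<in>{..m}. w i * b i) \<noteq> 0"
  proof (rule generic_weight[where \<kappa> = full_exp and I = "{..m}" and ?i0.0 = 0 and B = B])
    show "full_exp 0 \<noteq> 0" using d by (simp add: full_exp_def)
    fix v assume "v \<in> B"
    then obtain a b a' b' where ab: "(a, b) \<in> \<Psi>" "(a', b') \<in> \<Psi>" "(a, b) \<noteq> (a', b')" "v = \<delta> ((a, b), (a', b'))"
      by (auto simp: B_def)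
    show "\<exists>j\<in>{..m}. full_exp j * v 0 \<noteq> full_exp 0 * v j"
    proof (rule ccontr)
      assume "\<not> ?thesis"
      then obtain l where l: "\<And>j. j \<in> {..m} \<Longrightarrow> v j = full_exp j * l"
        using proportional_to_primitive[OF gcd_int, of 0 v] \<open>full_exp 0 \<noteq> 0\<close> by auto
      have diff: "int (a i) - int (a' i) = int (k i) * l" if "i \<in> {1..m}" for i
        using l[of i] that by (simp add: ab(4) \<delta>_def full_exp_def)
      then have "a = a'" using ab assms(3) by (intro reduced_eq_if_proportional_diff[of a a' l]) auto
      then have "l = 0" using diff[of 1] k[of 1] m by auto
      then have "b = b'" using l[of 0] by (simp add: ab(4) \<delta>_def)
      then show False using ab(3) \<open>a = a'\<close> by simp
    qed
  qed (use \<open>finite B\<close> in auto)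
  show ?thesis
  proof (rule that)
    show "wt w k = int d * w 0"
      using w(1) unfolding I by (simp add: full_exp_def mult.commute)
    show "inj_on (\<lambda>(a, b). w 0 * int b + wt w a) \<Psi>"
    proof (rule inj_onI, rule ccontr)
      fix p q assume pq: "p \<in> \<Psi>" "q \<in> \<Psi>" "p \<noteq> q"
        "(case p of (a, b) \<Rightarrow> w 0 * int b + wt w a)
          = (case q of (a, b) \<Rightarrow> w 0 * int b + wt w a)"
      obtain a b a' b' where [simp]: "p = (a, b)" "q = (a', b')" by (cases p, cases q)
      have "\<delta> (p, q) \<in> B" unfolding B_def using pq by blast
      moreover have "(\<Sum>i\<in>{..m}. w i * \<delta> (p, q) i)
          = w 0 * (int b - int b') + (\<Sum>i=1..m. w i * (int (a i) - int (a' i)))"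
        unfolding I by (simp add: \<delta>_def)
      then have "(\<Sum>i\<in>{..m}. w i * \<delta> (p, q) i) = 0"
        using pq(4) by (simp add: algebra_simps sum_subtractf)
      ultimately show False using w(2) by blast
    qed
  qed
qed

text \<open>
  If \<open>P = z\<^sup>d\<close>, the orbit through the point with all coordinates \<open>1\<close> determines a function: along it, for a separating weight, each
  monomial of the normal form contributes its own power of \<open>t\<close>.
\<close>

lemma single_term:
  assumes P: "P = monom 1 d" and gcd: "Gcd (insert d (k ` {1..m})) = 1" and "h \<in> polyfuns m"
    and mono: "\<And>w. wt w k = int d * w 0 \<Longrightarrow>
      \<exists>c n. \<forall>t. t \<noteq> 0 \<longrightarrow> h (curve w one_point t) = c * t powi n"
  shows "\<exists>c E. \<forall>x\<in>Y. h x = c * fmon E x"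
proof -
  obtain \<Phi> q where \<Phi>: "finite \<Phi>" "\<Phi> \<subseteq> reduced" "\<And>x. x \<in> Y \<Longrightarrow> h x = normal_sum \<Phi> q x"
    using normal_form_on_Y[OF assms(3)] by metis
  define N where "N = (\<Sum>a\<in>\<Phi>. degree (q a))"
  define \<Psi> where "\<Psi> = \<Phi> \<times> {..N}"
  have fin: "finite \<Psi>" using \<Phi>(1) by (simp add: \<Psi>_def)
  have h: "h x = (\<Sum>(a, b)\<in>\<Psi>. coeff (q a) b * x 0 ^ b * ymon a x)" if "x \<in> Y" for x
  proof -
    have "degree (q a) \<le> N" if "a \<in> \<Phi>" for a unfolding N_def using \<Phi>(1) that by (intro member_le_sum) auto
    then have "normal_sum \<Phi> q x = (\<Sum>a\<in>\<Phi>. (\<Sum>b\<le>N. coeff (q a) b * x 0 ^ b) * ymon a x)"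
      unfolding normal_sum_def by (intro sum.cong) (auto simp: poly_eq_sum_upto)
    then show ?thesis using \<Phi>(3)[OF that] by (simp add: \<Psi>_def sum.cartesian_product[symmetric] sum_distrib_right)
  qed
  obtain w where w: "wt w k = int d * w 0"
    "inj_on (\<lambda>(a, b). w 0 * int b + wt w a) \<Psi>" (is "inj_on ?e \<Psi>")
    using separating_weight_full[OF gcd fin] \<Phi>(2) by (auto simp: \<Psi>_def)
  obtain c n where cn: "\<And>t. t \<noteq> 0 \<Longrightarrow> h (curve w one_point t) = c * t powi n" using mono[OF w(1)] by blast
  have eq: "(\<Sum>p\<in>\<Psi>. (case p of (a, b) \<Rightarrow> coeff (q a) b) * t powi ?e p) = c * t powi n"
    if t: "t \<noteq> 0" for t
  proof -
    note cu = curve_one_point[OF P w(1) t]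
    have "h (curve w one_point t) = (\<Sum>p\<in>\<Psi>. (case p of (a, b) \<Rightarrow> coeff (q a) b) * t powi ?e p)"
      unfolding h[OF cu(1)] cu(2,3) using t
      by (intro sum.cong) (auto simp: power_int_add power_int_mult)
    then show ?thesis using cn[OF t] by simp
  qed
  have exp: "?e p = n" if "p \<in> \<Psi>" "(case p of (a, b) \<Rightarrow> coeff (q a) b) \<noteq> 0" for p
    using powi_sum_monomial[OF fin w(2) eq that(1)] that(2) by blast
  show ?thesis
  proof (cases "\<exists>p\<in>\<Psi>. (case p of (a, b) \<Rightarrow> coeff (q a) b) \<noteq> 0")
    case True
    then obtain a b where ab: "(a, b) \<in> \<Psi>" "coeff (q a) b \<noteq> 0" by auto
    have z: "coeff (q a') b' = 0" if "(a', b') \<in> \<Psi> - {(a, b)}" for a' b'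
    proof (rule ccontr)
      assume "coeff (q a') b' \<noteq> 0"
      then have "?e (a', b') = ?e (a, b)" using exp[of "(a', b')"] exp[of "(a, b)"] ab that by simp
      then show False using inj_onD[OF w(2)] that ab(1) by blast
    qed
    have "h x = coeff (q a) b * fmon (a(0 := b)) x" if "x \<in> Y" for x
    proof -
      have rest: "(\<Sum>(a, b)\<in>\<Psi> - {(a, b)}. coeff (q a) b * x 0 ^ b * ymon a x) = 0"
      proof (rule sum.neutral, rule ballI)
        fix p assume "p \<in> \<Psi> - {(a, b)}"
        then show "(case p of (a, b) \<Rightarrow> coeff (q a) b * x 0 ^ b * ymon a x) = 0"
          using z[of "fst p" "snd p"] by (cases p) simp
      qed
      have "h x = coeff (q a) b * x 0 ^ b * ymon a x"
        unfolding h[OF that] using fin ab(1) rest by (simp add: sum.remove[of _ "(a, b)"])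
      moreover have "ymon (a(0 := b)) x = ymon a x" by (rule ymon_cong) auto
      ultimately show ?thesis by (simp add: fmon_eq)
    qed
    then show ?thesis by blast
  next
    case False
    then have "h x = 0" if "x \<in> Y" for x unfolding h[OF that] by (intro sum.neutral) auto
    then show ?thesis by (intro exI[of _ 0]) auto
  qed
qed

end

context suspension_automorphism
begin

text \<open>
  Here \<open>z = 0\<close> is the singular locus, which \<open>\<psi>\<close> preserves, so no coordinate of \<open>\<psi>\<close> vanishes on the orbit.
\<close>

lemma monomial_if_power:
  assumes P: "P = monom 1 d" and gcd: "Gcd (insert d (k ` {1..m})) = 1" and i: "i \<le> m"
  shows "\<exists>c E. \<forall>x\<in>Y. f i x = c * fmon E x"
proof (rule single_term[OF P gcd f[OF i]])
  fix w assume w: "wt w k = int d * w 0"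
  have "f i (curve w one_point t) \<noteq> 0" if t: "t \<noteq> 0" for t
  proof -
    note cu = curve_one_point[OF P w t]
    have "poly P (curve w one_point t 0) \<noteq> 0" using cu(2) t by (simp add: P poly_monom)
    then have "curve w one_point t \<notin> Sing" by (simp add: Sing_def)
    then have "\<psi> (curve w one_point t) \<notin> Sing" using Sing_iff[OF cu(1)] by simp
    moreover have zero: "poly P 0 = 0" "poly (pderiv P) 0 = 0"
      using d by (auto simp: P poly_monom pderiv_monom power_0_left)
    ultimately have nz: "\<psi> (curve w one_point t) 0 \<noteq> 0"
      using \<psi>[OF cu(1)] zero by (auto simp: Sing_def)
    then have "\<forall>i\<in>{1..m}. \<psi> (curve w one_point t) i \<noteq> 0"
      using nonzero_coords[OF \<psi>[OF cu(1)]] by (simp add: P poly_monom)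
    then have "\<psi> (curve w one_point t) i \<noteq> 0" using nz i by (cases "i = 0") auto
    then show ?thesis using f_eq[OF i cu(1)] by simp
  qed
  then show "\<exists>c n. \<forall>t. t \<noteq> 0 \<longrightarrow> f i (curve w one_point t) = c * t powi n"
    using laurent_nowhere_zero[OF laurent_curve[OF f[OF i]]] by metis
qed

lemma full_exponents_compose:
  assumes P: "P = monom 1 d"
    and fE: "\<And>i x. i \<le> m \<Longrightarrow> x \<in> Y \<Longrightarrow> f i x = c i * fmon (E i) x"
    and gE: "\<And>i x. i \<le> m \<Longrightarrow> x \<in> Y \<Longrightarrow> g i x = c' i * fmon (E' i) x"
    and i: "i \<le> m" and l: "l \<le> m"
  shows "(\<Sum>j\<le>m. E' i j * E j l) = (if l = i then 1 else 0)"
proof -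
  define S where "S l = (\<Sum>j\<le>m. E' i j * E j l)" for l
  define C where "C = c' i * (\<Prod>j\<le>m. c j ^ E' i j)"
  have fmon_S: "fmon S x = (\<Prod>j\<le>m. fmon (E j) x ^ E' i j)" for x
    unfolding S_def[abs_def] by (rule fmon_combination)
  have eq: "x i = C * x 0 ^ S 0 * ymon S x" if x: "x \<in> Y" for x
  proof -
    have "x i = g i (\<psi> x)" using left_inverse[OF x] g_eq[OF i \<psi>[OF x]] by simp
    also have "\<dots> = c' i * (\<Prod>j\<le>m. \<psi> x j ^ E' i j)" using gE[OF i \<psi>[OF x]] by (simp add: fmon_def)
    also have "(\<Prod>j\<le>m. \<psi> x j ^ E' i j) = (\<Prod>j\<le>m. (c j * fmon (E j) x) ^ E' i j)"
      using f_eq fE x by (intro prod.cong) auto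
    also have "\<dots> = (\<Prod>j\<le>m. c j ^ E' i j) * fmon S x"
      unfolding fmon_S by (simp add: power_mult_distrib prod.distrib)
    finally show ?thesis by (simp add: C_def fmon_eq mult.assoc)
  qed
  have deg: "degree (monom C (S 0) * P ^ r) = S 0 + r * d" if "monom C (S 0) * P ^ r \<noteq> 0" for r
  proof -
    have "C \<noteq> 0" using that by auto
    then show ?thesis using P0 degree by (simp add: degree_mult_eq degree_power_eq degree_monom_eq)
  qed
  have "S l = (if l = i then 1 else 0)"
  proof (cases "i = 0")
    case True
    have "poly (monom C (S 0)) (x 0) * ymon S x = poly [:0, 1:] (x 0) * ymon (\<lambda>_. 0) x" if "x \<in> Y" for x
      using eq[OF that] True by (simp add: poly_monom)
    then obtain r where r: "\<And>j. j \<in> {1..m} \<Longrightarrow> S j = 0 + r * k j" "monom C (S 0) * P ^ r = [:0, 1:]"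
      by (rule monomial_eqD[OF _ reduced_zero]) auto
    have "S 0 + r * d = 1" using deg[of r] r(2) by auto
    then have "r = 0" "S 0 = 1" using d by (cases r; auto)+
    then show ?thesis using r(1)[of l] l True by (cases "l = 0") auto
  next
    case False
    then have i1: "i \<in> {1..m}" using i by auto
    have "poly (monom C (S 0)) (x 0) * ymon S x = poly 1 (x 0) * ymon (unit_exp i) x" if "x \<in> Y" for x
      using eq[OF that] ymon_unit_exp[OF i1] by (simp add: poly_monom)
    then obtain r where r: "\<And>j. j \<in> {1..m} \<Longrightarrow> S j = unit_exp i j + r * k j" "monom C (S 0) * P ^ r = 1"
      by (rule monomial_eqD[OF _ reduced_unit_exp[OF i1]]) auto
    have "S 0 + r * d = 0" using deg[of r] r(2) by auto
    then have "r = 0" "S 0 = 0" using d by auto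
    then show ?thesis using r(1)[of l] l False by (cases "l = 0") (auto simp: unit_exp_def)
  qed
  then show ?thesis by (simp add: S_def)
qed

text \<open>
  The exponents of \<open>\<psi>\<close> and of its inverse are inverse matrices of natural numbers, so \<open>\<psi>\<close> permutes the coordinates up to factors.
  It fixes the coordinate \<open>z\<close>: otherwise the equation of \<open>Y\<close> becomes one between \<open>y\<^sub>i\<^sup>d\<close> for some \<open>i\<close> and a monomial without \<open>y\<^sub>i\<close>,
  which is only possible for \<open>m = 1\<close> and \<open>d = k\<^sub>1\<close>, against the condition on the greatest common divisor.
\<close>

lemma diagonal_if_power:
  assumes P: "P = monom 1 d" and gcd: "Gcd (insert d (k ` {1..m})) = 1" and inj: "inj_on k {1..m}"
  shows "\<exists>t\<in>diag_group. \<forall>x\<in>Y. \<psi> x = act t x"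
proof -
  interpret inv: suspension_automorphism m d k P \<psi>' \<psi> g f by (rule inverse_automorphism)
  obtain c E where fE: "\<And>i x. i \<le> m \<Longrightarrow> x \<in> Y \<Longrightarrow> f i x = c i * fmon (E i) x"
    using monomial_if_power[OF P gcd] by metis
  obtain c' E' where gE: "\<And>i x. i \<le> m \<Longrightarrow> x \<in> Y \<Longrightarrow> g i x = c' i * fmon (E' i) x"
    using inv.monomial_if_power[OF P gcd] by metis
  have "\<exists>j\<in>{..m}. \<forall>l\<in>{..m}. E j l = (if l = i then 1 else 0)" if i: "i \<le> m" for i
    using full_exponents_compose[OF P fE gE i] i
    by (intro nat_combination_eq_unit[where b = "E' i"]) auto
  then obtain \<tau> where \<tau>: "\<And>i. i \<le> m \<Longrightarrow> \<tau> i \<le> m"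
    "\<And>i l. i \<le> m \<Longrightarrow> l \<le> m \<Longrightarrow> E (\<tau> i) l = (if l = i then 1 else 0)" by (metis atMost_iff)
  have inj\<tau>: "inj_on \<tau> {..m}"
    by (rule inj_onI) (metis \<tau>(2) atMost_iff zero_neq_one)
  then have surj: "\<tau> ` {..m} = {..m}" using \<tau>(1) by (intro endo_inj_surj) auto
  have f\<tau>: "f (\<tau> i) x = c (\<tau> i) * x i" if i: "i \<le> m" and x: "x \<in> Y" for i x
  proof -
    have "fmon (E (\<tau> i)) x = (\<Prod>l\<le>m. if l = i then x i else 1)"
      unfolding fmon_def using \<tau>(2)[OF i] by (intro prod.cong) auto
    then show ?thesis using fE[OF \<tau>(1)[OF i] x] i by simp
  qed
  have c: "c i \<noteq> 0" if "i \<le> m" for i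
  proof
    assume "c i = 0"
    then have "f i (\<psi>' one_point) = 0" using fE[OF that \<psi>'[OF one_point_in_Y[OF P]]] by simp
    then have "one_point i = 0"
      using f_eq[OF that \<psi>'[OF one_point_in_Y[OF P]]] right_inverse[OF one_point_in_Y[OF P]] by simp
    then show False using that by (simp add: one_point_def)
  qed
  have "\<tau> 0 = 0"
  proof (rule ccontr)
    assume \<tau>0: "\<tau> 0 \<noteq> 0"
    obtain i0 where i0: "i0 \<le> m" "\<tau> i0 = 0" using surj by (metis atMost_iff imageE le0)
    have i01: "i0 \<in> {1..m}" using i0 \<tau>0 by (cases "i0 = 0") auto
    have \<tau>1: "\<tau> i \<in> {1..m}" if "i \<le> m" "i \<noteq> i0" for i
    proof -
      have "\<tau> i \<noteq> 0" using inj_onD[OF inj\<tau>, of i i0] i0 that by auto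
      then show ?thesis using \<tau>(1)[OF that(1)] by auto
    qed
    define e where "e i = (if i \<in> {1..m} - {i0} then k (\<tau> i) else 0)" for i
    have ereduced: "e \<in> reduced" using i01 k[OF i01] by (auto simp: reduced_def e_def intro!: bexI[of _ i0])
    define C where "C = (\<Prod>i\<in>{..m} - {i0}. c (\<tau> i) ^ k (\<tau> i))"
    have "C \<noteq> 0" using c \<tau>(1) by (auto simp: C_def)
    have image: "\<tau> ` ({..m} - {i0}) = {1..m}"
    proof -
      have "\<tau> ` ({..m} - {i0}) = \<tau> ` {..m} - \<tau> ` {i0}"
        using i0 by (intro inj_on_image_set_diff[OF inj\<tau>]) auto
      also have "\<dots> = {1..m}" using surj i0 by auto
      finally show ?thesis .
    qed
    have eq: "poly [:c 0 ^ d:] (x 0) * ymon (\<lambda>l. d * unit_exp i0 l) x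
        = poly (monom C (k (\<tau> 0))) (x 0) * ymon e x" if x: "x \<in> Y" for x
    proof -
      have "(\<Prod>j=1..m. f j x ^ k j) = (\<Prod>i\<in>{..m} - {i0}. f (\<tau> i) x ^ k (\<tau> i))"
        unfolding image[symmetric]
        by (subst prod.reindex) (auto intro: inj_on_subset[OF inj\<tau>])
      also have "\<dots> = (\<Prod>i\<in>{..m} - {i0}. c (\<tau> i) ^ k (\<tau> i) * x i ^ k (\<tau> i))"
        using f\<tau> x by (intro prod.cong) (auto simp: power_mult_distrib)
      also have "\<dots> = C * (\<Prod>i\<in>insert 0 ({1..m} - {i0}). x i ^ k (\<tau> i))"
      proof -
        have "{..m} - {i0} = insert 0 ({1..m} - {i0})" using i01 by auto
        then show ?thesis by (simp add: prod.distrib C_def)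
      qed
      also have "(\<Prod>i\<in>insert 0 ({1..m} - {i0}). x i ^ k (\<tau> i)) = x 0 ^ k (\<tau> 0) * ymon e x"
      proof -
        have "(\<Prod>i\<in>{1..m} - {i0}. x i ^ k (\<tau> i)) = ymon e x"
          unfolding ymon_def by (intro prod.mono_neutral_cong_left) (auto simp: e_def)
        then show ?thesis by simp
      qed
      finally have "(\<Prod>j=1..m. f j x ^ k j) = C * x 0 ^ k (\<tau> 0) * ymon e x" by simp
      moreover have "(\<Prod>j=1..m. f j x ^ k j) = (c 0 * x i0) ^ d"
        using eq_on_Y[OF x] f\<tau>[OF i0(1) x] i0(2) by (simp add: P poly_monom)
      ultimately show ?thesis
        by (simp add: poly_monom ymon_scale ymon_unit_exp[OF i01] power_mult_distrib)
    qed
    have "monom C (k (\<tau> 0)) \<noteq> 0" using \<open>C \<noteq> 0\<close> by simp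
    with eq ereduced obtain l where l: "\<And>i. i \<in> {1..m} \<Longrightarrow> d * unit_exp i0 i = e i + l * k i"
      "[:c 0 ^ d:] * P ^ l = monom C (k (\<tau> 0))" by (rule monomial_eqD) auto
    have d_eq: "d = l * k i0" using l(1)[OF i01] by (simp add: unit_exp_def e_def)
    have "i = i0" if i: "i \<in> {1..m}" for i
    proof (rule ccontr)
      assume "i \<noteq> i0"
      then have "k (\<tau> i) = 0" using l(1)[OF i] i by (simp add: unit_exp_def e_def)
      then show False using k[OF \<tau>1[of i]] i \<open>i \<noteq> i0\<close> by simp
    qed
    then have one: "{1..m} = {i0}" using i01 by blast
    have "degree ([:c 0 ^ d:] * P ^ l) = l * d"
      using c[of 0] P0 degree by (simp add: degree_power_eq)
    then have "l * d = degree (monom C (k (\<tau> 0)))" unfolding l(2) by (rule sym)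
    then have "l * d = k (\<tau> 0)" using \<open>C \<noteq> 0\<close> by (simp add: degree_monom_eq)
    moreover have "\<tau> 0 = i0" using \<tau>1[of 0] i01 one by auto
    ultimately have "l * l * k i0 = k i0" using d_eq by simp
    then have "l = 1" using k[OF i01] by simp
    then have "Gcd (insert d (k ` {1..m})) = d" using d_eq one by simp
    then show False using gcd d by simp
  qed
  have \<tau>1: "\<tau> i \<in> {1..m}" if "i \<in> {1..m}" for i
  proof -
    have "\<tau> i \<noteq> 0" using inj_onD[OF inj\<tau>, of i 0] \<open>\<tau> 0 = 0\<close> that by auto
    then show ?thesis using \<tau>(1)[of i] that by auto
  qed
  have inj1: "inj_on \<tau> {1..m}" using inj\<tau> by (rule inj_on_subset) auto
  have f0: "f 0 x = 0 + c 0 * x 0" if "x \<in> Y" for x using f\<tau>[of 0 x] that \<open>\<tau> 0 = 0\<close> by simp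
  have c0: "c 0 \<noteq> 0" by (rule c) simp
  have f1: "f (\<tau> i) x = c (\<tau> i) * x i" if "i \<in> {1..m}" "x \<in> Y" for i x using f\<tau>[of i x] that by simp
  have \<tau>_id: "\<tau> i = i" if "i \<in> {1..m}" for i
    using permutation_trivial[OF inj c0 f0 \<tau>1 inj1 f1 that] .
  have fi: "f i x = c i * x i" if "i \<in> {1..m}" "x \<in> Y" for i x
    using f1[OF that] unfolding \<tau>_id[OF that(1)] .
  show ?thesis
  proof (rule diagonal_conclusion[OF c0 f0 fi])
    fix t assume "t \<in> diag_group" "\<And>x. x \<in> Y \<Longrightarrow> \<psi> x = act t x"
    then show ?thesis by blast
  qed
qed

end

section \<open>The automorphism group\<close>

lemma root_of_unity_exists:
  assumes "n > 1" obtains \<zeta> :: "'a::{alg_closed_field, field_char_0}" where "\<zeta> ^ n = 1" "\<zeta> \<noteq> 1"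
proof -
  have "\<exists>\<zeta>::'a. \<zeta> ^ n = 1 \<and> \<zeta> ^ 1 \<noteq> \<zeta> ^ 0"
  proof (rule ccontr)
    assume "\<not> ?thesis"
    then have "1 mod n = 0 mod n"
      using assms by (intro roots_of_unity_determine_exponent[where 'a = 'a]) auto
    then show False using assms by simp
  qed
  then show ?thesis using that by auto
qed

lemma power_int_prod: "(\<Prod>c\<in>C. x c :: 'a::field) powi b = (\<Prod>c\<in>C. x c powi b)"
  by (induction C rule: infinite_finite_induct) (auto simp: power_int_mult_distrib)

lemma prod_power_int: "(x::'a::field) \<noteq> 0 \<Longrightarrow> (\<Prod>i\<in>I. x powi e i) = x powi (\<Sum>i\<in>I. e i)"
  by (induction I rule: infinite_finite_induct) (auto simp: power_int_add)

lemma monomial_map_compose: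
  fixes \<tau> :: "'c \<Rightarrow> 'a::field"
  assumes "\<And>c. c \<in> C \<Longrightarrow> \<tau> c \<noteq> 0"
  shows "(\<Prod>i\<in>I. (\<Prod>c\<in>C. \<tau> c powi A i c) powi b i) = (\<Prod>c\<in>C. \<tau> c powi (\<Sum>i\<in>I. b i * A i c))"
proof -
  have "(\<Prod>i\<in>I. (\<Prod>c\<in>C. \<tau> c powi A i c) powi b i) = (\<Prod>i\<in>I. \<Prod>c\<in>C. \<tau> c powi (b i * A i c))"
    by (simp add: power_int_prod power_int_mult[symmetric] mult.commute)
  also have "\<dots> = (\<Prod>c\<in>C. \<Prod>i\<in>I. \<tau> c powi (b i * A i c))" by (rule prod.swap)
  finally show ?thesis using assms by (simp add: prod_power_int)
qed

lemma torus_carrier: "\<tau> \<in> carrier (torus n) \<longleftrightarrow> \<tau> \<in> {..<n} \<rightarrow>\<^sub>E UNIV - {0}"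
  by (simp add: torus_def Gm_def)

lemma torus_mult: "\<sigma> \<otimes>\<^bsub>torus n\<^esub> \<tau> = (\<lambda>i\<in>{..<n}. \<sigma> i * \<tau> i)"
  by (simp add: torus_def Gm_def)

lemma Aut_mult:
  assumes "a \<in> carrier (Aut I Z)" "b \<in> carrier (Aut I Z)"
  shows "a \<otimes>\<^bsub>Aut I Z\<^esub> b = compose Z a b"
  using assms by (simp add: Aut_def BijGroup_def)

context suspension_automorphism
begin

lemma restrict_in_Aut: "restrict \<psi> Y \<in> carrier (Aut {0..m} Y)"
proof -
  have bij: "bij_betw (restrict \<psi> Y) Y Y"
    by (rule bij_betw_byWitness[where f' = \<psi>']) (auto simp: left_inverse right_inverse \<psi> \<psi>')
  have inv: "inv_into Y (restrict \<psi> Y) x = \<psi>' x" if "x \<in> Y" for x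
    using bij that \<psi>' right_inverse by (intro inv_into_f_eq) (auto simp: bij_betw_def)
  have reg: "regular_on (coords {0..m}) Y (\<lambda>x. restrict \<psi> Y x j)" if "j \<in> {0..m}" for j
    unfolding regular_on_def using f[of j] f_eq[of j] that by (intro bexI[of _ "f j"]) auto
  have reg': "regular_on (coords {0..m}) Y (\<lambda>x. restrict (inv_into Y (restrict \<psi> Y)) Y x j)" if "j \<in> {0..m}" for j
    unfolding regular_on_def using g[of j] g_eq[of j] that inv by (intro bexI[of _ "g j"]) auto
  show ?thesis
    unfolding Aut_def BijGroup_def regular_maps_def
    using bij reg reg' inv by (auto simp: Bij_def \<psi> \<psi>')
qed

end

context suspension_data
begin

lemma Aut_automorphism:
  assumes "a \<in> carrier (Aut {0..m} Y)"
  obtains f g where "suspension_automorphism m d k P a (inv_into Y a) f g"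
proof -
  have a: "a \<in> Bij Y" "a \<in> regular_maps {0..m} Y {0..m} Y"
    "restrict (inv_into Y a) Y \<in> regular_maps {0..m} Y {0..m} Y"
    using assms by (auto simp: Aut_def BijGroup_def)
  have bij: "bij_betw a Y Y" using a(1) by (simp add: Bij_def)
  have "\<forall>j\<in>{0..m}. \<exists>h\<in>polyfuns m. \<forall>x\<in>Y. a x j = h x"
    using a(2) by (simp add: regular_maps_def regular_on_def)
  then obtain f where f: "\<And>j. j \<in> {0..m} \<Longrightarrow> f j \<in> polyfuns m" "\<And>j x. j \<in> {0..m} \<Longrightarrow> x \<in> Y \<Longrightarrow> a x j = f j x"
    by metis
  have "\<forall>j\<in>{0..m}. \<exists>h\<in>polyfuns m. \<forall>x\<in>Y. inv_into Y a x j = h x"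
    using a(3) by (simp add: regular_maps_def regular_on_def)
  then obtain g where g: "\<And>j. j \<in> {0..m} \<Longrightarrow> g j \<in> polyfuns m"
    "\<And>j x. j \<in> {0..m} \<Longrightarrow> x \<in> Y \<Longrightarrow> inv_into Y a x j = g j x"
    by metis
  show ?thesis
  proof (rule that, unfold_locales)
    show "a x \<in> Y" if "x \<in> Y" for x using bij that by (rule bij_betw_apply)
    show "inv_into Y a x \<in> Y" if "x \<in> Y" for x using bij_betw_inv_into[OF bij] that by (rule bij_betw_apply)
    show "inv_into Y a (a x) = x" if "x \<in> Y" for x using bij that by (rule bij_betw_inv_into_left)
    show "a (inv_into Y a x) = x" if "x \<in> Y" for x using bij that by (rule bij_betw_inv_into_right)
  qed (use f g in auto)
qed

lemma diag_group_act: "t \<in> diag_group \<Longrightarrow> x \<in> Y \<Longrightarrow> act t x \<in> Y"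
  by (rule act_in_Y) (auto simp: diag_group_def)

lemma diag_group_cong: "(\<And>i. i \<le> m \<Longrightarrow> s i = t i) \<Longrightarrow> s \<in> diag_group \<longleftrightarrow> t \<in> diag_group"
proof -
  assume eq: "\<And>i. i \<le> m \<Longrightarrow> s i = t i"
  then have "ymon k s = ymon k t" by (intro ymon_cong) auto
  then show ?thesis using eq by (simp add: diag_group_def)
qed

lemma diag_group_ymon_k:
  assumes "t \<in> diag_group"
  shows "ymon k t = t 0 ^ d" "coeff P j \<noteq> 0 \<Longrightarrow> t 0 ^ j = t 0 ^ d"
proof -
  have "Polynomial.smult (ymon k t) P = pcompose P [:0, t 0:]"
    using assms by (intro poly_eqI_all) (simp add: diag_group_def poly_pcompose mult.commute)
  moreover have "t 0 \<noteq> 0" using assms by (simp add: diag_group_def)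
  ultimately show "ymon k t = t 0 ^ d" "coeff P j \<noteq> 0 \<Longrightarrow> t 0 ^ j = t 0 ^ d"
    by (rule proportional_affine_substitution)+
qed

lemma act_inverse:
  assumes "t \<in> diag_group" "x \<in> Y" shows "act (\<lambda>i. inverse (t i)) (act t x) = x" "act t (act (\<lambda>i. inverse (t i)) x) = x"
proof -
  have "x \<in> {0..m} \<rightarrow>\<^sub>E UNIV" using assms(2) by (simp add: suspension_iff)
  then have "x i = undefined" if "\<not> i \<le> m" for i using that by auto
  then show "act (\<lambda>i. inverse (t i)) (act t x) = x" "act t (act (\<lambda>i. inverse (t i)) x) = x"
    using assms(1) by (auto simp: act_def diag_group_def fun_eq_iff)
qed

lemma diag_group_inverse:
  assumes "t \<in> diag_group" shows "(\<lambda>i. inverse (t i)) \<in> diag_group"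
proof -
  have t: "t i \<noteq> 0" if "i \<le> m" for i using assms that by (simp add: diag_group_def)
  have inv: "ymon k (\<lambda>i. inverse (t i)) = inverse (ymon k t)"
    using prod_inversef[of "\<lambda>i. t i ^ k i" "{1..m}"] by (simp add: ymon_def power_inverse o_def)
  have nz: "ymon k t \<noteq> 0" using t by (intro ymon_nonzero) auto
  have shift: "ymon k t * poly P (inverse (t 0) * z) = poly P z" for z
  proof -
    have e: "t 0 * (inverse (t 0) * z) = z" using t[of 0] by (simp add: mult.assoc[symmetric])
    have "ymon k t * poly P (inverse (t 0) * z) = poly P (t 0 * (inverse (t 0) * z))"
      using assms by (simp add: diag_group_def)
    then show ?thesis unfolding e .
  qed
  have "ymon k (\<lambda>i. inverse (t i)) * poly P z = poly P (inverse (t 0) * z)" for z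
    unfolding inv shift[symmetric, of z] using nz by (simp add: mult.assoc[symmetric])
  then show ?thesis using t by (simp add: diag_group_def)
qed

lemma diag_group_automorphism:
  assumes "t \<in> diag_group"
  shows "suspension_automorphism m d k P (act t) (act (\<lambda>i. inverse (t i))) (\<lambda>i x. t i * x i) (\<lambda>i x. inverse (t i) * x i)"
  by unfold_locales
    (use assms diag_group_act diag_group_inverse act_inverse in \<open>auto intro: subalgebra.mult subalgebra.const polyfuns_coord\<close>)

lemma diag_group_in_Aut: "t \<in> diag_group \<Longrightarrow> restrict (act t) Y \<in> carrier (Aut {0..m} Y)"
  by (rule suspension_automorphism.restrict_in_Aut[OF diag_group_automorphism])

lemma generic_point:
  obtains x where "x \<in> Y" "\<And>i. i \<le> m \<Longrightarrow> x i \<noteq> 0"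
proof -
  have "P * [:0, 1:] \<noteq> 0" using P0 by simp
  then obtain z where z: "poly (P * [:0, 1:]) z \<noteq> 0" using nonroot_exists by blast
  obtain x where x: "x \<in> Y" "x 0 = z" "\<forall>i\<in>{1..m}. x i \<noteq> 0" using point_over[of z] z by auto
  have "x i \<noteq> 0" if "i \<le> m" for i using x z that by (cases "i = 0") auto
  then show ?thesis using x that by blast
qed

lemma act_determines:
  assumes "\<And>x. x \<in> Y \<Longrightarrow> act s x = act t x" "i \<le> m" shows "s i = t i"
proof -
  obtain x where x: "x \<in> Y" "\<And>i. i \<le> m \<Longrightarrow> x i \<noteq> 0" using generic_point by blast
  have "act s x i = act t x i" using assms(1)[OF x(1)] by simp
  then show ?thesis using x assms(2) by simp
qed

definition coord_elem :: "nat \<Rightarrow> 'a \<Rightarrow> nat \<Rightarrow> 'a" where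
  "coord_elem i y = (\<lambda>l. if l = i then y else 1)"

lemma ymon_coord_elem: "i \<in> {1..m} \<Longrightarrow> ymon c (coord_elem i y) = y ^ c i"
proof -
  assume i: "i \<in> {1..m}"
  have "ymon c (coord_elem i y) = (\<Prod>l=1..m. if l = i then y ^ c i else 1)"
    unfolding ymon_def by (intro prod.cong) (auto simp: coord_elem_def)
  then show ?thesis using i by simp
qed

subsection \<open>Necessity\<close>

text \<open>
  The swap of \<open>y\<^sub>i\<close> and \<open>y\<^sub>j\<close> conjugates the diagonal automorphism with entries \<open>2\<close> and \<open>1/2\<close> to its inverse.
\<close>

lemma exponents_distinct_if_commutative:
  assumes comm: "\<And>a b x. a \<in> carrier (Aut {0..m} Y) \<Longrightarrow> b \<in> carrier (Aut {0..m} Y) \<Longrightarrow> x \<in> Y \<Longrightarrow>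
      a (b x) = b (a x)"
  shows "inj_on k {1..m}"
proof (rule inj_onI, rule ccontr)
  fix i j assume ij: "i \<in> {1..m}" "j \<in> {1..m}" "k i = k j" "i \<noteq> j"
  define s where "s l = (if l = i then j else if l = j then i else l)" for l
  have s: "s (s l) = l" "k (s l) = k l" "l \<in> {1..m} \<Longrightarrow> s l \<in> {1..m}" "l \<le> m \<Longrightarrow> s l \<le> m" "s 0 = 0" for l
    using ij by (auto simp: s_def)
  have sY: "x \<circ> s \<in> Y" if x: "x \<in> Y" for x
  proof -
    have "ymon k (x \<circ> s) = (\<Prod>l=1..m. x (s l) ^ k (s l))" by (simp add: ymon_def s(2))
    also have "\<dots> = ymon k x"
      unfolding ymon_def by (rule prod.reindex_bij_witness[of _ s s]) (use ij in \<open>auto simp: s_def\<close>)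
    finally have "ymon k (x \<circ> s) = poly P ((x \<circ> s) 0)" using ymon_k[OF x] s(5) by simp
    moreover have "s l = l" if "l > m" for l using that ij by (auto simp: s_def)
    then have "x \<circ> s \<in> {0..m} \<rightarrow>\<^sub>E UNIV" using x by (auto simp: suspension_iff PiE_def extensional_def)
    ultimately show ?thesis by (simp add: suspension_iff)
  qed
  interpret swap: suspension_automorphism m d k P "\<lambda>x. x \<circ> s" "\<lambda>x. x \<circ> s" "\<lambda>l x. x (s l)" "\<lambda>l x. x (s l)"
    by unfold_locales (auto simp: sY s intro!: polyfuns_coord)
  define t where "t l = coord_elem i 2 l * coord_elem j (inverse 2) l" for l
  have "ymon k t = 1"
    unfolding t_def[abs_def] ymon_mult ymon_coord_elem[OF ij(1)] ymon_coord_elem[OF ij(2)]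
    using ij(3) by (simp add: power_mult_distrib[symmetric])
  then have "t \<in> diag_group" using ij by (auto simp: diag_group_def t_def coord_elem_def)
  obtain x where x: "x \<in> Y" "\<And>i. i \<le> m \<Longrightarrow> x i \<noteq> 0" using generic_point by blast
  have "restrict (\<lambda>x. x \<circ> s) Y (restrict (act t) Y x) = restrict (act t) Y (restrict (\<lambda>x. x \<circ> s) Y x)"
    by (rule comm[OF swap.restrict_in_Aut diag_group_in_Aut[OF \<open>t \<in> diag_group\<close>] x(1)])
  then have "(act t x \<circ> s) i = act t (x \<circ> s) i" using x(1) sY diag_group_act[OF \<open>t \<in> diag_group\<close>] by simp
  then have "inverse 2 * x j = 2 * x j" using ij by (simp add: s_def t_def coord_elem_def)
  then have "inverse 2 = (2::'a)" using x(2)[of j] ij by simp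
  then have "of_nat 4 = (of_nat 1 :: 'a)" by (simp add: field_simps)
  then show False by (simp only: of_nat_eq_iff)
qed

lemma diagonal_if_commutative:
  assumes comm: "\<And>a b x. a \<in> carrier (Aut {0..m} Y) \<Longrightarrow> b \<in> carrier (Aut {0..m} Y) \<Longrightarrow> x \<in> Y \<Longrightarrow>
      a (b x) = b (a x)"
    and a: "a \<in> carrier (Aut {0..m} Y)"
  shows "\<exists>t\<in>diag_group. a = restrict (act t) Y"
proof -
  obtain f g where "suspension_automorphism m d k P a (inv_into Y a) f g" using Aut_automorphism[OF a] .
  then interpret A: suspension_automorphism m d k P a "inv_into Y a" f g .
  have "a (act t x) = act t (a x)" if t: "t \<in> fibre_torus" "t 0 = 1" and x: "x \<in> Y" for t x
  proof -
    have "t i \<noteq> 0" if "i \<le> m" for i using that t by (cases "i = 0") (auto simp: fibre_torus_def)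
    then have "t \<in> diag_group" using t by (simp add: diag_group_def fibre_torus_def)
    then show ?thesis using comm[OF a diag_group_in_Aut x] x A.\<psi> by simp
  qed
  then obtain t where t: "t \<in> diag_group" "\<And>x. x \<in> Y \<Longrightarrow> a x = act t x" using A.centralizer_diagonal by blast
  have "a \<in> extensional Y" using a by (simp add: Aut_def BijGroup_def Bij_def)
  then have "a = restrict (act t) Y" using t(2) by (auto simp: extensional_def restrict_def fun_eq_iff)
  then show ?thesis using t(1) by blast
qed

text \<open>
  Divisibility of the torus, transported to the diagonal group.
\<close>

lemma diag_group_divisible:
  fixes \<phi> :: "(nat \<Rightarrow> 'a) \<Rightarrow> (nat \<Rightarrow> 'a) \<Rightarrow> nat \<Rightarrow> 'a"
  assumes \<phi>: "\<phi> \<in> iso (torus n) (Aut {0..m} Y)"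
    and diag: "\<And>a. a \<in> carrier (Aut {0..m} Y) \<Longrightarrow> \<exists>t\<in>diag_group. a = restrict (act t) Y"
    and s: "s \<in> diag_group" and "N > 0"
  obtains t where "t \<in> diag_group" "\<And>i. i \<le> m \<Longrightarrow> s i = t i ^ N"
proof -
  have bij: "bij_betw \<phi> (carrier (torus n)) (carrier (Aut {0..m} Y))" and hom: "\<phi> \<in> hom (torus n) (Aut {0..m} Y)"
    using \<phi> by (auto simp: iso_def)
  obtain \<sigma> where \<sigma>: "\<sigma> \<in> carrier (torus n)" "\<phi> \<sigma> = restrict (act s) Y"
    using bij diag_group_in_Aut[OF s] by (metis bij_betw_imp_surj_on imageE)
  have "\<forall>c. \<exists>y. y ^ N = \<sigma> c" by (intro allI nth_root_exists assms(4))
  then obtain y where y: "\<And>c. y c ^ N = \<sigma> c" by metis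
  \<comment> \<open>The powers of an \<open>N\<close>-th root of \<open>\<sigma>\<close> in the torus.\<close>
  define pw where "pw r = (\<lambda>c\<in>{..<n}. y c ^ r)" for r
  have nz: "y c \<noteq> 0" if "c < n" for c
    using \<sigma>(1) y[of c] that assms(4) by (auto simp: torus_carrier PiE_def Pi_def power_0_left)
  have pw: "pw r \<in> carrier (torus n)" for r using nz by (auto simp: torus_carrier pw_def)
  have \<sigma>_pw: "\<sigma> = pw N" using \<sigma>(1) y by (auto simp: torus_carrier pw_def PiE_def extensional_def fun_eq_iff)
  have carr: "\<phi> (pw r) \<in> carrier (Aut {0..m} Y)" for r using hom pw by (auto simp: hom_def)
  obtain t where t: "t \<in> diag_group" "\<phi> (pw 1) = restrict (act t) Y" using diag[OF carr] by blast
  have power: "\<phi> (pw (Suc r)) x = act (\<lambda>i. t i ^ Suc r) x" if x: "x \<in> Y" for r x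
    using x
  proof (induction r arbitrary: x)
    case 0
    then show ?case using t(2) by simp
  next
    case (Suc r)
    have "pw (Suc (Suc r)) = pw (Suc r) \<otimes>\<^bsub>torus n\<^esub> pw 1"
      by (auto simp: torus_mult pw_def fun_eq_iff)
    then have "\<phi> (pw (Suc (Suc r))) = \<phi> (pw (Suc r)) \<otimes>\<^bsub>Aut {0..m} Y\<^esub> \<phi> (pw 1)"
      using hom pw by (simp add: hom_def)
    also have "\<dots> = compose Y (\<phi> (pw (Suc r))) (\<phi> (pw 1))" by (rule Aut_mult[OF carr carr])
    finally have "\<phi> (pw (Suc (Suc r))) x = \<phi> (pw (Suc r)) (act t x)"
      using Suc.prems t(2) by (simp add: compose_def)
    also have "\<dots> = act (\<lambda>i. t i ^ Suc r) (act t x)" using Suc.IH diag_group_act[OF t(1) Suc.prems] by blast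
    finally show ?case by (auto simp: act_def fun_eq_iff)
  qed
  obtain r where r: "N = Suc r" using assms(4) by (cases N) auto
  have "act s x = act (\<lambda>i. t i ^ N) x" if "x \<in> Y" for x
    using power[OF that, of r] \<sigma> \<sigma>_pw r that by simp
  then have "s i = t i ^ N" if "i \<le> m" for i using act_determines[of s "\<lambda>i. t i ^ N" i] that by blast
  then show ?thesis using t(1) that by blast
qed

text \<open>
  A common divisor \<open>g > 1\<close> of the exponents gives the character \<open>y\<^bsup>k/g\<^esup>\<close>, which takes a \<open>g\<close>-th root of unity other than \<open>1\<close> as a value on
  the diagonal group. The element produced here will turn out to have no \<open>N\<close>-th root for suitable \<open>N\<close>.
\<close>

lemma gcd_element:
  assumes g: "g > 1" "\<And>i. i \<in> {1..m} \<Longrightarrow> g dvd k i"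
  obtains t \<zeta> where "t \<in> diag_group" "t 0 = 1" "ymon (\<lambda>i. k i div g) t = \<zeta>" "\<zeta> \<noteq> 1"
proof -
  obtain \<zeta> :: 'a where \<zeta>: "\<zeta> ^ g = 1" "\<zeta> \<noteq> 1" using root_of_unity_exists[OF g(1)] .
  have 1: "1 \<in> {1..m}" using m by auto
  have "k 1 div g \<noteq> 0" using g(2)[OF 1] k[OF 1] by (metis dvd_div_eq_0_iff not_numeral_le_zero)
  then have "k 1 div g > 0" by simp
  then obtain y where y: "y ^ (k 1 div g) = \<zeta>" using nth_root_exists by blast
  have "y ^ k 1 = (y ^ (k 1 div g)) ^ g" using g(2)[OF 1] by (simp add: power_mult[symmetric])
  then have yk: "y ^ k 1 = 1" using y \<zeta> by simp
  then have "y \<noteq> 0" using k[OF 1] by (auto simp: power_0_left)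
  then have "coord_elem 1 y \<in> diag_group"
    using yk ymon_coord_elem[OF 1, of k y] by (simp add: diag_group_def) (simp add: coord_elem_def)
  then show ?thesis using y \<zeta> ymon_coord_elem[OF 1, of "\<lambda>i. k i div g" y]
    by (intro that[of "coord_elem 1 y" \<zeta>]) (auto simp: coord_elem_def)
qed

lemma ymon_quotient_power:
  assumes "\<And>i. i \<in> {1..m} \<Longrightarrow> g dvd k i" "\<And>i. i \<le> m \<Longrightarrow> s i = t i ^ (g * V)"
  shows "ymon (\<lambda>i. k i div g) s = ymon k t ^ V"
proof -
  have "ymon (\<lambda>i. k i div g) s = ymon (\<lambda>i. V * k i) t"
    unfolding ymon_def
  proof (intro prod.cong refl)
    fix i assume i: "i \<in> {1..m}"
    have "g * V * (k i div g) = V * (g * (k i div g))" by (simp only: mult_ac)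
    also have "g * (k i div g) = k i" using assms(1)[OF i] by simp
    finally have e: "g * V * (k i div g) = V * k i" .
    have "s i ^ (k i div g) = (t i ^ (g * V)) ^ (k i div g)" using assms(2)[of i] i by simp
    then show "s i ^ (k i div g) = t i ^ (V * k i)" by (simp only: power_mult[symmetric] e)
  qed
  then show ?thesis by (simp add: ymon_scale)
qed

text \<open>
  Once the automorphism group is known to be the diagonal group, every condition that fails produces a diagonal element without an
  \<open>N\<close>-th root. For \<open>P = z\<^sup>d\<close> take \<open>N = g\<close>, the greatest common divisor. Otherwise \<open>P\<close> has a nonzero coefficient at some \<open>z\<^sup>j\<close> with
  \<open>j < d\<close>, so all diagonal elements have \<open>t\<^sub>0\<^sup>V = 1\<close> for \<open>V = d - j\<close>; a symmetry of \<open>P\<close> provides an element with \<open>t\<^sub>0 \<noteq> 1\<close>, which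
  has no \<open>V\<close>-th root, and a common divisor \<open>g\<close> of the exponents one without a \<open>g V\<close>-th root.
\<close>

lemma conditions_if_torus:
  assumes "Aut_is_torus {0..m} Y"
  shows "inj_on k {1..m} \<and>
    ((P = monom 1 d \<and> Gcd (insert d (k ` {1..m})) = 1) \<or>
     ((\<nexists>v. v > 1 \<and> (\<exists>u Q. P = monom 1 u * pcompose Q (monom 1 v))) \<and>
      Gcd (k ` {1..m}) = 1))"
proof -
  obtain n and \<phi> :: "(nat \<Rightarrow> 'a) \<Rightarrow> (nat \<Rightarrow> 'a) \<Rightarrow> nat \<Rightarrow> 'a"
    where \<phi>: "\<phi> \<in> iso (torus n) (Aut {0..m} Y)"
    using assms by (auto simp: Aut_is_torus_def)
  have bij: "bij_betw \<phi> (carrier (torus n)) (carrier (Aut {0..m} Y))" and hom: "\<phi> \<in> hom (torus n) (Aut {0..m} Y)"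
    using \<phi> by (auto simp: iso_def)
  have comm: "a (b x) = b (a x)"
    if ab: "a \<in> carrier (Aut {0..m} Y)" "b \<in> carrier (Aut {0..m} Y)" and x: "x \<in> Y" for a b x
  proof -
    obtain \<sigma> \<tau> where st: "\<sigma> \<in> carrier (torus n)" "a = \<phi> \<sigma>" "\<tau> \<in> carrier (torus n)" "b = \<phi> \<tau>"
      using ab bij by (metis bij_betw_imp_surj_on imageE)
    have "\<sigma> \<otimes>\<^bsub>torus n\<^esub> \<tau> = \<tau> \<otimes>\<^bsub>torus n\<^esub> \<sigma>" by (simp add: torus_mult mult.commute)
    then have "a \<otimes>\<^bsub>Aut {0..m} Y\<^esub> b = b \<otimes>\<^bsub>Aut {0..m} Y\<^esub> a" using st hom by (metis hom_mult)
    then have "compose Y a b x = compose Y b a x"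
      unfolding Aut_mult[OF ab] Aut_mult[OF ab(2,1)] by (rule fun_cong)
    then show ?thesis using x by (simp add: compose_def)
  qed
  have diag: "\<exists>t\<in>diag_group. a = restrict (act t) Y" if "a \<in> carrier (Aut {0..m} Y)" for a
    by (rule diagonal_if_commutative[OF _ that]) (rule comm)
  note divisible = diag_group_divisible[OF \<phi> diag]
  have 1: "1 \<in> {1..m}" using m by auto
  show ?thesis
  proof (intro conjI)
    show "inj_on k {1..m}" by (rule exponents_distinct_if_commutative) (rule comm)
    show "(P = monom 1 d \<and> Gcd (insert d (k ` {1..m})) = 1) \<or>
     ((\<nexists>v. v > 1 \<and> (\<exists>u Q. P = monom 1 u * pcompose Q (monom 1 v))) \<and> Gcd (k ` {1..m}) = 1)"
    proof (cases "P = monom 1 d")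
      case True
      define g where "g = Gcd (insert d (k ` {1..m}))"
      have gd: "g dvd d" and gk: "\<And>i. i \<in> {1..m} \<Longrightarrow> g dvd k i"
        unfolding g_def by (rule Gcd_dvd, simp)+
      have "g = 1"
      proof (rule ccontr)
        assume "g \<noteq> 1"
        moreover have "g \<noteq> 0" using gd d by (metis dvd_0_left not_numeral_le_zero)
        ultimately have g1: "g > 1" by simp
        obtain s \<zeta> where s: "s \<in> diag_group" "s 0 = 1" "ymon (\<lambda>i. k i div g) s = \<zeta>" "\<zeta> \<noteq> 1"
          using gcd_element[OF g1 gk] by blast
        obtain t where t: "t \<in> diag_group" "\<And>i. i \<le> m \<Longrightarrow> s i = t i ^ g"
          using divisible[OF _ s(1), of g] g1 by (metis gr_implies_not0 neq0_conv)
        have "\<zeta> = ymon k t ^ 1" using s(3) t(2) gk by (subst ymon_quotient_power[symmetric, of g s t 1]) auto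
        also have "\<dots> = t 0 ^ d" using diag_group_ymon_k(1)[OF t(1)] by simp
        also have "\<dots> = (t 0 ^ g) ^ (d div g)" using gd by (simp add: power_mult[symmetric])
        also have "\<dots> = 1" using t(2)[of 0] s(2) by simp
        finally show False using s(4) by simp
      qed
      then show ?thesis using True by (simp add: g_def)
    next
      case False
      obtain j where j: "coeff P j \<noteq> 0" "j < d" using nonzero_lower_coeff[OF False] by blast
      define V where "V = d - j"
      have V: "t 0 ^ V = 1" if "t \<in> diag_group" for t
      proof -
        have "t 0 ^ d = t 0 ^ V * t 0 ^ j" using j(2) by (simp add: V_def power_add[symmetric])
        moreover have "t 0 ^ j = t 0 ^ d" "t 0 \<noteq> 0" using diag_group_ymon_k(2)[OF that j(1)] that by (auto simp: diag_group_def)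
        ultimately show ?thesis by simp
      qed
      have "V > 0" using j(2) by (simp add: V_def)
      have "\<nexists>v. v > 1 \<and> (\<exists>u Q. P = monom 1 u * pcompose Q (monom 1 v))"
      proof
        assume "\<exists>v. v > 1 \<and> (\<exists>u Q. P = monom 1 u * pcompose Q (monom 1 v))"
        then obtain v u Q where v: "v > 1" "P = monom 1 u * pcompose Q (monom 1 v)" by blast
        obtain \<zeta> :: 'a where \<zeta>: "\<zeta> ^ v = 1" "\<zeta> \<noteq> 1" using root_of_unity_exists[OF v(1)] .
        have "\<zeta> \<noteq> 0" using \<zeta>(1) v(1) by (auto simp: power_0_left)
        obtain y where y: "y ^ k 1 = \<zeta> ^ u" using nth_root_exists[of "k 1" "\<zeta> ^ u"] k[OF 1] by auto
        have "y \<noteq> 0" using y \<open>\<zeta> \<noteq> 0\<close> k[OF 1] by (auto simp: power_0_left)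
        define s where "s = (coord_elem 1 y)(0 := \<zeta>)"
        have "ymon k s = ymon k (coord_elem 1 y)" by (rule ymon_cong) (auto simp: s_def)
        then have "ymon k s = \<zeta> ^ u" using ymon_coord_elem[OF 1, of k y] y by simp
        moreover have "\<zeta> ^ u * poly P z = poly P (\<zeta> * z)" for z
          using \<zeta>(1) by (simp add: v(2) poly_monom poly_pcompose power_mult_distrib)
        ultimately have "s \<in> diag_group" using \<open>y \<noteq> 0\<close> \<open>\<zeta> \<noteq> 0\<close> by (auto simp: diag_group_def s_def coord_elem_def)
        then obtain t where t: "t \<in> diag_group" "\<And>i. i \<le> m \<Longrightarrow> s i = t i ^ V"
          using divisible[OF _ _ \<open>V > 0\<close>] by blast
        then have "\<zeta> = 1" using V[OF t(1)] t(2)[of 0] by (simp add: s_def)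
        then show False using \<zeta>(2) by simp
      qed
      moreover have "Gcd (k ` {1..m}) = 1"
      proof (rule ccontr)
        define g where "g = Gcd (k ` {1..m})"
        have gk: "\<And>i. i \<in> {1..m} \<Longrightarrow> g dvd k i" by (auto simp: g_def)
        assume "Gcd (k ` {1..m}) \<noteq> 1"
        then have "g \<noteq> 1" by (simp add: g_def)
        moreover have "g \<noteq> 0" using gk[OF 1] k[OF 1] by (metis dvd_0_left not_numeral_le_zero)
        ultimately have g1: "g > 1" by simp
        obtain s \<zeta> where s: "s \<in> diag_group" "s 0 = 1" "ymon (\<lambda>i. k i div g) s = \<zeta>" "\<zeta> \<noteq> 1"
          using gcd_element[OF g1 gk] by blast
        have "g * V > 0" using g1 \<open>V > 0\<close> by simp
        then obtain t where t: "t \<in> diag_group" "\<And>i. i \<le> m \<Longrightarrow> s i = t i ^ (g * V)"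
          using divisible[OF _ s(1)] by blast
        have "\<zeta> = ymon k t ^ V" using s(3) ymon_quotient_power[OF gk t(2)] by simp
        also have "\<dots> = (t 0 ^ V) ^ d" using diag_group_ymon_k(1)[OF t(1)] by (simp add: power_mult[symmetric] mult.commute)
        also have "\<dots> = 1" using V[OF t(1)] by simp
        finally show False using s(4) by simp
      qed
      ultimately show ?thesis by blast
    qed
  qed
qed

subsection \<open>Sufficiency\<close>

text \<open>
  If \<open>Aut(Y)\<close> consists of diagonal elements supported on \<open>I\<close> and these are cut out by one primitive character \<open>t\<^sup>\<kappa> = 1\<close>, the
  matrices \<open>A\<close> and \<open>B\<close> of \<open>primitive_vector_complement\<close> are exponents of mutually inverse monomial maps between a torus and
  \<open>Aut(Y)\<close>. The torus acts on each coordinate by a Laurent monomial, which makes the action algebraic.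
\<close>

lemma torus_if_diagonal:
  fixes \<kappa> :: "nat \<Rightarrow> int"
  assumes I: "I \<subseteq> {0..m}" "card I = Suc n" and gcd: "Gcd (\<kappa> ` I) = 1"
    and diag_group: "\<And>t. (\<And>i. i \<in> I \<Longrightarrow> t i \<noteq> 0) \<Longrightarrow> (\<And>i. i \<notin> I \<Longrightarrow> t i = 1) \<Longrightarrow>
        t \<in> diag_group \<longleftrightarrow> (\<Prod>i\<in>I. t i powi \<kappa> i) = 1"
    and diag: "\<And>a. a \<in> carrier (Aut {0..m} Y) \<Longrightarrow>
        \<exists>t\<in>diag_group. (\<forall>i\<le>m. i \<notin> I \<longrightarrow> t i = 1) \<and> (\<forall>x\<in>Y. a x = act t x)"
  shows "Aut_is_torus {0..m} Y"
proof -
  have fin: "finite I" using I(1) by (rule finite_subset) simp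
  obtain A B u where A: "\<And>c. c < n \<Longrightarrow> (\<Sum>l\<in>I. \<kappa> l * A l c) = 0"
    and BA: "\<And>c c'. c < n \<Longrightarrow> c' < n \<Longrightarrow> (\<Sum>l\<in>I. B c l * A l c') = (if c = c' then 1 else 0)"
    and AB: "\<And>i l. i \<in> I \<Longrightarrow> l \<in> I \<Longrightarrow> (\<Sum>c<n. A i c * B c l) = (if i = l then 1 else 0) - u i * \<kappa> l"
    using primitive_vector_complement[OF fin I(2) gcd] by blast
  define T :: "(nat \<Rightarrow> 'a) \<Rightarrow> nat \<Rightarrow> 'a" where
    "T \<tau> i = (if i \<in> I then \<Prod>c<n. \<tau> c powi A i c else 1)" for \<tau> i
  define \<phi> where "\<phi> \<tau> = restrict (act (T \<tau>)) Y" for \<tau>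
  have nz: "\<tau> c \<noteq> 0" if "\<tau> \<in> carrier (torus n)" "c \<in> {..<n}" for \<tau> :: "nat \<Rightarrow> 'a" and c
    using that by (auto simp: torus_carrier)
  have TDD: "T \<tau> \<in> diag_group" if \<tau>: "\<tau> \<in> carrier (torus n)" for \<tau>
  proof -
    have "(\<Prod>i\<in>I. T \<tau> i powi \<kappa> i) = (\<Prod>i\<in>I. (\<Prod>c<n. \<tau> c powi A i c) powi \<kappa> i)"
      by (intro prod.cong) (auto simp: T_def)
    also have "\<dots> = (\<Prod>c<n. \<tau> c powi (\<Sum>i\<in>I. \<kappa> i * A i c))" by (rule monomial_map_compose[OF nz[OF \<tau>]])
    also have "\<dots> = 1" using A by (intro prod.neutral) auto
    finally show ?thesis using nz[OF \<tau>] by (subst diag_group) (auto simp: T_def)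
  qed
  have carr: "\<phi> \<tau> \<in> carrier (Aut {0..m} Y)" if "\<tau> \<in> carrier (torus n)" for \<tau>
    unfolding \<phi>_def by (rule diag_group_in_Aut[OF TDD[OF that]])
  have hom: "\<phi> \<in> hom (torus n) (Aut {0..m} Y)"
  proof (rule homI)
    fix \<sigma> \<tau> :: "nat \<Rightarrow> 'a" assume st: "\<sigma> \<in> carrier (torus n)" "\<tau> \<in> carrier (torus n)"
    have T: "T (\<sigma> \<otimes>\<^bsub>torus n\<^esub> \<tau>) i = T \<sigma> i * T \<tau> i" for i
      by (simp add: T_def torus_mult power_int_mult_distrib prod.distrib)
    have "\<phi> (\<sigma> \<otimes>\<^bsub>torus n\<^esub> \<tau>) = compose Y (\<phi> \<sigma>) (\<phi> \<tau>)"
    proof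
      fix x
      show "\<phi> (\<sigma> \<otimes>\<^bsub>torus n\<^esub> \<tau>) x = compose Y (\<phi> \<sigma>) (\<phi> \<tau>) x"
        using diag_group_act[OF TDD[OF st(2)], of x] T
        by (auto simp: \<phi>_def compose_def act_def fun_eq_iff mult.assoc)
    qed
    then show "\<phi> (\<sigma> \<otimes>\<^bsub>torus n\<^esub> \<tau>) = \<phi> \<sigma> \<otimes>\<^bsub>Aut {0..m} Y\<^esub> \<phi> \<tau>"
      using Aut_mult[OF carr[OF st(1)] carr[OF st(2)]] by simp
  qed (rule carr)
  have recover: "(\<Prod>i\<in>I. T \<tau> i powi B c i) = \<tau> c" if \<tau>: "\<tau> \<in> carrier (torus n)" and c: "c < n" for \<tau> c
  proof -
    have "(\<Prod>i\<in>I. T \<tau> i powi B c i) = (\<Prod>i\<in>I. (\<Prod>c<n. \<tau> c powi A i c) powi B c i)"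
      by (intro prod.cong) (auto simp: T_def)
    also have "\<dots> = (\<Prod>c'<n. \<tau> c' powi (\<Sum>i\<in>I. B c i * A i c'))" by (rule monomial_map_compose[OF nz[OF \<tau>]])
    also have "\<dots> = (\<Prod>c'<n. if c' = c then \<tau> c else 1)" using BA c by (intro prod.cong) auto
    finally show ?thesis using c by simp
  qed
  have inj: "inj_on \<phi> (carrier (torus n))"
  proof (rule inj_onI)
    fix \<sigma> \<tau> assume st: "\<sigma> \<in> carrier (torus n)" "\<tau> \<in> carrier (torus n)" "\<phi> \<sigma> = \<phi> \<tau>"
    have "act (T \<sigma>) x = act (T \<tau>) x" if "x \<in> Y" for x using fun_cong[OF st(3), of x] that by (simp add: \<phi>_def)
    then have "T \<sigma> i = T \<tau> i" if "i \<in> I" for i using act_determines[of "T \<sigma>" "T \<tau>" i] I(1) that by auto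
    then have "(\<Prod>i\<in>I. T \<sigma> i powi B c i) = (\<Prod>i\<in>I. T \<tau> i powi B c i)" for c by simp
    then have "\<sigma> c = \<tau> c" if "c < n" for c using recover[OF st(1) that] recover[OF st(2) that] by simp
    then show "\<sigma> = \<tau>" using st(1,2) by (intro PiE_ext) (auto simp: torus_carrier)
  qed
  have surj: "carrier (Aut {0..m} Y) \<subseteq> \<phi> ` carrier (torus n)"
  proof
    fix a assume a: "a \<in> carrier (Aut {0..m} Y)"
    obtain t' where t': "t' \<in> diag_group" "\<And>i. i \<le> m \<Longrightarrow> i \<notin> I \<Longrightarrow> t' i = 1" "\<And>x. x \<in> Y \<Longrightarrow> a x = act t' x"
      using diag[OF a] by blast
    define t where "t i = (if i \<in> I then t' i else 1)" for i
    have tt': "t i = t' i" if "i \<le> m" for i using t'(2) that by (simp add: t_def)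
    have t: "t \<in> diag_group" using t'(1) diag_group_cong[OF tt'] by simp
    have tnz: "t i \<noteq> 0" if "i \<in> I" for i using t I(1) that by (auto simp: diag_group_def)
    have tk: "(\<Prod>i\<in>I. t i powi \<kappa> i) = 1" using diag_group[of t] tnz t by (simp add: t_def)
    define \<tau> where "\<tau> = (\<lambda>c\<in>{..<n}. \<Prod>l\<in>I. t l powi B c l)"
    have \<tau>: "\<tau> \<in> carrier (torus n)" using tnz fin by (auto simp: torus_carrier \<tau>_def)
    have "T \<tau> i = t i" for i
    proof (cases "i \<in> I")
      case True
      have "T \<tau> i = (\<Prod>c<n. (\<Prod>l\<in>I. t l powi B c l) powi A i c)" using True by (simp add: T_def \<tau>_def)
      also have "\<dots> = (\<Prod>l\<in>I. t l powi (\<Sum>c<n. A i c * B c l))" by (rule monomial_map_compose[OF tnz])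
      also have "\<dots> = (\<Prod>l\<in>I. (if l = i then t i else 1) * (t l powi \<kappa> l) powi (- u i))"
      proof (intro prod.cong refl)
        fix l assume l: "l \<in> I"
        have "(\<Sum>c<n. A i c * B c l) = (if l = i then 1 else 0) + \<kappa> l * (- u i)"
          using AB[OF True l] by simp
        then show "t l powi (\<Sum>c<n. A i c * B c l) = (if l = i then t i else 1) * (t l powi \<kappa> l) powi (- u i)"
          using tnz[OF l] by (simp add: power_int_add power_int_mult del: mult_minus_right)
      qed
      also have "\<dots> = t i * (\<Prod>l\<in>I. t l powi \<kappa> l) powi (- u i)"
        using fin True by (simp add: prod.distrib power_int_prod)
      finally show ?thesis using tk by simp
    qed (simp add: T_def t_def)
    then have "act (T \<tau>) x = a x" if "x \<in> Y" for x using t'(3)[OF that] tt' by (auto simp: act_def)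
    moreover have "a \<in> extensional Y" using a by (simp add: Aut_def BijGroup_def Bij_def)
    ultimately have "a = \<phi> \<tau>" by (auto simp: \<phi>_def extensional_def restrict_def fun_eq_iff)
    then show "a \<in> \<phi> ` carrier (torus n)" using \<tau> by blast
  qed
  have "\<phi> \<in> iso (torus n) (Aut {0..m} Y)"
    using hom inj surj carr by (auto simp: iso_def bij_betw_def)
  moreover have "regular_on (torus_prod_coords n {0..m}) (carrier (torus n) \<times> Y) (\<lambda>(\<tau>, y). \<phi> \<tau> y i)"
    if i: "i \<in> {0..m}" for i
  proof -
    let ?G = "torus_prod_coords n {0..m} :: ((nat \<Rightarrow> 'a) \<times> (nat \<Rightarrow> 'a) \<Rightarrow> 'a) set"
    have y: "(\<lambda>p. snd p i) \<in> subalgebra ?G"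
      by (rule subalgebra.gen) (use i in \<open>auto simp: torus_prod_coords_def case_prod_unfold\<close>)
    have g: "(\<lambda>p. fst p c) \<in> subalgebra ?G" "(\<lambda>p. inverse (fst p c)) \<in> subalgebra ?G" if "c < n" for c
      by (rule subalgebra.gen, use that in \<open>auto simp: torus_prod_coords_def case_prod_unfold\<close>)+
    have pw: "(\<lambda>p. fst p c powi e) \<in> subalgebra ?G" if "c < n" for c and e :: int
      using subalgebra_power[OF g(1)[OF that], of "nat e"] subalgebra_power[OF g(2)[OF that], of "nat (- e)"]
      by (cases "e \<ge> 0") (simp_all add: power_int_def)
    have "(\<lambda>p. T (fst p) i) \<in> subalgebra ?G"
      unfolding T_def using pw by (cases "i \<in> I") (auto intro!: subalgebra_prod subalgebra.const)
    then have "(\<lambda>p. T (fst p) i * snd p i) \<in> subalgebra ?G" using y by (rule subalgebra.mult)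
    then show ?thesis unfolding regular_on_def
      by (rule bexI[rotated]) (use i in \<open>auto simp: \<phi>_def\<close>)
  qed
  ultimately show ?thesis unfolding Aut_is_torus_def by blast
qed

lemma torus_if_power:
  assumes inj: "inj_on k {1..m}" and P: "P = monom 1 d" and gcd: "Gcd (insert d (k ` {1..m})) = 1"
  shows "Aut_is_torus {0..m} Y"
proof -
  have I: "{0..m} = insert 0 {1..m}" by auto
  show ?thesis
  proof (rule torus_if_diagonal[of "{0..m}" m full_exp])
    show "Gcd (full_exp ` {0..m}) = 1" using Gcd_full_exp gcd by simp
    fix t :: "nat \<Rightarrow> 'a" assume t: "\<And>i. i \<in> {0..m} \<Longrightarrow> t i \<noteq> 0"
    have "(\<Prod>i\<in>{0..m}. t i powi full_exp i) = inverse (t 0 ^ d) * ymon k t"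
      unfolding I by (simp add: full_exp_def power_int_minus ymon_def)
    then have "(\<Prod>i\<in>{0..m}. t i powi full_exp i) = 1 \<longleftrightarrow> ymon k t = t 0 ^ d"
      using t[of 0] by (auto simp: field_simps)
    also have "\<dots> \<longleftrightarrow> t \<in> diag_group"
    proof
      assume "ymon k t = t 0 ^ d"
      then have "ymon k t * poly P z = poly P (t 0 * z)" for z
        by (simp add: P poly_monom power_mult_distrib)
      then show "t \<in> diag_group" using t by (simp add: diag_group_def)
    qed (rule diag_group_ymon_k(1))
    finally show "t \<in> diag_group \<longleftrightarrow> (\<Prod>i\<in>{0..m}. t i powi full_exp i) = 1" by simp
  next
    fix a assume "a \<in> carrier (Aut {0..m} Y)"
    then obtain f g where "suspension_automorphism m d k P a (inv_into Y a) f g" by (rule Aut_automorphism)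
    then show "\<exists>t\<in>diag_group. (\<forall>i\<le>m. i \<notin> {0..m} \<longrightarrow> t i = 1) \<and> (\<forall>x\<in>Y. a x = act t x)"
      using suspension_automorphism.diagonal_if_power[OF _ P gcd inj] by fastforce
  qed simp_all
qed

lemma torus_if_no_symmetry:
  assumes inj: "inj_on k {1..m}" and gcd: "Gcd (k ` {1..m}) = 1"
    and no_sym: "\<nexists>v. v > 1 \<and> (\<exists>u Q. P = monom 1 u * pcompose Q (monom 1 v))"
  shows "Aut_is_torus {0..m} Y"
proof (rule torus_if_diagonal[of "{1..m}" "m - 1" "\<lambda>i. int (k i)"])
  show "Gcd ((\<lambda>i. int (k i)) ` {1..m}) = 1"
    using gcd Gcd_int_eq[of "k ` {1..m}"] by (simp add: image_image)
  fix t :: "nat \<Rightarrow> 'a" assume t: "\<And>i. i \<in> {1..m} \<Longrightarrow> t i \<noteq> 0" "\<And>i. i \<notin> {1..m} \<Longrightarrow> t i = 1"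
  have t0: "t 0 = 1" using t(2) by simp
  have "t i \<noteq> 0" for i using t by (cases "i \<in> {1..m}") auto
  then have "t \<in> diag_group \<longleftrightarrow> ymon k t = 1" using diag_group_ymon_k(1)[of t] t0 by (auto simp: diag_group_def)
  then show "t \<in> diag_group \<longleftrightarrow> (\<Prod>i\<in>{1..m}. t i powi int (k i)) = 1" by (simp add: ymon_def)
next
  fix a assume "a \<in> carrier (Aut {0..m} Y)"
  then obtain f g where "suspension_automorphism m d k P a (inv_into Y a) f g" by (rule Aut_automorphism)
  then obtain t where t: "t \<in> diag_group" "t 0 = 1" "\<forall>x\<in>Y. a x = act t x"
    using suspension_automorphism.diagonal_if_no_symmetry[OF _ inj gcd no_sym] by blast
  moreover have "\<forall>i\<le>m. i \<notin> {1..m} \<longrightarrow> t i = 1" using t(2) by (metis atLeastAtMost_iff less_one not_le)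
  ultimately show "\<exists>t\<in>diag_group. (\<forall>i\<le>m. i \<notin> {1..m} \<longrightarrow> t i = 1) \<and> (\<forall>x\<in>Y. a x = act t x)" by blast
qed (use m in auto)

end

theorem corollary5p6:
  fixes P :: "'a::{alg_closed_field, field_char_0} poly"
    and m d :: nat and k :: "nat \<Rightarrow> nat"
  assumes "m \<ge> 1"
    and "\<And>i. i \<in> {1..m} \<Longrightarrow> k i \<ge> 2"
    and "d \<ge> 2" and "degree P = d" and "lead_coeff P = 1" and "coeff P (d - 1) = 0"
  shows "Aut_is_torus {0..m} (suspension m k P) \<longleftrightarrow>
    inj_on k {1..m} \<and>
    ((P = monom 1 d \<and> Gcd (insert d (k ` {1..m})) = 1) \<or>
     ((\<nexists>v. v > 1 \<and> (\<exists>u Q. P = monom 1 u * pcompose Q (monom 1 v))) \<and>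
      Gcd (k ` {1..m}) = 1))"
proof -
  interpret suspension_data m d k P
    using assms by unfold_locales auto
  show ?thesis
    using conditions_if_torus torus_if_power torus_if_no_symmetry by blast
qed

end
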